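(* Let $b,d$ be integers with $2\le b\le d$, let $(\epsilon_1,\epsilon_2,\epsilon_3,\epsilon_4,\epsilon_5)\in\{0,1\}^5$, and let $\alpha_i\in\mathbb{Z}$ for $\check n_{b-1}+1\le i\le \check n_d$. Suppose that for every $j\in\{1,2,3,4,5\}$ with $\epsilon_j=1$, $$\sum_{\check n_{b-1}+1\le i\le \check n_d}\alpha_i\,\tilde x^*_i(r^* )=0\qquad\text{for each } r^*\in \check R_j(b,d).$$ Then $\sum_{\check n_{b-1}+1\le i\le \check n_d}\alpha_i x^*_i$ is an integer-valued invariant of oriented spherical curves under the deformations corresponding to $\epsilon_j=1$; that is, whenever oriented spherical curves $P^\epsilon$ and $P'^\epsilon$ are related by a single deformation of the type corresponding to some $j$ with $\epsilon_j=1$, one has $\sum_i\alpha_i x^*_i(P^\epsilon)=\sum_i\alpha_i x^*_i(P'^\epsilon)$. If, in addition, for each mirroring pair $(x^*_i,x^*_j)$ (with $\check n_{b-1}+1\le i,j\le\check n_d$) at least one of the following holds: (1) $\alpha_i=\alpha_j$, or (2) $(x^*_i,x^*_j)$ is reflective, then $\sum_{\check n_{b-1}+1\le i\le \check n_d}\alpha_i x^*_i$ is an integer-valued invariant of (unoriented) spherical curves under the deformations corresponding to $\epsilon_j=1$; that is, its value moreover does not depend on the choice of orientation of the curve.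
   Context: **Oriented Gauss words and arrow diagrams.** A Gauss word of length $2n$ is a word of length $2n$ in positive integers in which every letter occurring occurs exactly twice. An oriented Gauss word $v^*$ is a Gauss word in which, for each letter $k$, one of the two occurrences is declared the starting point (written $k$) and the other the end point (written $\bar k$). Let $\mathrm{cyc},\mathrm{rev}$ be the maps of $\{1,\dots,2n\}$ with $\mathrm{cyc}(p)\equiv p+1$, $\mathrm{rev}(p)\equiv -p+1 \pmod{2n}$. Two oriented Gauss words $v^*,w^*$ of length $2n$ are isomorphic if there are $t\in\mathbb{Z}$ and a bijection $f$ from the letters of $v^*$ to those of $w^*$ with $w^*\circ \mathrm{cyc}^t=f^*\circ v^*$, where $f^*(k)=f(k)$, $f^*(\bar k)=\overline{f(k)}$. The isomorphism class of $v^*$ is denoted $[[v^*]]$ and is called an arrow diagram with $n$ arrows (geometrically: $n$ arrows joining $2n$ distinct points of an oriented circle, read along the circle). Words may be empty. $\mathrm{Sub}(v^* )$ is the set of oriented sub-Gauss words of $v^*$, each obtained by choosing a set of letters and deleting both occurrences of each of them. **Enumeration.** $\check G_{<\infty}$ is the set of all arrow diagrams, $\check G_{\le d}$ the set of those with at most $d$ arrows, $\check n_d=|\check G_{\le d}|$. The arrow diagrams are enumerated as $x^*_1,x^*_2,\dots$ with nondecreasing number of arrows, so $\check G_{\le d}=\{x^*_1,\dots,x^*_{\check n_d}\}$. For $2\le b\le d$, $\check G_{b,d}=\check G_{\le d}\setminus\check G_{\le b-1}=\{x^*_i\}_{\check n_{b-1}+1\le i\le\check n_d}$. $\mathbb{Z}[\check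 G_{\le l}]$ and $\mathbb{Z}[\check G_{b,d}]$ denote the free $\mathbb{Z}$-modules on these sets. **Functions.** For an arrow diagram $x^*$, $\tilde x^*$ is the $\mathbb{Z}$-linear function on $\bigcup_{l\ge1}\mathbb{Z}[\check G_{\le l}]$ with $\tilde x^*(z^* )=1$ if $z^*=x^*$ and $0$ otherwise, for arrow diagrams $z^*$. For an arrow diagram $AD=[[G^*]]$, $x^*(AD)=|\{H^*\in\mathrm{Sub}(G^* ): [[H^*]]=x^*\}|$ (independent of the choice of $G^*$). **Spherical curves.** A spherical curve $P$ is the image of a generic immersion $g:S^1\to S^2$ ($S^2$ oriented; only transverse double points), considered up to ambient isotopy; $P^\epsilon$ ($\epsilon=\pm$) denotes $P$ with one of its two orientations. Replace each double point of $P^\epsilon$ by a positive crossing: the over-branch is the one for which (tangent of over-branch, tangent of under-branch) is a positively oriented frame. The arrow diagram $AD_{P^\epsilon}$ is the arrow diagram on $S^1$ having, for each double point, an arrow joining its two preimages under $g$, with starting point on the over-branch and end point on the under-branch. Put $x^*(P^\epsilon)=x^*(AD_{P^\epsilon})$, and $\left(\sum_i\alpha_ix^*_i\right)(P^\epsilon)=\sum_i\alpha_i x^*_i(P^\epsilon)$. **Deformations.** RI: creation/removal of a monogon (Reidemeister move $\Omega_1$ without over/under information). RII: creation/removal of a bigon between two arcs ($\Omega_2$ without over/under information); it is strong if the two sides of the bigon are coherently oriented by the curve (the two arcs are antiparallel) and weak otherwise. RIII: the triangle move ($\Omega_3$ without over/under information); it is strong if the three sides of the triangle are coherently oriented by the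 curve and weak otherwise. The index $j=1,2,3,4,5$ corresponds to RI, strong RII, weak RII, strong RIII, weak RIII respectively. **Relators.** Let $S,T,U$ denote (possibly empty) words and $i,j,k$ distinct letters not occurring in them. - $\check R_1$ (Type $\check{\mathrm I}$): all $[[Si\bar i]]$ and $[[S\bar i i]]$, $S$ an oriented Gauss word. - $\check R_2$ (strong RII): all $[[Si\bar jTj\bar i]]+[[SiT\bar i]]+[[S\bar jTj]]$ and $[[S\bar ijT\bar ji]]+[[S\bar iTi]]+[[SjT\bar j]]$, with $ST$ an oriented Gauss word. - $\check R_3$ (weak RII): all $[[S\bar ijTi\bar j]]+[[S\bar iTi]]+[[SjT\bar j]]$, with $ST$ an oriented Gauss word. - $\check R_4$ (strong RIII): with $STU$ an oriented Gauss word, all $([[S\bar ijT\bar kiU\bar jk]]+[[S\bar ijTiU\bar j]]+[[S\bar iT\bar kiUk]]+[[SjT\bar kU\bar jk]])-([[Sj\bar iTi\bar kUk\bar j]]+[[Sj\bar iTiU\bar j]]+[[S\bar iTi\bar kUk]]+[[SjT\bar kUk\bar j]])$ and $([[Sk\bar jTi\bar kUj\bar i]]+[[S\bar jTiUj\bar i]]+[[SkTi\bar kU\bar i]]+[[Sk\bar jT\bar kUj]])-([[S\bar jkT\bar kiU\bar ij]]+[[S\bar jTiU\bar ij]]+[[SkT\bar kiU\bar i]]+[[S\bar jkT\bar kUj]])$. - $\check R_5$ (weak RIII): with $STU$ an oriented Gauss word, all $([[S\bar i\,\bar jTi\bar kUjk]]+[[S\bar i\,\bar jTiUj]]+[[S\bar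 iTi\bar kUk]]+[[S\bar jT\bar kUjk]])-([[S\bar j\,\bar iT\bar kiUkj]]+[[S\bar j\,\bar iTiUj]]+[[S\bar iT\bar kiUk]]+[[S\bar jT\bar kUkj]])$ and $([[SkjT\bar kiU\bar j\,\bar i]]+[[SjTiU\bar j\,\bar i]]+[[SkT\bar kiU\bar i]]+[[SkjT\bar kU\bar j]])-([[SjkTi\bar kU\bar i\,\bar j]]+[[SjTiU\bar i\,\bar j]]+[[SkTi\bar kU\bar i]]+[[SjkT\bar kU\bar j]])$. $\check O_{b,d}$ is the linear projection $\bigcup_l\mathbb{Z}[\check G_{\le l}]\to\mathbb{Z}[\check G_{b,d}]$ (killing all diagrams not in $\check G_{b,d}$), and $\check R_j(b,d)=\check O_{b,d}(\check R_j)$. **Mirroring and reflective pairs.** $(x^*_i,x^*_j)$ is a mirroring pair if there are oriented Gauss words $v^*,w^*$ with $[[v^*]]=x^*_i$, $[[w^*]]=x^*_j$, $v^*=w^*\circ\mathrm{rev}$. A mirroring pair is reflective if $x^*_i(P^\epsilon)=x^*_j(P^\epsilon)$ for every oriented spherical curve $P^\epsilon$. *)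

theory Defs
  imports "HOL-Analysis.Analysis" "HOL-Library.Poly_Mapping"
begin

section \<open>Oriented Gauss words and arrow diagrams\<close>

text \<open>\<open>Start k\<close> is the starting point written $k$, and \<open>End k\<close> the end point written $\bar k$.
  The map $f^*$ induced by a map $f$ of letters is \<open>map_endpoint f\<close>.\<close>

datatype 'a endpoint = Start (letter: 'a) | End (letter: 'a)

type_synonym gword = "nat endpoint list"

definition letters :: "gword \<Rightarrow> nat set" where
  "letters v = letter ` set v"

definition oriented_gauss_word :: "gword \<Rightarrow> bool" where
  "oriented_gauss_word v \<longleftrightarrow>
     distinct v \<and> (\<forall>k\<in>letters v. 0 < k \<and> Start k \<in> set v \<and> End k \<in> set v)"

text \<open>\<open>rotate t w\<close> is the word $w \circ \mathrm{cyc}^t$. As $\mathrm{cyc}$ has finite order,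
  natural exponents are enough.\<close>

definition isomorphic_words :: "gword \<Rightarrow> gword \<Rightarrow> bool" where
  "isomorphic_words v w \<longleftrightarrow>
     length v = length w \<and>
     (\<exists>t f. bij_betw f (letters v) (letters w) \<and> rotate t w = map (map_endpoint f) v)"

type_synonym diagram = "gword set"

definition arrow_diagram :: "gword \<Rightarrow> diagram" where
  "arrow_diagram v = {w. oriented_gauss_word w \<and> isomorphic_words v w}"

definition all_diagrams :: "diagram set" where
  "all_diagrams = arrow_diagram ` {v. oriented_gauss_word v}"

definition representative :: "diagram \<Rightarrow> gword" where
  "representative X = (SOME v. oriented_gauss_word v \<and> arrow_diagram v = X)"

definition num_arrows :: "diagram \<Rightarrow> nat" where
  "num_arrows X = card (letters (representative X))"

definition diagrams_le :: "nat \<Rightarrow> diagram set" where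
  "diagrams_le d = {X \<in> all_diagrams. num_arrows X \<le> d}"

definition n_check :: "nat \<Rightarrow> nat" where
  "n_check d = card (diagrams_le d)"

definition diagrams_between :: "nat \<Rightarrow> nat \<Rightarrow> diagram set" where
  "diagrams_between b d = diagrams_le d - diagrams_le (b - 1)"

definition diagram_enumeration :: "(nat \<Rightarrow> diagram) \<Rightarrow> bool" where
  "diagram_enumeration x \<longleftrightarrow>
     bij_betw x {1..} all_diagrams \<and>
     (\<forall>i j. 1 \<le> i \<and> i \<le> j \<longrightarrow> num_arrows (x i) \<le> num_arrows (x j))"

definition sub_words :: "gword \<Rightarrow> gword set" where
  "sub_words v = {filter (\<lambda>e. letter e \<notin> K) v | K. K \<subseteq> letters v}"

definition diagram_count :: "diagram \<Rightarrow> diagram \<Rightarrow> nat" where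
  "diagram_count x AD = card {H \<in> sub_words (representative AD). arrow_diagram H = x}"

definition mirroring_pair :: "diagram \<Rightarrow> diagram \<Rightarrow> bool" where
  "mirroring_pair x y \<longleftrightarrow>
     (\<exists>v w. oriented_gauss_word v \<and> oriented_gauss_word w \<and>
            arrow_diagram v = x \<and> arrow_diagram w = y \<and> v = rev w)"


section \<open>Free modules on arrow diagrams and relators\<close>

definition tilde :: "diagram \<Rightarrow> (diagram \<Rightarrow>\<^sub>0 int) \<Rightarrow> int" where
  "tilde x z = (\<Sum>y\<in>Poly_Mapping.keys z. Poly_Mapping.lookup z y * (if y = x then 1 else 0))"

definition O_proj :: "nat \<Rightarrow> nat \<Rightarrow> (diagram \<Rightarrow>\<^sub>0 int) \<Rightarrow> (diagram \<Rightarrow>\<^sub>0 int)" where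
  "O_proj b d = frag_extend (\<lambda>x. if x \<in> diagrams_between b d then frag_of x else 0)"

abbreviation ad :: "gword \<Rightarrow> (diagram \<Rightarrow>\<^sub>0 int)" where
  "ad v \<equiv> frag_of (arrow_diagram v)"

definition fresh_letters :: "nat list \<Rightarrow> gword \<Rightarrow> bool" where
  "fresh_letters ks v \<longleftrightarrow> distinct ks \<and> (\<forall>k\<in>set ks. 0 < k \<and> k \<notin> letters v)"

datatype deformation = RI | strong_RII | weak_RII | strong_RIII | weak_RIII

definition relators_RI :: "(diagram \<Rightarrow>\<^sub>0 int) set" where
  "relators_RI =
     {r. \<exists>S i. oriented_gauss_word S \<and> fresh_letters [i] S \<and>
        (r = ad (S @ [Start i, End i]) \<or> r = ad (S @ [End i, Start i]))}"

definition relators_strong_RII :: "(diagram \<Rightarrow>\<^sub>0 int) set" where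
  "relators_strong_RII =
     {r. \<exists>S T i j. oriented_gauss_word (S @ T) \<and> fresh_letters [i, j] (S @ T) \<and>
        (r = ad (S @ [Start i, End j] @ T @ [Start j, End i])
           + ad (S @ [Start i] @ T @ [End i])
           + ad (S @ [End j] @ T @ [Start j])
       \<or> r = ad (S @ [End i, Start j] @ T @ [End j, Start i])
           + ad (S @ [End i] @ T @ [Start i])
           + ad (S @ [Start j] @ T @ [End j]))}"

definition relators_weak_RII :: "(diagram \<Rightarrow>\<^sub>0 int) set" where
  "relators_weak_RII =
     {r. \<exists>S T i j. oriented_gauss_word (S @ T) \<and> fresh_letters [i, j] (S @ T) \<and>
         r = ad (S @ [End i, Start j] @ T @ [Start i, End j])
           + ad (S @ [End i] @ T @ [Start i])
           + ad (S @ [Start j] @ T @ [End j])}"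

definition relators_strong_RIII :: "(diagram \<Rightarrow>\<^sub>0 int) set" where
  "relators_strong_RIII =
     {r. \<exists>S T U i j k. oriented_gauss_word (S @ T @ U) \<and> fresh_letters [i, j, k] (S @ T @ U) \<and>
        (r = (ad (S @ [End i, Start j] @ T @ [End k, Start i] @ U @ [End j, Start k])
            + ad (S @ [End i, Start j] @ T @ [Start i] @ U @ [End j])
            + ad (S @ [End i] @ T @ [End k, Start i] @ U @ [Start k])
            + ad (S @ [Start j] @ T @ [End k] @ U @ [End j, Start k]))
           - (ad (S @ [Start j, End i] @ T @ [Start i, End k] @ U @ [Start k, End j])
            + ad (S @ [Start j, End i] @ T @ [Start i] @ U @ [End j])
            + ad (S @ [End i] @ T @ [Start i, End k] @ U @ [Start k])
            + ad (S @ [Start j] @ T @ [End k] @ U @ [Start k, End j]))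
       \<or> r = (ad (S @ [Start k, End j] @ T @ [Start i, End k] @ U @ [Start j, End i])
            + ad (S @ [End j] @ T @ [Start i] @ U @ [Start j, End i])
            + ad (S @ [Start k] @ T @ [Start i, End k] @ U @ [End i])
            + ad (S @ [Start k, End j] @ T @ [End k] @ U @ [Start j]))
           - (ad (S @ [End j, Start k] @ T @ [End k, Start i] @ U @ [End i, Start j])
            + ad (S @ [End j] @ T @ [Start i] @ U @ [End i, Start j])
            + ad (S @ [Start k] @ T @ [End k, Start i] @ U @ [End i])
            + ad (S @ [End j, Start k] @ T @ [End k] @ U @ [Start j])))}"

definition relators_weak_RIII :: "(diagram \<Rightarrow>\<^sub>0 int) set" where
  "relators_weak_RIII =
     {r. \<exists>S T U i j k. oriented_gauss_word (S @ T @ U) \<and> fresh_letters [i, j, k] (S @ T @ U) \<and>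
        (r = (ad (S @ [End i, End j] @ T @ [Start i, End k] @ U @ [Start j, Start k])
            + ad (S @ [End i, End j] @ T @ [Start i] @ U @ [Start j])
            + ad (S @ [End i] @ T @ [Start i, End k] @ U @ [Start k])
            + ad (S @ [End j] @ T @ [End k] @ U @ [Start j, Start k]))
           - (ad (S @ [End j, End i] @ T @ [End k, Start i] @ U @ [Start k, Start j])
            + ad (S @ [End j, End i] @ T @ [Start i] @ U @ [Start j])
            + ad (S @ [End i] @ T @ [End k, Start i] @ U @ [Start k])
            + ad (S @ [End j] @ T @ [End k] @ U @ [Start k, Start j]))
       \<or> r = (ad (S @ [Start k, Start j] @ T @ [End k, Start i] @ U @ [End j, End i])
            + ad (S @ [Start j] @ T @ [Start i] @ U @ [End j, End i])
            + ad (S @ [Start k] @ T @ [End k, Start i] @ U @ [End i])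
            + ad (S @ [Start k, Start j] @ T @ [End k] @ U @ [End j]))
           - (ad (S @ [Start j, Start k] @ T @ [Start i, End k] @ U @ [End i, End j])
            + ad (S @ [Start j] @ T @ [Start i] @ U @ [End i, End j])
            + ad (S @ [Start k] @ T @ [Start i, End k] @ U @ [End i])
            + ad (S @ [Start j, Start k] @ T @ [End k] @ U @ [End j])))}"

fun relators :: "deformation \<Rightarrow> (diagram \<Rightarrow>\<^sub>0 int) set" where
  "relators RI = relators_RI"
| "relators strong_RII = relators_strong_RII"
| "relators weak_RII = relators_weak_RII"
| "relators strong_RIII = relators_strong_RIII"
| "relators weak_RIII = relators_weak_RIII"

definition relators_between :: "deformation \<Rightarrow> nat \<Rightarrow> nat \<Rightarrow> (diagram \<Rightarrow>\<^sub>0 int) set" where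
  "relators_between j b d = O_proj b d ` relators j"


section \<open>Oriented spherical curves\<close>

text \<open>The circle is $\mathbb{R}/\mathbb{Z}$ and $S^2$ is the unit sphere of $\mathbb{R}^3$, oriented
  by the outward normal: a tangent frame $(u,v)$ at $p$ is positive iff $\det(p,u,v) > 0$.
  An oriented spherical curve is given by a parametrization, taken up to \<open>same_curve\<close> below.
  Immersions, diffeomorphisms and isotopies are of class $C^1$.\<close>

definition double_points :: "(real \<Rightarrow> real^3) \<Rightarrow> real set" where
  "double_points g = {t\<in>{0..<1}. \<exists>s\<in>{0..<1}. s \<noteq> t \<and> g s = g t}"

definition spherical_curve :: "(real \<Rightarrow> real^3) \<Rightarrow> bool" where
  "spherical_curve g \<longleftrightarrow>
     (\<forall>t. g (t + 1) = g t) \<and> range g \<subseteq> sphere 0 1 \<and>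
     g C1_differentiable_on UNIV \<and> (\<forall>t. vector_derivative g (at t) \<noteq> 0) \<and>
     finite (double_points g) \<and>
     (\<forall>r\<in>{0..<1}. \<forall>s\<in>{0..<1}. \<forall>t\<in>{0..<1}.
        g r = g s \<and> g s = g t \<longrightarrow> r = s \<or> s = t \<or> r = t) \<and>
     (\<forall>s\<in>{0..<1}. \<forall>t\<in>{0..<1}. s \<noteq> t \<and> g s = g t \<longrightarrow>
        \<not> collinear {0, vector_derivative g (at s), vector_derivative g (at t)})"

definition reversed :: "(real \<Rightarrow> real^3) \<Rightarrow> real \<Rightarrow> real^3" where
  "reversed g = (\<lambda>t. g (- t))"

text \<open>\<open>\<Phi>\<close> is a $C^1$ family of diffeomorphisms of the sphere starting at the identity. Derivatives
  are taken within the sphere, so only the restriction of \<open>D t x\<close> to the tangent plane at \<open>x\<close>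
  is determined.\<close>

definition ambient_isotopy :: "(real \<Rightarrow> real^3 \<Rightarrow> real^3) \<Rightarrow> bool" where
  "ambient_isotopy \<Phi> \<longleftrightarrow>
     continuous_on ({0..1} \<times> sphere 0 1) (\<lambda>(t, x). \<Phi> t x) \<and>
     (\<forall>x\<in>sphere 0 1. \<Phi> 0 x = x) \<and>
     (\<forall>t\<in>{0..1}. bij_betw (\<Phi> t) (sphere 0 1) (sphere 0 1)) \<and>
     (\<exists>D :: real \<Rightarrow> real^3 \<Rightarrow> ((real^3) \<Rightarrow>\<^sub>L (real^3)).
        continuous_on ({0..1} \<times> sphere 0 1) (\<lambda>(t, x). D t x) \<and>
        (\<forall>t\<in>{0..1}. \<forall>x\<in>sphere 0 1.
           (\<Phi> t has_derivative blinfun_apply (D t x)) (at x within sphere 0 1) \<and>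
           (\<forall>v. v \<bullet> x = 0 \<and> v \<noteq> 0 \<longrightarrow> blinfun_apply (D t x) v \<noteq> 0)))"

definition circle_reparametrization :: "(real \<Rightarrow> real) \<Rightarrow> bool" where
  "circle_reparametrization \<rho> \<longleftrightarrow>
     \<rho> C1_differentiable_on UNIV \<and> (\<forall>t. 0 < deriv \<rho> t) \<and> (\<forall>t. \<rho> (t + 1) = \<rho> t + 1)"

definition same_curve :: "(real \<Rightarrow> real^3) \<Rightarrow> (real \<Rightarrow> real^3) \<Rightarrow> bool" where
  "same_curve g h \<longleftrightarrow>
     (\<exists>\<Phi> \<rho>. ambient_isotopy \<Phi> \<and> circle_reparametrization \<rho> \<and> (\<forall>t. h (\<rho> t) = \<Phi> 1 (g t)))"


section \<open>The arrow diagram of an oriented spherical curve\<close>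

definition over_branch :: "(real \<Rightarrow> real^3) \<Rightarrow> real \<Rightarrow> bool" where
  "over_branch g t \<longleftrightarrow>
     (\<exists>s\<in>{0..<1}. s \<noteq> t \<and> g s = g t \<and>
        0 < g t \<bullet> cross3 (vector_derivative g (at t)) (vector_derivative g (at s)))"

text \<open>The letter of a double point \<open>p\<close> is the position (counted from 1) of the first passage
  of \<open>g\<close> through \<open>p\<close> in the ordered list of all passages through double points.\<close>

definition double_point_letter :: "(real \<Rightarrow> real^3) \<Rightarrow> real^3 \<Rightarrow> nat" where
  "double_point_letter g p =
     Suc (LEAST n. g (sorted_list_of_set (double_points g) ! n) = p)"

definition curve_word :: "(real \<Rightarrow> real^3) \<Rightarrow> gword" where
  "curve_word g =
     map (\<lambda>t. if over_branch g t then Start (double_point_letter g (g t))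
              else End (double_point_letter g (g t)))
       (sorted_list_of_set (double_points g))"

definition curve_diagram :: "(real \<Rightarrow> real^3) \<Rightarrow> diagram" where
  "curve_diagram g = arrow_diagram (curve_word g)"

definition curve_count :: "diagram \<Rightarrow> (real \<Rightarrow> real^3) \<Rightarrow> nat" where
  "curve_count x g = diagram_count x (curve_diagram g)"

definition reflective_pair :: "diagram \<Rightarrow> diagram \<Rightarrow> bool" where
  "reflective_pair x y \<longleftrightarrow>
     mirroring_pair x y \<and> (\<forall>g. spherical_curve g \<longrightarrow> curve_count x g = curve_count y g)"


section \<open>Deformations\<close>

abbreviation model_square :: "(real \<times> real) set" where
  "model_square \<equiv> {-1..1} \<times> {-1..1}"

text \<open>A $C^1$ embedding into the sphere of a neighbourhood of the square. It may preserve or reverse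
  orientation, so the mirror images of the models below are included.\<close>

definition square_chart :: "(real \<times> real \<Rightarrow> real^3) \<Rightarrow> bool" where
  "square_chart \<psi> \<longleftrightarrow>
     (\<exists>U. open U \<and> model_square \<subseteq> U \<and> inj_on \<psi> U \<and> \<psi> ` U \<subseteq> sphere 0 1 \<and>
        (\<exists>D :: real \<times> real \<Rightarrow> ((real \<times> real) \<Rightarrow>\<^sub>L (real^3)).
           continuous_on U D \<and>
           (\<forall>z\<in>U. (\<psi> has_derivative blinfun_apply (D z)) (at z) \<and> inj (blinfun_apply (D z)))))"

text \<open>\<open>local_change as bs \<sigma> g h\<close>: in a disk of the sphere, identified with the square, the curve
  \<open>g\<close> consists of the model arcs \<open>as\<close>, traversed during disjoint time intervals; \<open>h\<close> is obtained
  by replacing them with the model arcs \<open>bs\<close>. Model arcs are parametrized by $[-1,1]$, and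
  \<open>\<sigma> n = 1\<close> or \<open>\<sigma> n = -1\<close> tells whether the \<open>n\<close>-th arc is traversed in this direction or
  backwards. Arcs \<open>as ! n\<close> and \<open>bs ! n\<close> agree to first order at the endpoints. Up to rotating the
  parameter circle, the intervals can be taken inside $(0,1)$, in any order.\<close>

definition local_change ::
  "(real \<Rightarrow> real \<times> real) list \<Rightarrow> (real \<Rightarrow> real \<times> real) list \<Rightarrow> (nat \<Rightarrow> real) \<Rightarrow>
   (real \<Rightarrow> real^3) \<Rightarrow> (real \<Rightarrow> real^3) \<Rightarrow> bool" where
  "local_change as bs \<sigma> g h \<longleftrightarrow>
     (\<exists>\<psi> l r.
        square_chart \<psi> \<and>
        (\<forall>n<length as. \<sigma> n \<in> {-1, 1} \<and> 0 < l n \<and> l n < r n \<and> r n < 1) \<and>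
        (\<forall>m<length as. \<forall>n<length as. m \<noteq> n \<longrightarrow> {l m..r m} \<inter> {l n..r n} = {}) \<and>
        (\<forall>n<length as. \<forall>t\<in>{l n..r n}.
           g t = \<psi> ((as ! n) (\<sigma> n * ((2 * t - l n - r n) / (r n - l n)))) \<and>
           h t = \<psi> ((bs ! n) (\<sigma> n * ((2 * t - l n - r n) / (r n - l n))))) \<and>
        (\<forall>t\<in>{0..1} - (\<Union>n<length as. {l n..r n}). h t = g t \<and> g t \<notin> \<psi> ` model_square))"

text \<open>RI: an arc without double point becomes an arc with one small loop (the parameters
  $\pm s$ with $(1 - s^2)^2 = 1/2$ give the double point).\<close>

definition RI_before :: "(real \<Rightarrow> real \<times> real) list" where
  "RI_before = [\<lambda>s. (s, 0)]"

definition RI_after :: "(real \<Rightarrow> real \<times> real) list" where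
  "RI_after = [\<lambda>s. (s * (1 - 2 * (1 - s\<^sup>2)\<^sup>2), (1 - s\<^sup>2)\<^sup>2 / 2)]"

text \<open>RII: two disjoint arcs become two arcs meeting in two points and bounding a bigon.\<close>

definition RII_before :: "(real \<Rightarrow> real \<times> real) list" where
  "RII_before = [\<lambda>s. (s, 0), \<lambda>s. (s, 1 / 2)]"

definition RII_after :: "(real \<Rightarrow> real \<times> real) list" where
  "RII_after = [\<lambda>s. (s, 0), \<lambda>s. (s, 1 / 2 - (1 - s\<^sup>2)\<^sup>2)]"

text \<open>RIII: the third arc passes above, respectively below, the crossing of the first two.\<close>

definition RIII_before :: "(real \<Rightarrow> real \<times> real) list" where
  "RIII_before = [\<lambda>s. (s, s / 2), \<lambda>s. (s, - s / 2), \<lambda>s. (s, (1 - s\<^sup>2)\<^sup>2 / 2)]"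

definition RIII_after :: "(real \<Rightarrow> real \<times> real) list" where
  "RIII_after = [\<lambda>s. (s, s / 2), \<lambda>s. (s, - s / 2), \<lambda>s. (s, - (1 - s\<^sup>2)\<^sup>2 / 2)]"

text \<open>Running once around the bigon in \<open>RII_after\<close>, one follows one arc to the right and the
  other to the left. Running once around the triangle in \<open>RIII_before\<close> or \<open>RIII_after\<close>,
  one follows the first two arcs in the same horizontal direction and the third in the opposite
  one. This is what coherence of the sides means in terms of \<open>\<sigma>\<close>.\<close>

definition coherent_bigon :: "(nat \<Rightarrow> real) \<Rightarrow> bool" where
  "coherent_bigon \<sigma> \<longleftrightarrow> \<sigma> 1 = - \<sigma> 0"

definition coherent_triangle :: "(nat \<Rightarrow> real) \<Rightarrow> bool" where
  "coherent_triangle \<sigma> \<longleftrightarrow> \<sigma> 1 = \<sigma> 0 \<and> \<sigma> 2 = - \<sigma> 0"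

fun elementary_move :: "deformation \<Rightarrow> (real \<Rightarrow> real^3) \<Rightarrow> (real \<Rightarrow> real^3) \<Rightarrow> bool" where
  "elementary_move RI g h \<longleftrightarrow> (\<exists>\<sigma>. local_change RI_before RI_after \<sigma> g h)"
| "elementary_move strong_RII g h \<longleftrightarrow>
     (\<exists>\<sigma>. coherent_bigon \<sigma> \<and> local_change RII_before RII_after \<sigma> g h)"
| "elementary_move weak_RII g h \<longleftrightarrow>
     (\<exists>\<sigma>. \<not> coherent_bigon \<sigma> \<and> local_change RII_before RII_after \<sigma> g h)"
| "elementary_move strong_RIII g h \<longleftrightarrow>
     (\<exists>\<sigma>. coherent_triangle \<sigma> \<and> local_change RIII_before RIII_after \<sigma> g h)"
| "elementary_move weak_RIII g h \<longleftrightarrow>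
     (\<exists>\<sigma>. \<not> coherent_triangle \<sigma> \<and> local_change RIII_before RIII_after \<sigma> g h)"

definition related_by_deformation ::
  "deformation \<Rightarrow> (real \<Rightarrow> real^3) \<Rightarrow> (real \<Rightarrow> real^3) \<Rightarrow> bool" where
  "related_by_deformation j g g' \<longleftrightarrow>
     (\<exists>h h'. spherical_curve h \<and> spherical_curve h' \<and> same_curve g h \<and> same_curve h' g' \<and>
        (elementary_move j h h' \<or> elementary_move j h' h))"


section \<open>Invariants\<close>

definition oriented_invariant :: "deformation set \<Rightarrow> ((real \<Rightarrow> real^3) \<Rightarrow> int) \<Rightarrow> bool" where
  "oriented_invariant J F \<longleftrightarrow>
     (\<forall>g g'. spherical_curve g \<and> spherical_curve g' \<longrightarrow>
        (same_curve g g' \<longrightarrow> F g = F g') \<and>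
        (\<forall>j\<in>J. related_by_deformation j g g' \<longrightarrow> F g = F g'))"

definition unoriented_invariant :: "deformation set \<Rightarrow> ((real \<Rightarrow> real^3) \<Rightarrow> int) \<Rightarrow> bool" where
  "unoriented_invariant J F \<longleftrightarrow>
     oriented_invariant J F \<and> (\<forall>g. spherical_curve g \<longrightarrow> F (reversed g) = F g)"

definition curve_combination ::
  "(nat \<Rightarrow> diagram) \<Rightarrow> (nat \<Rightarrow> int) \<Rightarrow> nat set \<Rightarrow> (real \<Rightarrow> real^3) \<Rightarrow> int" where
  "curve_combination x \<alpha> I g = (\<Sum>i\<in>I. \<alpha> i * int (curve_count (x i) g))"

end

theory Submission
  imports Defs
begin

text \<open>Fix the coefficients and let \<open>\<phi>\<close> be the function on diagrams which they define. The value of the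
  combination on a curve is the sum of \<open>\<phi>\<close> over all sub-words of its Gauss word, indexed by the sets of
  letters kept. A deformation changes the word only by inserting, deleting or reversing short
  blocks, whose letters are the crossings inside a disk. Grouping the sub-words according to the set
  of letters kept outside the disk, the difference of the two values becomes a sum of values of
  \<open>\<phi>\<close> on relators. An isotopy preserves the sign of the frame at a double point, and reversing
  the curve changes the sign of both tangent vectors, so the over-branch is unchanged and the word is
  reversed.\<close>

section \<open>Words and diagrams\<close>

text \<open>The word of a curve depends on the base point and names crossings by their first
  passage, so one deformation may rename every letter. Words are therefore read with an arbitrary
  injective labelling of the double points, which does not affect the diagram: crossings in the disk
  get letters among 1, 2, 3, all others larger ones, the same before and after. The arcs can be
  passed in any order, while a relator fixes one; since diagrams are cyclic, the replacement rule
  \<open>exchangeable\<close> is stable under rotating its three blocks. Inside the disk, over and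
  under depend only on the directions \<open>\<sigma>\<close> and on whether the chart preserves
  orientation, so finitely many sign patterns remain, each a relator up to renaming, rotation and
  interchange of the two sides. Relators list only the sets of crossings whose contributions do not
  cancel: the nonempty ones for RI and RII, those with at least two elements for RIII. The
  hypothesis concerns projected relators, but the combination has no term outside the range of the
  projection, so it vanishes on the relators themselves.\<close>

lemma letter_map_endpoint [simp]: "letter (map_endpoint f e) = f (letter e)"
  by (cases e) auto

lemma letters_map_endpoint: "letters (map (map_endpoint f) v) = f ` letters v"
  by (auto simp: letters_def image_image)

lemma letters_rotate [simp]: "letters (rotate t v) = letters v"
  by (simp add: letters_def)

lemma letters_rev [simp]: "letters (rev v) = letters v"
  by (simp add: letters_def)

lemma letters_append [simp]: "letters (v @ w) = letters v \<union> letters w"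
  by (auto simp: letters_def)

lemma letters_Nil [simp]: "letters [] = {}"
  by (simp add: letters_def)

lemma letters_Cons [simp]: "letters (e # v) = insert (letter e) (letters v)"
  by (simp add: letters_def)

lemma finite_letters [simp]: "finite (letters v)"
  by (simp add: letters_def)

lemma isomorphic_wordsI:
  assumes "inj_on f (letters v)" "rotate t w = map (map_endpoint f) v"
  shows "isomorphic_words v w"
proof -
  have "letters w = f ` letters v"
    using assms(2) letters_map_endpoint letters_rotate by metis
  moreover have "length v = length w"
    using assms(2) by (metis length_map length_rotate)
  ultimately show ?thesis
    using assms by (auto simp: isomorphic_words_def bij_betw_def)
qed

lemma isomorphic_wordsE:
  assumes "isomorphic_words v w"
  obtains f t where "inj_on f (letters v)" "rotate t w = map (map_endpoint f) v"
  using assms by (auto simp: isomorphic_words_def bij_betw_def)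

lemma isomorphic_words_refl: "isomorphic_words v v"
  by (rule isomorphic_wordsI[of id _ 0]) (auto simp: endpoint.map_id0)

lemma isomorphic_words_trans:
  assumes "isomorphic_words u v" "isomorphic_words v w"
  shows "isomorphic_words u w"
proof -
  obtain f s where f: "inj_on f (letters u)" "rotate s v = map (map_endpoint f) u"
    using assms(1) by (rule isomorphic_wordsE)
  obtain g t where g: "inj_on g (letters v)" "rotate t w = map (map_endpoint g) v"
    using assms(2) by (rule isomorphic_wordsE)
  have "letters v = f ` letters u"
    using f(2) letters_map_endpoint letters_rotate by metis
  then have "inj_on (g \<circ> f) (letters u)"
    using f(1) g(1) by (simp add: comp_inj_on)
  moreover have "rotate (s + t) w = map (map_endpoint (g \<circ> f)) u"
    using f(2) g(2) by (simp add: endpoint.map_comp flip: rotate_rotate rotate_map)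
       (simp add: rotate_map f(2) endpoint.map_comp)
  ultimately show ?thesis by (rule isomorphic_wordsI)
qed

text \<open>Rotating by \<open>t\<close> altogether \<open>length v\<close> times is the identity;
  with \<open>length v = Suc m\<close>, a further rotation by \<open>t * m\<close> therefore undoes
  the first one.\<close>

lemma rotate_inverse: "\<exists>s. rotate s (rotate t v) = v"
proof (cases "v = []")
  case False
  then obtain m where "length v = Suc m" by (cases v) auto
  then have "rotate (t * m) (rotate t v) = rotate (length v * t) v"
    by (simp add: rotate_rotate algebra_simps)
  also have "\<dots> = v"
    by (metis mod_mult_self1_is_0 rotate_conv_mod rotate0 id_apply)
  finally show ?thesis by blast
qed auto

lemma isomorphic_words_sym:
  assumes "isomorphic_words v w"
  shows "isomorphic_words w v"
proof -
  obtain f t where f: "inj_on f (letters v)" "rotate t w = map (map_endpoint f) v"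
    using assms by (rule isomorphic_wordsE)
  obtain s where s: "rotate s (rotate t w) = w" using rotate_inverse by blast
  let ?g = "inv_into (letters v) f"
  have lw: "letters w = f ` letters v"
    using f(2) letters_map_endpoint letters_rotate by metis
  have "map (map_endpoint ?g) (map (map_endpoint f) v) = v"
  proof -
    have "map_endpoint ?g (map_endpoint f e) = e" if "e \<in> set v" for e
    proof -
      have "letter e \<in> letters v" using that by (simp add: letters_def)
      then show ?thesis using f(1) by (cases e) (simp_all add: inv_into_f_f)
    qed
    then show ?thesis by (simp add: map_idI)
  qed
  then have "rotate s v = map (map_endpoint ?g) w"
    by (metis f(2) s rotate_map)
  moreover have "inj_on ?g (letters w)"
    using lw by (simp add: inj_on_inv_into)
  ultimately show ?thesis by (metis isomorphic_wordsI)
qed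

text \<open>The assumption puts \<open>w\<close> into its own class, which turns equality of classes
  into an isomorphism. The converse direction is \<open>arrow_diagram_eqI\<close>.\<close>

lemma arrow_diagram_eq_iff:
  assumes "oriented_gauss_word w"
  shows "arrow_diagram v = arrow_diagram w \<longleftrightarrow> isomorphic_words v w"
  using assms isomorphic_words_refl isomorphic_words_trans isomorphic_words_sym
  unfolding arrow_diagram_def by blast

lemma arrow_diagram_eqI: "isomorphic_words v w \<Longrightarrow> arrow_diagram v = arrow_diagram w"
  using isomorphic_words_trans isomorphic_words_sym
  unfolding arrow_diagram_def by blast

lemma isomorphic_words_rotate: "isomorphic_words (rotate t v) v"
  by (rule isomorphic_wordsI[of id _ t]) (auto simp: endpoint.map_id0)

lemma arrow_diagram_rotate [simp]: "arrow_diagram (rotate t v) = arrow_diagram v"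
  by (rule arrow_diagram_eqI) (rule isomorphic_words_rotate)

lemma arrow_diagram_append_commute: "arrow_diagram (v @ w) = arrow_diagram (w @ v)"
  by (metis arrow_diagram_rotate rotate_append)

text \<open>A rotation exchanges the two pieces of a cut word. Reversal turns this into the exchange
  of the two reversed pieces, which is again a rotation, while the renaming of letters stays the
  same.\<close>

lemma isomorphic_words_rev:
  assumes "isomorphic_words v w"
  shows "isomorphic_words (rev v) (rev w)"
proof -
  obtain f t where f: "inj_on f (letters v)" "rotate t w = map (map_endpoint f) v"
    using assms by (rule isomorphic_wordsE)
  have "rev (rotate t w) = rev (take (t mod length w) w) @ rev (drop (t mod length w) w)"
    by (simp add: rotate_drop_take)
  also have "\<dots> = rotate (length (rev (drop (t mod length w) w)))
      (rev (drop (t mod length w) w) @ rev (take (t mod length w) w))"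
    by (simp only: rotate_append)
  also have "\<dots> = rotate (length (rev (drop (t mod length w) w))) (rev w)"
    by (metis append_take_drop_id rev_append)
  finally show ?thesis
    using f by (intro isomorphic_wordsI[of f]) (auto simp: rev_map)
qed

section \<open>Sub-words indexed by the letters kept, and sums over all sub-words of a word\<close>

definition sub_word :: "gword \<Rightarrow> nat set \<Rightarrow> gword" where
  "sub_word v K = filter (\<lambda>e. letter e \<in> K) v"

lemma sub_word_append [simp]: "sub_word (v @ w) K = sub_word v K @ sub_word w K"
  by (simp add: sub_word_def)

lemma sub_word_Nil [simp]: "sub_word [] K = []"
  by (simp add: sub_word_def)

lemma sub_word_Cons [simp]:
  "sub_word (e # v) K = (if letter e \<in> K then e # sub_word v K else sub_word v K)"
  by (simp add: sub_word_def)

lemma sub_word_rev: "sub_word (rev v) K = rev (sub_word v K)"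
  by (simp add: sub_word_def rev_filter)

lemma letters_sub_word: "letters (sub_word v K) = letters v \<inter> K"
  by (auto simp: sub_word_def letters_def)

lemma sub_word_cong: "K \<inter> letters v = K' \<inter> letters v \<Longrightarrow> sub_word v K = sub_word v K'"
  unfolding sub_word_def letters_def by (rule filter_cong) auto

lemma oriented_gauss_word_sub_word:
  "oriented_gauss_word v \<Longrightarrow> oriented_gauss_word (sub_word v K)"
  unfolding oriented_gauss_word_def letters_sub_word by (auto simp: sub_word_def)

text \<open>Deleting letters commutes with cutting the word, but the piece in front of the cut
  becomes shorter, so the amount of the rotation changes.\<close>

lemma sub_word_rotate: "\<exists>s. sub_word (rotate t v) K = rotate s (sub_word v K)"
proof -
  have "rotate t v = drop (t mod length v) v @ take (t mod length v) v"
    by (rule rotate_drop_take)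
  then have "sub_word (rotate t v) K
      = sub_word (drop (t mod length v) v) K @ sub_word (take (t mod length v) v) K" by simp
  also have "\<dots> = rotate (length (sub_word (take (t mod length v) v) K))
       (sub_word (take (t mod length v) v) K @ sub_word (drop (t mod length v) v) K)"
    by (simp add: rotate_append)
  also have "\<dots> = rotate (length (sub_word (take (t mod length v) v) K)) (sub_word v K)"
    by (simp flip: sub_word_append)
  finally show ?thesis by blast
qed

lemma isomorphic_words_sub_word:
  assumes "inj_on f (letters v)" "rotate t w = map (map_endpoint f) v" "K \<subseteq> letters v"
  shows "isomorphic_words (sub_word v K) (sub_word w (f ` K))"
proof -
  obtain s where s: "sub_word (rotate t w) (f ` K) = rotate s (sub_word w (f ` K))"
    using sub_word_rotate by blast
  have "sub_word (map (map_endpoint f) v) (f ` K) = map (map_endpoint f) (sub_word v K)"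
    unfolding sub_word_def filter_map o_def letter_map_endpoint
    using assms(1,3)
    by (intro arg_cong[where f = "map _"] filter_cong)
       (simp_all add: inj_on_image_mem_iff[OF assms(1)] letters_def)
  then have "rotate s (sub_word w (f ` K)) = map (map_endpoint f) (sub_word v K)"
    using s assms(2) by simp
  moreover have "inj_on f (letters (sub_word v K))"
    using assms(1) by (auto simp: letters_sub_word intro: inj_on_subset)
  ultimately show ?thesis by (metis isomorphic_wordsI)
qed

definition word_sum :: "(diagram \<Rightarrow> int) \<Rightarrow> gword \<Rightarrow> int" where
  "word_sum \<phi> w = (\<Sum>K\<in>Pow (letters w). \<phi> (arrow_diagram (sub_word w K)))"

text \<open>The renaming induces a bijection between the sets of letters kept, and corresponding
  sub-words are isomorphic. Thus the sum depends on the diagram only.\<close>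

lemma word_sum_isomorphic:
  assumes "isomorphic_words v w"
  shows "word_sum \<phi> v = word_sum \<phi> w"
proof -
  obtain f t where f: "inj_on f (letters v)" "rotate t w = map (map_endpoint f) v"
    using assms by (rule isomorphic_wordsE)
  have lw: "letters w = f ` letters v"
    using f(2) letters_map_endpoint letters_rotate by metis
  have "bij_betw ((`) f) (Pow (letters v)) (Pow (letters w))"
    unfolding lw using f(1) by (intro bij_betw_Pow) (simp add: bij_betw_def)
  then have "word_sum \<phi> w
      = (\<Sum>K\<in>Pow (letters v). \<phi> (arrow_diagram (sub_word w (f ` K))))"
    unfolding word_sum_def by (rule sum.reindex_bij_betw[symmetric])
  also have "\<dots> = word_sum \<phi> v"
    unfolding word_sum_def
    by (intro sum.cong refl arg_cong[where f = \<phi>] arrow_diagram_eqI[symmetric]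
          isomorphic_words_sub_word[OF f]) simp
  finally show ?thesis by simp
qed

lemma representative_isomorphic:
  assumes "oriented_gauss_word v"
  shows "oriented_gauss_word (representative (arrow_diagram v))"
    "isomorphic_words (representative (arrow_diagram v)) v"
proof -
  let ?r = "representative (arrow_diagram v)"
  have "oriented_gauss_word ?r \<and> arrow_diagram ?r = arrow_diagram v"
    unfolding representative_def by (rule someI[of _ v]) (use assms in simp)
  then show "oriented_gauss_word ?r" "isomorphic_words ?r v"
    using arrow_diagram_eq_iff[OF assms] by auto
qed

text \<open>\<open>sub_words\<close> is indexed by the letters deleted and collects words in a set.
  Complements give the letters kept, and no two of these sets give the same word because a sub-word
  determines its letters. The representative may then be replaced by any Gauss word of the
  diagram.\<close>

lemma int_diagram_count:
  assumes "oriented_gauss_word v"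
  shows "int (diagram_count x (arrow_diagram v)) = word_sum (\<lambda>X. if X = x then 1 else 0) v"
proof -
  let ?r = "representative (arrow_diagram v)"
  have "{H \<in> sub_words ?r. arrow_diagram H = x}
      = sub_word ?r ` {K \<in> Pow (letters ?r). arrow_diagram (sub_word ?r K) = x}"
  proof -
    have 1: "filter (\<lambda>e. letter e \<notin> K) ?r = sub_word ?r (letters ?r - K)" for K
      unfolding sub_word_def by (rule filter_cong) (auto simp: letters_def)
    have "sub_words ?r = sub_word ?r ` Pow (letters ?r)"
    proof (intro equalityI subsetI)
      fix H assume "H \<in> sub_words ?r"
      then show "H \<in> sub_word ?r ` Pow (letters ?r)" by (auto simp: sub_words_def 1)
    next
      fix H assume "H \<in> sub_word ?r ` Pow (letters ?r)"
      then obtain K where K: "K \<subseteq> letters ?r" "H = sub_word ?r K" by auto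
      then have "H = filter (\<lambda>e. letter e \<notin> letters ?r - K) ?r"
        unfolding 1 by (simp add: double_diff)
      then show "H \<in> sub_words ?r" unfolding sub_words_def by blast
    qed
    then show ?thesis by auto
  qed
  moreover have "inj_on (sub_word ?r) {K \<in> Pow (letters ?r). arrow_diagram (sub_word ?r K) = x}"
  proof (rule inj_onI; clarsimp)
    fix K L assume "K \<subseteq> letters ?r" "L \<subseteq> letters ?r" "sub_word ?r K = sub_word ?r L"
    then show "K = L" by (metis inf.absorb2 letters_sub_word)
  qed
  ultimately have "diagram_count x (arrow_diagram v)
      = card {K \<in> Pow (letters ?r). arrow_diagram (sub_word ?r K) = x}"
    unfolding diagram_count_def by (simp add: card_image)
  also have "int \<dots> = word_sum (\<lambda>X. if X = x then 1 else 0) ?r"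
    unfolding word_sum_def by (simp add: sum.If_cases Int_def)
  also have "\<dots> = word_sum (\<lambda>X. if X = x then 1 else 0) v"
    using representative_isomorphic[OF assms] by (intro word_sum_isomorphic)
  finally show ?thesis .
qed


definition endpoint_of :: "bool \<Rightarrow> 'a \<Rightarrow> 'a endpoint" where
  "endpoint_of b k = (if b then Start k else End k)"

lemma letter_endpoint_of [simp]: "letter (endpoint_of b k) = k"
  by (simp add: endpoint_of_def)

text \<open>Only the coincidences among letters matter: the renaming sends a letter to the other
  label of any time that carries it.\<close>

lemma isomorphic_words_endpoint_of:
  assumes "\<And>s t. s \<in> set ts \<Longrightarrow> t \<in> set ts \<Longrightarrow> N s = N t \<longleftrightarrow> M s = M t"
  shows "isomorphic_words (map (\<lambda>t. endpoint_of (b t) (N t)) ts)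
           (map (\<lambda>t. endpoint_of (b t) (M t)) ts)"
proof -
  define f where "f k = M (SOME t. t \<in> set ts \<and> N t = k)" for k
  have f: "f (N t) = M t" if "t \<in> set ts" for t
  proof -
    let ?s = "SOME s. s \<in> set ts \<and> N s = N t"
    have "?s \<in> set ts \<and> N ?s = N t" by (rule someI[of _ t]) (use that in simp)
    then show ?thesis using assms that unfolding f_def by blast
  qed
  have "inj_on f (N ` set ts)"
    using assms f by (auto simp: inj_on_def)
  moreover have "letters (map (\<lambda>t. endpoint_of (b t) (N t)) ts) = N ` set ts"
    by (simp add: letters_def image_image)
  ultimately show ?thesis
    using f by (intro isomorphic_wordsI[of f _ 0]) (auto simp: endpoint_of_def)
qed

section \<open>Replacing parts of a word\<close>

lemma sum_Pow_insert:
  fixes g :: "'a set \<Rightarrow> 'b::comm_monoid_add"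
  assumes "finite F" "i \<notin> F"
  shows "sum g (Pow (insert i F)) = sum g (Pow F) + (\<Sum>K\<in>Pow F. g (insert i K))"
proof -
  have "sum g (Pow (insert i F)) = sum g (Pow F) + sum g (insert i ` Pow F)"
    unfolding Pow_insert using assms by (intro sum.union_disjoint) auto
  also have "sum g (insert i ` Pow F) = (\<Sum>K\<in>Pow F. g (insert i K))"
    using assms by (subst sum.reindex) (auto simp: inj_on_def)
  finally show ?thesis .
qed

lemma sum_Pow_Un:
  fixes g :: "'a set \<Rightarrow> 'b::comm_monoid_add"
  assumes "finite X" "finite Y" "X \<inter> Y = {}"
  shows "sum g (Pow (X \<union> Y)) = (\<Sum>K\<in>Pow X. \<Sum>L\<in>Pow Y. g (K \<union> L))"
proof -
  have "bij_betw (\<lambda>(K, L). K \<union> L) (Pow X \<times> Pow Y) (Pow (X \<union> Y))"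
    by (rule bij_betwI[where g = "\<lambda>Z. (Z \<inter> X, Z \<inter> Y)"]) (use assms(3) in auto)
  then show ?thesis
    by (simp add: sum.cartesian_product sum.reindex_bij_betw[symmetric] case_prod_beta)
qed

text \<open>The gaps \<open>S\<close>, \<open>T\<close>, \<open>U\<close> are what is left of the
  outside part once its letters are chosen; the sums run over the choices inside the disk. Three
  blocks serve all deformations, a missing arc being an empty block. In a linear word, the parts
  before the first and after the last block together form the gap \<open>S\<close>.\<close>

definition exchangeable ::
  "(diagram \<Rightarrow> int) \<Rightarrow> gword \<Rightarrow> gword \<Rightarrow> gword \<Rightarrow> gword \<Rightarrow> gword \<Rightarrow> gword \<Rightarrow> bool" where
  "exchangeable \<phi> A B C A' B' C' \<longleftrightarrow>
     (\<forall>S T U. oriented_gauss_word (S @ T @ U) \<and>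
        letters (S @ T @ U) \<inter> (letters (A @ B @ C) \<union> letters (A' @ B' @ C')) = {} \<longrightarrow>
        (\<Sum>K\<in>Pow (letters (A @ B @ C)).
           \<phi> (arrow_diagram (S @ sub_word A K @ T @ sub_word B K @ U @ sub_word C K))) =
        (\<Sum>K\<in>Pow (letters (A' @ B' @ C')).
           \<phi> (arrow_diagram (S @ sub_word A' K @ T @ sub_word B' K @ U @ sub_word C' K))))"

lemma exchangeable_sym: "exchangeable \<phi> A B C A' B' C' \<Longrightarrow> exchangeable \<phi> A' B' C' A B C"
  unfolding exchangeable_def by (metis (no_types, lifting) Un_commute)

lemma oriented_gauss_word_append_commute:
  "oriented_gauss_word (v @ w) \<longleftrightarrow> oriented_gauss_word (w @ v)"
  by (auto simp: oriented_gauss_word_def)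

text \<open>The diagram forgets the base point, so any of the three blocks may come first.\<close>

lemma exchangeable_rotate:
  assumes "exchangeable \<phi> A B C A' B' C'"
  shows "exchangeable \<phi> B C A B' C' A'"
  unfolding exchangeable_def
proof (intro allI impI, elim conjE)
  fix S T U :: gword
  assume g: "oriented_gauss_word (S @ T @ U)"
    and d: "letters (S @ T @ U) \<inter> (letters (B @ C @ A) \<union> letters (B' @ C' @ A')) = {}"
  have "oriented_gauss_word (U @ S @ T)"
    using g oriented_gauss_word_append_commute[of "S @ T" U] by simp
  moreover have "letters (U @ S @ T) \<inter> (letters (A @ B @ C) \<union> letters (A' @ B' @ C')) = {}"
    using d by auto
  ultimately have 1: "(\<Sum>K\<in>Pow (letters (A @ B @ C)).
           \<phi> (arrow_diagram (U @ sub_word A K @ S @ sub_word B K @ T @ sub_word C K))) =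
        (\<Sum>K\<in>Pow (letters (A' @ B' @ C')).
           \<phi> (arrow_diagram (U @ sub_word A' K @ S @ sub_word B' K @ T @ sub_word C' K)))"
    using assms unfolding exchangeable_def by blast
  have "(\<Sum>K\<in>Pow (letters (B @ C @ A)).
           \<phi> (arrow_diagram (S @ sub_word B K @ T @ sub_word C K @ U @ sub_word A K))) =
        (\<Sum>K\<in>Pow (letters (A @ B @ C)).
           \<phi> (arrow_diagram (U @ sub_word A K @ S @ sub_word B K @ T @ sub_word C K)))" for A B C
  proof (rule sum.cong)
    show "Pow (letters (B @ C @ A)) = Pow (letters (A @ B @ C))" by auto
    fix K
    show "\<phi> (arrow_diagram (S @ sub_word B K @ T @ sub_word C K @ U @ sub_word A K)) =
        \<phi> (arrow_diagram (U @ sub_word A K @ S @ sub_word B K @ T @ sub_word C K))"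
      using arrow_diagram_append_commute[of "S @ sub_word B K @ T @ sub_word C K" "U @ sub_word A K"]
      by simp
  qed
  then show "(\<Sum>K\<in>Pow (letters (B @ C @ A)).
           \<phi> (arrow_diagram (S @ sub_word B K @ T @ sub_word C K @ U @ sub_word A K))) =
        (\<Sum>K\<in>Pow (letters (B' @ C' @ A')).
           \<phi> (arrow_diagram (S @ sub_word B' K @ T @ sub_word C' K @ U @ sub_word A' K)))"
    using 1 by simp
qed

text \<open>The letters outside the blocks are chosen first. For each choice the rest
  \<open>W\<close> of the word is rotated to the front, where it joins \<open>V\<close>, and the
  restricted gaps again form a Gauss word, so that exchangeability applies to them.\<close>

lemma word_sum_exchange:
  assumes ex: "exchangeable \<phi> A B C A' B' C'"
    and g: "oriented_gauss_word (V @ T @ U @ W)"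
    and d: "letters (V @ T @ U @ W) \<inter> letters (A @ B @ C) = {}"
      "letters (V @ T @ U @ W) \<inter> letters (A' @ B' @ C') = {}"
  shows "word_sum \<phi> (V @ A @ T @ B @ U @ C @ W) = word_sum \<phi> (V @ A' @ T @ B' @ U @ C' @ W)"
proof -
  have *: "word_sum \<phi> (V @ A @ T @ B @ U @ C @ W) =
      (\<Sum>K\<in>Pow (letters (V @ T @ U @ W)). \<Sum>L\<in>Pow (letters (A @ B @ C)).
         \<phi> (arrow_diagram (sub_word (W @ V) K @ sub_word A L @ sub_word T K @ sub_word B L
              @ sub_word U K @ sub_word C L)))"
    if "letters (V @ T @ U @ W) \<inter> letters (A @ B @ C) = {}" for A B C
  proof -
    have "letters (V @ A @ T @ B @ U @ C @ W) = letters (V @ T @ U @ W) \<union> letters (A @ B @ C)"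
      by auto
    then have "word_sum \<phi> (V @ A @ T @ B @ U @ C @ W) =
      (\<Sum>K\<in>Pow (letters (V @ T @ U @ W)). \<Sum>L\<in>Pow (letters (A @ B @ C)).
         \<phi> (arrow_diagram (sub_word (V @ A @ T @ B @ U @ C @ W) (K \<union> L))))"
      unfolding word_sum_def using that by (simp only: sum_Pow_Un finite_letters)
    also have "\<dots> = (\<Sum>K\<in>Pow (letters (V @ T @ U @ W)). \<Sum>L\<in>Pow (letters (A @ B @ C)).
         \<phi> (arrow_diagram (sub_word (W @ V) K @ sub_word A L @ sub_word T K @ sub_word B L
              @ sub_word U K @ sub_word C L)))"
    proof (intro sum.cong refl arg_cong[where f = \<phi>])
      fix K L assume K: "K \<in> Pow (letters (V @ T @ U @ W))" and L: "L \<in> Pow (letters (A @ B @ C))"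
      have "sub_word V (K \<union> L) = sub_word V K" "sub_word T (K \<union> L) = sub_word T K"
        "sub_word U (K \<union> L) = sub_word U K" "sub_word W (K \<union> L) = sub_word W K"
        "sub_word A (K \<union> L) = sub_word A L" "sub_word B (K \<union> L) = sub_word B L"
        "sub_word C (K \<union> L) = sub_word C L"
        using that K L by (intro sub_word_cong; auto)+
      then show "arrow_diagram (sub_word (V @ A @ T @ B @ U @ C @ W) (K \<union> L)) =
          arrow_diagram (sub_word (W @ V) K @ sub_word A L @ sub_word T K @ sub_word B L
            @ sub_word U K @ sub_word C L)"
        using arrow_diagram_append_commute[of
          "sub_word V K @ sub_word A L @ sub_word T K @ sub_word B L @ sub_word U K @ sub_word C L"
          "sub_word W K"] by simp
    qed
    finally show ?thesis .
  qed
  have **: "(\<Sum>L\<in>Pow (letters (A @ B @ C)).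
         \<phi> (arrow_diagram (sub_word (W @ V) K @ sub_word A L @ sub_word T K @ sub_word B L
              @ sub_word U K @ sub_word C L))) =
      (\<Sum>L\<in>Pow (letters (A' @ B' @ C')).
         \<phi> (arrow_diagram (sub_word (W @ V) K @ sub_word A' L @ sub_word T K @ sub_word B' L
              @ sub_word U K @ sub_word C' L)))" for K
  proof -
    have "oriented_gauss_word (W @ V @ T @ U)"
      using g oriented_gauss_word_append_commute[of "V @ T @ U" W] by simp
    then have "oriented_gauss_word (sub_word (W @ V @ T @ U) K)"
      by (rule oriented_gauss_word_sub_word)
    then have 1: "oriented_gauss_word (sub_word (W @ V) K @ sub_word T K @ sub_word U K)"
      by simp
    have 2: "letters (sub_word (W @ V) K @ sub_word T K @ sub_word U K) \<inter>
        (letters (A @ B @ C) \<union> letters (A' @ B' @ C')) = {}"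
      using d by (auto simp: letters_sub_word)
    show ?thesis using ex 1 2 unfolding exchangeable_def by blast
  qed
  show ?thesis unfolding *[OF d(1)] *[OF d(2)] ** ..
qed

section \<open>From relators to replacement rules for blocks\<close>

locale diagram_functional =
  fixes \<Phi> :: "(diagram \<Rightarrow>\<^sub>0 int) \<Rightarrow> int"
  assumes add: "\<Phi> (r + s) = \<Phi> r + \<Phi> s"
begin

abbreviation \<phi> :: "diagram \<Rightarrow> int" where
  "\<phi> X \<equiv> \<Phi> (frag_of X)"

lemma diff: "\<Phi> (r - s) = \<Phi> r - \<Phi> s"
  using add[of "r - s" s] by simp

text \<open>The single crossing is either deleted, which leaves the word without the loop, or kept,
  which gives a relator.\<close>

lemma exchangeable_RI:
  assumes "\<And>r. r \<in> relators RI \<Longrightarrow> \<Phi> r = 0" and "0 < i"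
    and "A = [Start i, End i] \<or> A = [End i, Start i]"
  shows "exchangeable \<phi> A [] [] [] [] []"
  unfolding exchangeable_def
proof (intro allI impI, elim conjE)
  fix S T U :: gword
  assume g: "oriented_gauss_word (S @ T @ U)"
    and d: "letters (S @ T @ U) \<inter> (letters (A @ [] @ []) \<union> letters ([] @ [] @ [])) = {}"
  have lA: "letters (A @ [] @ []) = {i}" using assms(3) by auto
  \<comment> \<open>The relator has its block at the end, so the cyclic word is cut just behind
    \<open>A\<close>.\<close>
  have 1: "oriented_gauss_word ((T @ U) @ S)"
    using g by (simp add: oriented_gauss_word_def) auto
  have 2: "fresh_letters [i] ((T @ U) @ S)"
    using d lA \<open>0 < i\<close> by (auto simp: fresh_letters_def)
  have "ad (((T @ U) @ S) @ A) \<in> relators RI"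
    using 1 2 assms(3) unfolding relators.simps relators_RI_def by blast
  then have "\<phi> (arrow_diagram (((T @ U) @ S) @ A)) = 0" by (rule assms(1))
  moreover have "arrow_diagram (((T @ U) @ S) @ A) = arrow_diagram (S @ A @ T @ U)"
    using arrow_diagram_append_commute[of "T @ U" "S @ A"] by simp
  moreover have "sub_word A {i} = A" "sub_word A {} = []" using assms(3) by auto
  ultimately show "(\<Sum>K\<in>Pow (letters (A @ [] @ [])).
           \<phi> (arrow_diagram (S @ sub_word A K @ T @ sub_word [] K @ U @ sub_word [] K))) =
        (\<Sum>K\<in>Pow (letters ([] @ [] @ [])).
           \<phi> (arrow_diagram (S @ sub_word [] K @ T @ sub_word [] K @ U @ sub_word [] K)))"
    unfolding lA by (simp add: sum_Pow_insert)
qed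

text \<open>Of the four sets of crossings kept, the empty one gives the word without the bigon, and
  the other three give exactly the terms of the relator.\<close>

lemma exchangeable_RII:
  assumes "\<And>S T. oriented_gauss_word (S @ T) \<Longrightarrow> fresh_letters [i, j] (S @ T) \<Longrightarrow>
      \<Phi> (ad (S @ A @ T @ B) + ad (S @ sub_word A {i} @ T @ sub_word B {i})
         + ad (S @ sub_word A {j} @ T @ sub_word B {j})) = 0"
    and l: "letters (A @ B) = {i, j}" and ij: "0 < i" "0 < j" "i \<noteq> j"
  shows "exchangeable \<phi> A B [] [] [] []"
  unfolding exchangeable_def
proof (intro allI impI, elim conjE)
  fix S T U :: gword
  assume g: "oriented_gauss_word (S @ T @ U)"
    and d: "letters (S @ T @ U) \<inter> (letters (A @ B @ []) \<union> letters ([] @ [] @ [])) = {}"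
  have l': "letters (A @ B @ []) = {i, j}" using l by simp
  have sub: "sub_word A {i, j} = A" "sub_word B {i, j} = B" "sub_word A {} = []" "sub_word B {} = []"
    using l by (auto simp: sub_word_def filter_id_conv letters_def)
  have "oriented_gauss_word ((U @ S) @ T)"
    using g oriented_gauss_word_append_commute[of U "S @ T"] by simp
  moreover have "fresh_letters [i, j] ((U @ S) @ T)"
    using d l' ij by (auto simp: fresh_letters_def)
  ultimately have "\<Phi> (ad ((U @ S) @ A @ T @ B)
         + ad ((U @ S) @ sub_word A {i} @ T @ sub_word B {i})
         + ad ((U @ S) @ sub_word A {j} @ T @ sub_word B {j})) = 0"
    by (rule assms(1))
  moreover have "arrow_diagram ((U @ S) @ X @ T @ Y) = arrow_diagram (S @ X @ T @ Y @ U)" for X Y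
    using arrow_diagram_append_commute[of U "S @ X @ T @ Y"] by simp
  ultimately show "(\<Sum>K\<in>Pow (letters (A @ B @ [])).
           \<phi> (arrow_diagram (S @ sub_word A K @ T @ sub_word B K @ U @ sub_word [] K))) =
        (\<Sum>K\<in>Pow (letters ([] @ [] @ [])).
           \<phi> (arrow_diagram (S @ sub_word [] K @ T @ sub_word [] K @ U @ sub_word [] K)))"
    unfolding l' using ij by (simp add: sum_Pow_insert add sub)
qed

text \<open>Subsets of at most one letter contribute the same to both sides: a word with one letter left
  in the three parts does not see the reversal of the parts.\<close>

lemma exchangeable_RIII:
  assumes "\<And>S T U. oriented_gauss_word (S @ T @ U) \<Longrightarrow> fresh_letters [i, j, k] (S @ T @ U) \<Longrightarrow>
      \<Phi> ((ad (S @ A @ T @ B @ U @ C)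
        + ad (S @ sub_word A {i, j} @ T @ sub_word B {i, j} @ U @ sub_word C {i, j})
        + ad (S @ sub_word A {i, k} @ T @ sub_word B {i, k} @ U @ sub_word C {i, k})
        + ad (S @ sub_word A {j, k} @ T @ sub_word B {j, k} @ U @ sub_word C {j, k}))
       - (ad (S @ rev A @ T @ rev B @ U @ rev C)
        + ad (S @ rev (sub_word A {i, j}) @ T @ rev (sub_word B {i, j}) @ U @ rev (sub_word C {i, j}))
        + ad (S @ rev (sub_word A {i, k}) @ T @ rev (sub_word B {i, k}) @ U @ rev (sub_word C {i, k}))
        + ad (S @ rev (sub_word A {j, k}) @ T @ rev (sub_word B {j, k}) @ U @ rev (sub_word C {j, k}))))
      = 0"
    and l: "letters (A @ B @ C) = {i, j, k}" and ijk: "0 < i" "0 < j" "0 < k" "i \<noteq> j" "i \<noteq> k" "j \<noteq> k"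
    and single: "\<And>n. rev (sub_word A {n}) = sub_word A {n}" "\<And>n. rev (sub_word B {n}) = sub_word B {n}"
      "\<And>n. rev (sub_word C {n}) = sub_word C {n}"
  shows "exchangeable \<phi> A B C (rev A) (rev B) (rev C)"
  unfolding exchangeable_def
proof (intro allI impI, elim conjE)
  fix S T U :: gword
  assume g: "oriented_gauss_word (S @ T @ U)"
    and d: "letters (S @ T @ U) \<inter> (letters (A @ B @ C) \<union> letters (rev A @ rev B @ rev C)) = {}"
  have l': "letters (rev A @ rev B @ rev C) = {i, j, k}" using l by simp
  have sub: "sub_word A {i, j, k} = A" "sub_word B {i, j, k} = B" "sub_word C {i, j, k} = C"
    "sub_word A {} = []" "sub_word B {} = []" "sub_word C {} = []"
    using l by (auto simp: sub_word_def filter_id_conv letters_def)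
  have perm: "{j, i} = {i, j}" "{k, i} = {i, k}" "{k, j} = {j, k}" "{k, j, i} = {i, j, k}"
    by auto
  have "fresh_letters [i, j, k] (S @ T @ U)"
    using d l ijk by (auto simp: fresh_letters_def)
  note rel = assms(1)[OF g this]
  show "(\<Sum>K\<in>Pow (letters (A @ B @ C)).
           \<phi> (arrow_diagram (S @ sub_word A K @ T @ sub_word B K @ U @ sub_word C K))) =
        (\<Sum>K\<in>Pow (letters (rev A @ rev B @ rev C)).
           \<phi> (arrow_diagram (S @ sub_word (rev A) K @ T @ sub_word (rev B) K @ U @ sub_word (rev C) K)))"
    using rel unfolding l l' using ijk
    by (simp add: sum_Pow_insert add diff sub_word_rev single sub perm)
qed

lemma exchangeable_strong_RII:
  assumes "\<And>r. r \<in> relators strong_RII \<Longrightarrow> \<Phi> r = 0" and "0 < i" "0 < j" "i \<noteq> j"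
  shows "exchangeable \<phi> [Start i, End j] [Start j, End i] [] [] [] []"
    and "exchangeable \<phi> [End i, Start j] [End j, Start i] [] [] [] []"
  by (rule exchangeable_RII[of i j]; use assms(2-) in
      \<open>auto intro!: assms(1) simp: relators_strong_RII_def\<close>; blast)+

lemma exchangeable_weak_RII:
  assumes "\<And>r. r \<in> relators weak_RII \<Longrightarrow> \<Phi> r = 0" and "0 < i" "0 < j" "i \<noteq> j"
  shows "exchangeable \<phi> [End i, Start j] [Start i, End j] [] [] [] []"
  by (rule exchangeable_RII[of i j]; use assms(2-) in
      \<open>auto intro!: assms(1) simp: relators_weak_RII_def\<close>; blast)

lemma exchangeable_strong_RIII:
  assumes "\<And>r. r \<in> relators strong_RIII \<Longrightarrow> \<Phi> r = 0"
    and "0 < i" "0 < j" "0 < k" "i \<noteq> j" "i \<noteq> k" "j \<noteq> k"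
  shows "exchangeable \<phi> [End i, Start j] [End k, Start i] [End j, Start k]
           [Start j, End i] [Start i, End k] [Start k, End j]" (is ?A)
    and "exchangeable \<phi> [Start k, End j] [Start i, End k] [Start j, End i]
           [End j, Start k] [End k, Start i] [End i, Start j]" (is ?B)
proof -
  have "exchangeable \<phi> [End i, Start j] [End k, Start i] [End j, Start k]
         (rev [End i, Start j]) (rev [End k, Start i]) (rev [End j, Start k])"
    by (rule exchangeable_RIII[of i j k]; use assms(2-) in
      \<open>auto intro!: assms(1) simp: relators_strong_RIII_def\<close>; blast)
  then show ?A by simp
  have "exchangeable \<phi> [Start k, End j] [Start i, End k] [Start j, End i]
         (rev [Start k, End j]) (rev [Start i, End k]) (rev [Start j, End i])"
    by (rule exchangeable_RIII[of i j k]; use assms(2-) in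
      \<open>auto intro!: assms(1) simp: relators_strong_RIII_def\<close>; blast)
  then show ?B by simp
qed

lemma exchangeable_weak_RIII:
  assumes "\<And>r. r \<in> relators weak_RIII \<Longrightarrow> \<Phi> r = 0"
    and "0 < i" "0 < j" "0 < k" "i \<noteq> j" "i \<noteq> k" "j \<noteq> k"
  shows "exchangeable \<phi> [End i, End j] [Start i, End k] [Start j, Start k]
           [End j, End i] [End k, Start i] [Start k, Start j]" (is ?A)
    and "exchangeable \<phi> [Start k, Start j] [End k, Start i] [End j, End i]
           [Start j, Start k] [Start i, End k] [End i, End j]" (is ?B)
proof -
  have "exchangeable \<phi> [End i, End j] [Start i, End k] [Start j, Start k]
         (rev [End i, End j]) (rev [Start i, End k]) (rev [Start j, Start k])"
    by (rule exchangeable_RIII[of i j k]; use assms(2-) in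
      \<open>auto intro!: assms(1) simp: relators_weak_RIII_def\<close>; blast)
  then show ?A by simp
  have "exchangeable \<phi> [Start k, Start j] [End k, Start i] [End j, End i]
         (rev [Start k, Start j]) (rev [End k, Start i]) (rev [End j, End i])"
    by (rule exchangeable_RIII[of i j k]; use assms(2-) in
      \<open>auto intro!: assms(1) simp: relators_weak_RIII_def\<close>; blast)
  then show ?B by simp
qed

end

section \<open>Mirror images\<close>

lemma oriented_gauss_word_rev [simp]: "oriented_gauss_word (rev v) \<longleftrightarrow> oriented_gauss_word v"
  by (simp add: oriented_gauss_word_def)

text \<open>A function on diagrams picking the partner in a mirroring pair. The choice of a
  representative is harmless because reversal respects isomorphism.\<close>

definition mirror :: "diagram \<Rightarrow> diagram" where
  "mirror X = arrow_diagram (rev (representative X))"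

lemma mirror_arrow_diagram:
  assumes "oriented_gauss_word v"
  shows "mirror (arrow_diagram v) = arrow_diagram (rev v)"
  unfolding mirror_def
  using representative_isomorphic[OF assms]
  by (intro arrow_diagram_eqI isomorphic_words_rev)

lemma mirror_all_diagrams:
  assumes "X \<in> all_diagrams"
  shows "mirror X \<in> all_diagrams" "mirror (mirror X) = X"
    "num_arrows (mirror X) = num_arrows X" "mirroring_pair X (mirror X)"
proof -
  obtain v where v: "oriented_gauss_word v" "X = arrow_diagram v"
    using assms by (auto simp: all_diagrams_def)
  show "mirror X \<in> all_diagrams" "mirror (mirror X) = X"
    using v by (auto simp: mirror_arrow_diagram all_diagrams_def)
  show "mirroring_pair X (mirror X)"
    unfolding mirroring_pair_def using v
    by (intro exI[of _ v] exI[of _ "rev v"]) (simp add: mirror_arrow_diagram)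
  have num: "num_arrows (arrow_diagram w) = card (letters w)" if "oriented_gauss_word w" for w
    using representative_isomorphic(2)[OF that]
    by (auto simp: num_arrows_def isomorphic_words_def intro: bij_betw_same_card)
  show "num_arrows (mirror X) = num_arrows X"
    using v by (simp add: mirror_arrow_diagram num)
qed

lemma word_sum_rev:
  assumes "oriented_gauss_word v"
  shows "word_sum \<phi> (rev v) = word_sum (\<lambda>X. \<phi> (mirror X)) v"
  unfolding word_sum_def letters_rev sub_word_rev
  using assms by (simp add: mirror_arrow_diagram oriented_gauss_word_sub_word)

text \<open>Reversing a word reverses its sub-words, and as the mirror is an involution, a sub-word
  has type \<open>x\<close> after reversal iff it had type \<open>mirror x\<close> before.\<close>

lemma diagram_count_rev:
  assumes "oriented_gauss_word v" "x \<in> all_diagrams"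
  shows "diagram_count x (arrow_diagram (rev v)) = diagram_count (mirror x) (arrow_diagram v)"
proof -
  have "int (diagram_count x (arrow_diagram (rev v)))
      = word_sum (\<lambda>X. if mirror X = x then 1 else 0) v"
    using assms by (simp add: int_diagram_count word_sum_rev)
  also have "\<dots> = word_sum (\<lambda>X. if X = mirror x then 1 else 0) v"
    unfolding word_sum_def
  proof (intro sum.cong refl)
    fix K
    have "arrow_diagram (sub_word v K) \<in> all_diagrams"
      using assms(1) by (auto simp: all_diagrams_def oriented_gauss_word_sub_word)
    then show "(if mirror (arrow_diagram (sub_word v K)) = x then 1 else 0 :: int) =
        (if arrow_diagram (sub_word v K) = mirror x then 1 else 0)"
      using mirror_all_diagrams(2) assms(2) by metis
  qed
  finally show ?thesis using assms by (simp flip: int_diagram_count)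
qed

section \<open>Linear combinations\<close>

lemma tilde_lookup: "tilde x z = Poly_Mapping.lookup z x"
proof -
  have "tilde x z = (\<Sum>y\<in>Poly_Mapping.keys z. if y = x then Poly_Mapping.lookup z y else 0)"
    unfolding tilde_def by (rule sum.cong) auto
  also have "\<dots> = Poly_Mapping.lookup z x"
    by (simp add: in_keys_iff)
  finally show ?thesis .
qed

lemma lookup_O_proj:
  assumes "x \<in> diagrams_between b d"
  shows "Poly_Mapping.lookup (O_proj b d r) x = Poly_Mapping.lookup r x"
  by (rule frag_induction[of r UNIV])
     (use assms in \<open>auto simp: O_proj_def frag_extend_diff lookup_minus\<close>)

text \<open>The number of arrows is nondecreasing along the enumeration, so the diagrams with at
  most \<open>c\<close> arrows occupy an initial segment of the indices, and its length is
  \<open>n_check c\<close>.\<close>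

lemma enumeration_between:
  assumes x: "diagram_enumeration x" and b: "0 < b" "b \<le> d"
    and ne: "{n_check (b - 1) + 1..n_check d} \<noteq> {}"
  shows "bij_betw x {n_check (b - 1) + 1..n_check d} (diagrams_between b d)"
proof -
  have bij: "bij_betw x {1..} all_diagrams"
    and mono: "\<And>i j. 1 \<le> i \<Longrightarrow> i \<le> j \<Longrightarrow> num_arrows (x i) \<le> num_arrows (x j)"
    using x by (auto simp: diagram_enumeration_def)
  have seg: "diagrams_le c = x ` {1..n_check c}" if "finite (diagrams_le c)" for c
  proof -
    let ?I = "{i \<in> {1..}. num_arrows (x i) \<le> c}"
    have I: "diagrams_le c = x ` ?I"
    proof -
      have "all_diagrams = x ` {1..}" using bij by (simp add: bij_betw_def)
      moreover have "{X \<in> x ` {1..}. num_arrows X \<le> c} = x ` ?I" by auto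
      ultimately show ?thesis by (simp add: diagrams_le_def)
    qed
    have inj: "inj_on x ?I" using bij by (auto simp: bij_betw_def inj_on_def)
    then have "finite ?I" using I that finite_imageD by metis
    have card: "card ?I = n_check c" unfolding n_check_def I using inj by (simp add: card_image)
    have "?I = {1..n_check c}"
    proof (cases "?I = {}")
      case True
      then show ?thesis using card by (metis atLeastatMost_empty card.empty zero_less_one)
    next
      case False
      then have "Max ?I \<in> ?I" using \<open>finite ?I\<close> Max_in by blast
      moreover have "i \<le> Max ?I" if "i \<in> ?I" for i
        using \<open>finite ?I\<close> that by (rule Max_ge)
      moreover have "num_arrows (x i) \<le> c" if "1 \<le> i" "i \<le> j" "j \<in> ?I" for i j
        using mono[OF that(1,2)] that(3) by simp
      ultimately have "?I = {1..Max ?I}" by fastforce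
      then show ?thesis using card by (metis card_atLeastAtMost diff_Suc_1 One_nat_def)
    qed
    then show ?thesis using I by simp
  qed
  \<comment> \<open>An infinite set has cardinality 0, so a nonempty index range forces
    \<open>n_check d\<close> to be positive and the set to be finite.\<close>
  have fin_d: "finite (diagrams_le d)"
    using ne by (auto simp: n_check_def intro: card_ge_0_finite)
  have "diagrams_le (b - 1) \<subseteq> diagrams_le d" using b by (auto simp: diagrams_le_def)
  then have fin_b: "finite (diagrams_le (b - 1))" using fin_d finite_subset by blast
  have "n_check (b - 1) \<le> n_check d"
    unfolding n_check_def using fin_d \<open>diagrams_le (b - 1) \<subseteq> diagrams_le d\<close> by (rule card_mono)
  then have "diagrams_between b d = x ` ({1..n_check d} - {1..n_check (b - 1)})"
    unfolding diagrams_between_def seg[OF fin_d] seg[OF fin_b]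
    using bij by (intro inj_on_image_set_diff[symmetric, where C = "{1..}"]) (auto simp: bij_betw_def)
  moreover have "{1..n_check d} - {1..n_check (b - 1)} = {n_check (b - 1) + 1..n_check d}"
    by auto
  ultimately show ?thesis
    using bij by (auto simp: bij_betw_def inj_on_def)
qed

definition weight :: "(nat \<Rightarrow> diagram) \<Rightarrow> (nat \<Rightarrow> int) \<Rightarrow> nat set \<Rightarrow> (diagram \<Rightarrow>\<^sub>0 int) \<Rightarrow> int" where
  "weight x \<alpha> I r = (\<Sum>i\<in>I. \<alpha> i * tilde (x i) r)"

lemma diagram_functional_weight: "diagram_functional (weight x \<alpha> I)"
  by unfold_locales
     (simp add: weight_def tilde_lookup lookup_add sum.distrib distrib_left)

text \<open>Every \<open>x i\<close> of the range survives the projection, so a relator and its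
  projection receive the same value.\<close>

lemma weight_eq_0:
  assumes "diagram_enumeration x" "0 < b" "b \<le> d"
    and "\<forall>r\<in>relators_between j b d. (\<Sum>i = n_check (b - 1) + 1..n_check d. \<alpha> i * tilde (x i) r) = 0"
    and "r \<in> relators j"
  shows "weight x \<alpha> {n_check (b - 1) + 1..n_check d} r = 0"
proof -
  have "x i \<in> diagrams_between b d" if "i \<in> {n_check (b - 1) + 1..n_check d}" for i
    using enumeration_between[OF assms(1-3)] that by (metis bij_betw_apply empty_iff)
  then have "weight x \<alpha> {n_check (b - 1) + 1..n_check d} r
      = (\<Sum>i = n_check (b - 1) + 1..n_check d. \<alpha> i * tilde (x i) (O_proj b d r))"
    unfolding weight_def by (intro sum.cong refl) (simp add: tilde_lookup lookup_O_proj)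
  then show ?thesis using assms(4,5) by (auto simp: relators_between_def)
qed

text \<open>Exchanging two sums: instead of counting sub-words diagram by diagram, each sub-word
  contributes the coefficient attached to its own diagram.\<close>

lemma curve_combination_word_sum:
  assumes "curve_diagram g = arrow_diagram w" "oriented_gauss_word w"
  shows "curve_combination x \<alpha> I g = word_sum (\<lambda>X. weight x \<alpha> I (frag_of X)) w"
proof -
  have "curve_combination x \<alpha> I g
      = (\<Sum>i\<in>I. \<Sum>K\<in>Pow (letters w). \<alpha> i * (if arrow_diagram (sub_word w K) = x i then 1 else 0))"
    using assms by (simp add: curve_combination_def curve_count_def int_diagram_count word_sum_def
        sum_distrib_left)
  also have "\<dots> = word_sum (\<lambda>X. weight x \<alpha> I (frag_of X)) w"
    unfolding word_sum_def weight_def tilde_lookup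
    by (subst sum.swap) (auto intro!: sum.cong simp: lookup_single when_def)
  finally show ?thesis .
qed

text \<open>Summing over the mirror involution, the claim becomes
  \<open>(\<alpha> i - \<alpha> (m i)) * (c (m i) - c i) = 0\<close> for every mirroring pair.\<close>

lemma sum_involution:
  fixes \<alpha> c :: "nat \<Rightarrow> int"
  assumes m: "\<And>i. i \<in> I \<Longrightarrow> m i \<in> I" "\<And>i. i \<in> I \<Longrightarrow> m (m i) = i"
    and eq: "\<And>i. i \<in> I \<Longrightarrow> \<alpha> i = \<alpha> (m i) \<or> c i = c (m i)"
  shows "(\<Sum>i\<in>I. \<alpha> i * c (m i)) = (\<Sum>i\<in>I. \<alpha> i * c i)"
proof -
  have bij: "bij_betw m I I" by (rule bij_betwI[where g = m]) (use m in auto)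
  have reindex: "(\<Sum>i\<in>I. f (m i)) = sum f I" for f :: "nat \<Rightarrow> int"
    using bij by (rule sum.reindex_bij_betw)
  have "2 * (\<Sum>i\<in>I. \<alpha> i * c (m i)) = (\<Sum>i\<in>I. \<alpha> i * c (m i)) + (\<Sum>i\<in>I. \<alpha> (m i) * c i)"
    using reindex[of "\<lambda>i. \<alpha> i * c (m i)"] m by simp
  also have "\<dots> = (\<Sum>i\<in>I. \<alpha> i * c i) + (\<Sum>i\<in>I. \<alpha> (m i) * c (m i))"
    unfolding sum.distrib[symmetric] using eq
    by (intro sum.cong refl) (metis add.commute)
  also have "\<dots> = 2 * (\<Sum>i\<in>I. \<alpha> i * c i)"
    using reindex[of "\<lambda>i. \<alpha> i * c i"] by simp
  finally show ?thesis by simp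
qed

text \<open>The mirror preserves the number of arrows, hence induces an involution \<open>m\<close>
  of the index range. Reversing the curve replaces the count of each diagram by the count of its
  mirror, which is the situation of \<open>sum_involution\<close>.\<close>

lemma curve_combination_reversed:
  assumes x: "diagram_enumeration x" and b: "0 < b" "b \<le> d"
    and I: "I = {n_check (b - 1) + 1..n_check d}"
    and w: "curve_diagram g = arrow_diagram w" "curve_diagram h = arrow_diagram (rev w)"
      "oriented_gauss_word w"
    and g: "spherical_curve g"
    and mir: "\<And>i j. i \<in> I \<Longrightarrow> j \<in> I \<Longrightarrow> mirroring_pair (x i) (x j) \<Longrightarrow>
       \<alpha> i = \<alpha> j \<or> reflective_pair (x i) (x j)"
  shows "curve_combination x \<alpha> I h = curve_combination x \<alpha> I g"
proof (cases "I = {}")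
  case False
  have bij: "bij_betw x I (diagrams_between b d)"
    using enumeration_between[OF x b] False I by simp
  define m where "m i = inv_into I x (mirror (x i))" for i
  have all: "x i \<in> all_diagrams" if "i \<in> I" for i
    using bij that by (auto simp: bij_betw_def diagrams_between_def diagrams_le_def)
  have "mirror (x i) \<in> diagrams_between b d" if "i \<in> I" for i
  proof -
    have "x i \<in> diagrams_between b d" using bij that by (rule bij_betw_apply)
    then show ?thesis using mirror_all_diagrams[OF all[OF that]]
      by (auto simp: diagrams_between_def diagrams_le_def)
  qed
  then have m: "m i \<in> I" "x (m i) = mirror (x i)" if "i \<in> I" for i
    using bij that unfolding m_def
    by (auto simp: bij_betw_def inv_into_into f_inv_into_f)
  have mm: "m (m i) = i" if "i \<in> I" for i
    using bij m that mirror_all_diagrams(2)[OF all[OF that]]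
    by (metis (no_types, lifting) bij_betw_def inj_onD)
  have "curve_combination x \<alpha> I h = (\<Sum>i\<in>I. \<alpha> i * int (curve_count (x (m i)) g))"
    unfolding curve_combination_def curve_count_def w
    by (intro sum.cong refl) (simp add: diagram_count_rev w(3) all m)
  also have "\<dots> = curve_combination x \<alpha> I g"
    unfolding curve_combination_def
  proof (rule sum_involution)
    fix i assume i: "i \<in> I"
    have "mirroring_pair (x i) (x (m i))"
      using mirror_all_diagrams(4)[OF all[OF i]] m[OF i] by simp
    then show "\<alpha> i = \<alpha> (m i) \<or> int (curve_count (x i) g) = int (curve_count (x (m i)) g)"
      using mir[OF i m(1)[OF i]] g by (auto simp: reflective_pair_def)
  qed (use m mm in auto)
  finally show ?thesis .
qed (simp add: curve_combination_def)

section \<open>Curves on the sphere\<close>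

lemma sorted_list_of_set_eqI:
  fixes xs :: "'a::linorder list"
  assumes "sorted_wrt (<) xs" "set xs = A"
  shows "sorted_list_of_set A = xs"
  using assms by (metis sorted_list_of_set.idem_if_sorted_distinct strict_sorted_iff subset_UNIV list.map_ident)

lemma sorted_list_of_set_Un:
  fixes A B :: "'a::linorder set"
  assumes "finite A" "finite B" "\<And>x y. x \<in> A \<Longrightarrow> y \<in> B \<Longrightarrow> x < y"
  shows "sorted_list_of_set (A \<union> B) = sorted_list_of_set A @ sorted_list_of_set B"
  using assms by (intro sorted_list_of_set_eqI) (auto simp: sorted_wrt_append)

lemma sorted_list_of_set_image_mono:
  fixes f :: "'a::linorder \<Rightarrow> 'b::linorder"
  assumes "finite A" "\<And>x y. x \<in> A \<Longrightarrow> y \<in> A \<Longrightarrow> x < y \<Longrightarrow> f x < f y"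
  shows "sorted_list_of_set (f ` A) = map f (sorted_list_of_set A)"
proof (rule sorted_list_of_set_eqI)
  have "sorted_wrt (<) (sorted_list_of_set A)" by simp
  then show "sorted_wrt (<) (map f (sorted_list_of_set A))"
    unfolding sorted_wrt_map by (rule sorted_wrt_mono_rel[rotated]) (use assms in auto)
qed (use assms(1) in simp)

lemma sorted_list_of_set_image_antimono:
  fixes f :: "'a::linorder \<Rightarrow> 'b::linorder"
  assumes "finite A" "\<And>x y. x \<in> A \<Longrightarrow> y \<in> A \<Longrightarrow> x < y \<Longrightarrow> f y < f x"
  shows "sorted_list_of_set (f ` A) = map f (rev (sorted_list_of_set A))"
proof (rule sorted_list_of_set_eqI)
  have "sorted_wrt (<) (sorted_list_of_set A)" by simp
  then show "sorted_wrt (<) (map f (rev (sorted_list_of_set A)))"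
    unfolding sorted_wrt_map sorted_wrt_rev
    by (rule sorted_wrt_mono_rel[rotated]) (use assms in auto)
qed (use assms(1) in simp)

text \<open>The points differ by less than 1, so reduction modulo 1 shifts a first group by some
  integer \<open>m\<close> and the remaining ones by \<open>m + 1\<close>. The latter then precede
  the former, which is a rotation of the list.\<close>

lemma sorted_list_of_set_frac:
  fixes A :: "real set"
  assumes A: "finite A" and lt: "\<And>x y. x \<in> A \<Longrightarrow> y \<in> A \<Longrightarrow> x < y + 1"
  shows "\<exists>k. sorted_list_of_set (frac ` A) = rotate k (map frac (sorted_list_of_set A))"
proof (cases "A = {}")
  case False
  define m where "m = \<lfloor>Min A\<rfloor>"
  let ?A1 = "{x \<in> A. x < real_of_int m + 1}" and ?A2 = "{x \<in> A. real_of_int m + 1 \<le> x}"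
  have bounds: "m \<le> x" "x < m + 2" if "x \<in> A" for x :: real
  proof -
    have "Min A \<le> x" "Min A \<in> A" using A that Min_in False by auto
    then show "m \<le> x" "x < m + 2"
      using lt[OF that \<open>Min A \<in> A\<close>] unfolding m_def by linarith+
  qed
  have f1: "frac x = x - m" if "x \<in> ?A1" for x
    using that bounds[of x] by (auto simp: frac_unique_iff)
  have f2: "frac x = x - m - 1" if "x \<in> ?A2" for x
  proof -
    have "x - (x - m - 1) = of_int (m + 1)" by simp
    then have "x - (x - m - 1) \<in> \<int>" by (metis Ints_of_int)
    then show ?thesis using that bounds[of x] unfolding frac_unique_iff by auto
  qed
  have "A = ?A1 \<union> ?A2" by auto
  have "sorted_list_of_set (frac ` A) = sorted_list_of_set (frac ` ?A2 \<union> frac ` ?A1)"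
    using \<open>A = ?A1 \<union> ?A2\<close> by (metis Un_commute image_Un)
  also have "\<dots> = sorted_list_of_set (frac ` ?A2) @ sorted_list_of_set (frac ` ?A1)"
  proof (rule sorted_list_of_set_Un)
    fix u v assume "u \<in> frac ` ?A2" "v \<in> frac ` ?A1"
    then obtain x y where "x \<in> ?A2" "y \<in> ?A1" "u = frac x" "v = frac y" by blast
    then show "u < v" using f1 f2 lt[of x y] by simp
  qed (use A in auto)
  also have "\<dots> = map frac (sorted_list_of_set ?A2) @ map frac (sorted_list_of_set ?A1)"
    using A f1 f2 by (simp add: sorted_list_of_set_image_mono)
  also have "\<dots> = rotate (length (map frac (sorted_list_of_set ?A1)))
      (map frac (sorted_list_of_set ?A1) @ map frac (sorted_list_of_set ?A2))"
    by (simp only: rotate_append)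
  also have "map frac (sorted_list_of_set ?A1) @ map frac (sorted_list_of_set ?A2)
      = map frac (sorted_list_of_set (?A1 \<union> ?A2))"
    using A by (subst sorted_list_of_set_Un) auto
  finally show ?thesis using \<open>A = ?A1 \<union> ?A2\<close> by metis
qed auto

lemma double_pointI:
  "s \<in> {0..<1} \<Longrightarrow> t \<in> {0..<1} \<Longrightarrow> s \<noteq> t \<Longrightarrow> g s = g t \<Longrightarrow> s \<in> double_points g"
  unfolding double_points_def by force

lemma double_pointE:
  assumes "t \<in> double_points g"
  obtains s where "t \<in> {0..<1}" "s \<in> {0..<1}" "s \<noteq> t" "g s = g t"
  using assms unfolding double_points_def by blast

section \<open>Frames tangent to the sphere\<close>

abbreviation velocity :: "(real \<Rightarrow> real^3) \<Rightarrow> real \<Rightarrow> real^3" where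
  "velocity g t \<equiv> vector_derivative g (at t)"

definition frame_orientation :: "real^3 \<Rightarrow> real^3 \<Rightarrow> real^3 \<Rightarrow> real" where
  "frame_orientation p u v = p \<bullet> cross3 u v"

lemma frame_orientation_swap: "frame_orientation p v u = - frame_orientation p u v"
  unfolding frame_orientation_def by (subst cross_skew) simp

lemma frame_orientation_scaleR [simp]:
  "frame_orientation p (a *\<^sub>R u) v = a * frame_orientation p u v"
  "frame_orientation p u (a *\<^sub>R v) = a * frame_orientation p u v"
  by (simp_all add: frame_orientation_def cross_mult_left cross_mult_right)

text \<open>As \<open>p\<close> is orthogonal to \<open>u\<close> and \<open>v\<close>, the product
  \<open>cross3 u v\<close> is parallel to \<open>p\<close>. If it were orthogonal to
  \<open>p\<close> too, it would vanish and \<open>u\<close>, \<open>v\<close> would be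
  collinear.\<close>

lemma frame_orientation_nonzero:
  assumes "p \<bullet> p = 1" "p \<bullet> u = 0" "p \<bullet> v = 0" "\<not> collinear {0, u, v}"
  shows "frame_orientation p u v \<noteq> 0"
proof
  assume "frame_orientation p u v = 0"
  then have "p \<bullet> cross3 u v = 0" by (simp add: frame_orientation_def)
  moreover have "cross3 p (cross3 u v) = 0" using assms by (simp add: Lagrange)
  ultimately have "p = 0 \<or> cross3 u v = 0" using norm_and_cross_eq_0 by blast
  then show False using assms by (auto simp: cross_eq_0)
qed

text \<open>Differentiate the constant \<open>f s \<bullet> f s\<close>. The condition is local so
  that it also covers short segments inside the domain of a chart.\<close>

lemma tangent_orthogonal:
  fixes f :: "real \<Rightarrow> 'a::real_inner"
  assumes f: "(f has_vector_derivative d) (at t)" and S: "open S" "t \<in> S"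
    and n: "\<And>s. s \<in> S \<Longrightarrow> f s \<bullet> f s = 1"
  shows "f t \<bullet> d = 0"
proof -
  have "((\<lambda>s. f s \<bullet> f s) has_derivative (\<lambda>h. f t \<bullet> (h *\<^sub>R d) + (h *\<^sub>R d) \<bullet> f t)) (at t)"
    using f unfolding has_vector_derivative_def by (intro has_derivative_inner)
  moreover have "((\<lambda>s. f s \<bullet> f s) has_derivative (\<lambda>h. 0)) (at t)"
    by (rule has_derivative_transform_within_open[OF has_derivative_const[of 1]])
       (use S n in auto)
  ultimately have "(\<lambda>h. f t \<bullet> (h *\<^sub>R d) + (h *\<^sub>R d) \<bullet> f t) = (\<lambda>h. 0)"
    by (rule has_derivative_unique)
  from fun_cong[OF this, of 1] show ?thesis by (simp add: inner_commute)
qed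

lemma inner_self_sphere: "x \<in> sphere 0 1 \<Longrightarrow> x \<bullet> x = (1::real)" for x :: "'a::real_inner"
  by (simp flip: power2_norm_eq_inner)

section \<open>Double points and words of a single curve\<close>

locale curve =
  fixes g :: "real \<Rightarrow> real^3"
  assumes spherical: "spherical_curve g"
begin

lemma periodic: "g (t + of_int n) = g t"
proof -
  have 1: "g (t + 1) = g t" for t using spherical by (simp add: spherical_curve_def)
  have 2: "g (t + of_nat n) = g t" for t n
  proof (induction n arbitrary: t)
    case (Suc n)
    then show ?case using 1[of "t + of_nat n"] by (simp add: algebra_simps)
  qed simp
  show ?thesis
  proof (cases "0 \<le> n")
    case True
    then show ?thesis using 2[of t "nat n"] by simp
  next
    case False
    then show ?thesis using 2[of "t + of_int n" "nat (- n)"] by simp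
  qed
qed

lemma on_sphere: "g t \<in> sphere 0 1"
  using spherical unfolding spherical_curve_def by blast

lemma inner_self: "g t \<bullet> g t = 1"
  using on_sphere inner_self_sphere by blast

lemma has_velocity: "(g has_vector_derivative velocity g t) (at t)"
  using spherical
  by (auto simp: spherical_curve_def C1_differentiable_on_eq vector_derivative_works)

lemma velocity_orthogonal: "g t \<bullet> velocity g t = 0"
  by (rule tangent_orthogonal[OF has_velocity, of UNIV]) (auto simp: inner_self)

lemma velocity_periodic: "velocity g (t + of_int n) = velocity g t"
proof -
  have "((\<lambda>s. s + of_int n) has_vector_derivative 1) (at t)"
    by (auto intro!: derivative_eq_intros)
  then have "((g \<circ> (\<lambda>s. s + of_int n)) has_vector_derivative 1 *\<^sub>R velocity g (t + of_int n)) (at t)"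
    by (rule vector_diff_chain_at) (rule has_velocity)
  then have "(g has_vector_derivative velocity g (t + of_int n)) (at t)"
    by (simp add: o_def periodic)
  then show ?thesis using has_velocity vector_derivative_unique_at by blast
qed

lemma frac_simps: "g (frac t) = g t" "velocity g (frac t) = velocity g t"
  using periodic[of t "- \<lfloor>t\<rfloor>"] velocity_periodic[of t "- \<lfloor>t\<rfloor>"] by (simp_all add: frac_def)

lemma finite_double_points: "finite (double_points g)"
  using spherical by (simp add: spherical_curve_def)

lemma crossing_nonzero:
  assumes "s \<in> {0..<1}" "t \<in> {0..<1}" "s \<noteq> t" "g s = g t"
  shows "frame_orientation (g t) (velocity g t) (velocity g s) \<noteq> 0"
proof (rule frame_orientation_nonzero)
  show "\<not> collinear {0, velocity g t, velocity g s}"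
    using spherical assms by (metis spherical_curve_def)
  show "g t \<bullet> velocity g s = 0" using assms velocity_orthogonal by metis
qed (rule inner_self velocity_orthogonal)+

lemma no_triple:
  assumes "r \<in> {0..<1}" "s \<in> {0..<1}" "t \<in> {0..<1}" "g r = g t" "g s = g t" "r \<noteq> t" "s \<noteq> t"
  shows "r = s"
  using spherical assms unfolding spherical_curve_def by metis

lemma over_branch_iff:
  assumes "s \<in> {0..<1}" "t \<in> {0..<1}" "s \<noteq> t" "g s = g t"
  shows "over_branch g t \<longleftrightarrow> 0 < frame_orientation (g t) (velocity g t) (velocity g s)"
  using assms no_triple[OF _ assms(1,2)] unfolding over_branch_def frame_orientation_def by blast

text \<open>Exchanging the two tangents changes the sign of the frame, and transversality keeps it
  away from zero.\<close>

lemma over_branch_swap: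
  assumes "s \<in> {0..<1}" "t \<in> {0..<1}" "s \<noteq> t" "g s = g t"
  shows "over_branch g s \<longleftrightarrow> \<not> over_branch g t"
  using over_branch_iff[OF assms] over_branch_iff[of t s] crossing_nonzero[OF assms] assms
    frame_orientation_swap[of "g s" "velocity g s" "velocity g t"] by auto

definition labelled_word :: "(real^3 \<Rightarrow> nat) \<Rightarrow> gword" where
  "labelled_word N =
     map (\<lambda>t. endpoint_of (over_branch g t) (N (g t))) (sorted_list_of_set (double_points g))"

text \<open>The letters in \<open>curve_word\<close> separate double points as well: the letter of
  \<open>p\<close> is one more than the index of a passage through \<open>p\<close>, so
  \<open>p\<close> can be recovered from it. Hence both labellings have the same
  coincidences.\<close>

lemma curve_diagram_labelled_word:
  assumes "inj_on N (g ` double_points g)"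
  shows "curve_diagram g = arrow_diagram (labelled_word N)"
proof -
  let ?D = "sorted_list_of_set (double_points g)"
  have letter: "g (?D ! (double_point_letter g p - 1)) = p" if "p \<in> g ` double_points g" for p
  proof -
    obtain t where "t \<in> set ?D" "g t = p" using \<open>p \<in> _\<close> finite_double_points by auto
    then obtain n where "g (?D ! n) = p" by (auto simp: in_set_conv_nth)
    then have "g (?D ! (LEAST n. g (?D ! n) = p)) = p" by (rule LeastI)
    then show ?thesis by (simp add: double_point_letter_def)
  qed
  have "curve_word g =
      map (\<lambda>t. endpoint_of (over_branch g t) (double_point_letter g (g t))) ?D"
    by (simp add: curve_word_def endpoint_of_def)
  moreover have "double_point_letter g (g s) = double_point_letter g (g t) \<longleftrightarrow> N (g s) = N (g t)"
    if "s \<in> set ?D" "t \<in> set ?D" for s t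
  proof -
    have "g s \<in> g ` double_points g" "g t \<in> g ` double_points g"
      using that finite_double_points by auto
    then show ?thesis using letter inj_on_eq_iff[OF assms] by metis
  qed
  ultimately show ?thesis
    unfolding curve_diagram_def labelled_word_def
    using isomorphic_words_endpoint_of[of ?D "\<lambda>t. double_point_letter g (g t)" "\<lambda>t. N (g t)"]
    by (auto intro!: arrow_diagram_eqI)
qed

text \<open>Each double point is passed exactly twice, once above and once below, so its letter
  occurs once as a starting point and once as an end point.\<close>

lemma oriented_gauss_word_labelled_word:
  assumes N: "inj_on N (g ` double_points g)" "\<And>p. p \<in> g ` double_points g \<Longrightarrow> 0 < N p"
  shows "oriented_gauss_word (labelled_word N)"
proof -
  let ?D = "sorted_list_of_set (double_points g)"
  let ?l = "\<lambda>t. endpoint_of (over_branch g t) (N (g t))"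
  have D: "set ?D = double_points g" using finite_double_points by simp
  have "inj_on ?l (double_points g)"
  proof (rule inj_onI)
    fix s t assume s: "s \<in> double_points g" and t: "t \<in> double_points g" and l: "?l s = ?l t"
    then have "N (g s) = N (g t)" by (metis letter_endpoint_of)
    then have "g s = g t" using N s t by (auto dest: inj_onD)
    then show "s = t" using s t l over_branch_swap[of s t]
      by (auto simp: endpoint_of_def double_points_def split: if_splits)
  qed
  moreover have "0 < k \<and> Start k \<in> ?l ` double_points g \<and> End k \<in> ?l ` double_points g"
    if "k \<in> letters (labelled_word N)" for k
  proof -
    have "letters (labelled_word N) = (\<lambda>t. N (g t)) ` double_points g"
      by (simp add: labelled_word_def letters_def image_image D)
    then obtain t where t: "t \<in> double_points g" "k = N (g t)"
      using \<open>k \<in> letters (labelled_word N)\<close> by blast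
    obtain s where st: "t \<in> {0..<1}" "s \<in> {0..<1}" "s \<noteq> t" "g s = g t"
      using t(1) by (rule double_pointE)
    then have s: "s \<in> double_points g" "g s = g t" "s \<noteq> t"
      by (auto intro: double_pointI[of s t])
    have o: "over_branch g s \<longleftrightarrow> \<not> over_branch g t"
      using over_branch_swap[of s t] st by simp
    have "{Start k, End k} = {?l s, ?l t}" using s(2) t(2) o by (auto simp: endpoint_of_def)
    moreover have "{?l s, ?l t} \<subseteq> ?l ` double_points g" using s(1) t(1) by blast
    ultimately have "Start k \<in> ?l ` double_points g" "End k \<in> ?l ` double_points g" by blast+
    then show ?thesis using N(2) t by auto
  qed
  ultimately show ?thesis
    using D by (simp add: oriented_gauss_word_def distinct_map labelled_word_def)
qed

text \<open>With \<open>n = 3\<close>, the letters 1, 2, 3 stay free for the crossings in the disk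
  of a deformation.\<close>

lemma exists_labelling: "\<exists>N. inj_on N (g ` double_points g) \<and> (\<forall>p. (n::nat) < N p)"
proof -
  obtain f :: "real^3 \<Rightarrow> nat" where "inj_on f (g ` double_points g)"
    using finite_double_points finite_imp_inj_to_nat_seg by (metis finite_imageI)
  then have "inj_on (\<lambda>p. Suc (n + f p)) (g ` double_points g)" by (auto simp: inj_on_def)
  then show ?thesis by (intro exI[of _ "\<lambda>p. Suc (n + f p)"]) auto
qed

end

section \<open>Reparametrization, reversal and isotopy\<close>

text \<open>A map of the circle described by a lift to the line. The behaviour under integer shifts
  is existential because a reparametrization keeps the shift while \<open>t \<mapsto> - t\<close>
  negates it.\<close>

lemma bij_betw_frac_compose:
  fixes \<theta> :: "real \<Rightarrow> real"
  assumes bij: "bij \<theta>"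
    and tr: "\<And>t n. \<exists>m. \<theta> (t + of_int n) = \<theta> t + of_int m"
    and tr': "\<And>t m. \<exists>n. \<theta> t + of_int m = \<theta> (t + of_int n)"
  shows "bij_betw (\<lambda>t. frac (\<theta> t)) {0..<1} {0..<1}"
  unfolding bij_betw_def
proof
  show "inj_on (\<lambda>t. frac (\<theta> t)) {0..<1}"
  proof (rule inj_onI)
    fix s t :: real assume s: "s \<in> {0..<1}" and t: "t \<in> {0..<1}" and eq: "frac (\<theta> s) = frac (\<theta> t)"
    from eq have "\<theta> s = \<theta> t + of_int (\<lfloor>\<theta> s\<rfloor> - \<lfloor>\<theta> t\<rfloor>)" by (simp add: frac_def)
    then obtain n :: int where "\<theta> s = \<theta> (t + of_int n)"
      using tr'[of t "\<lfloor>\<theta> s\<rfloor> - \<lfloor>\<theta> t\<rfloor>"] by auto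
    then have n: "s = t + of_int n" using bij by (simp add: bij_def inj_eq)
    then have "\<bar>of_int n :: real\<bar> < 1" using s t by auto
    then have "n = 0" by linarith
    then show "s = t" using n by simp
  qed
  show "(\<lambda>t. frac (\<theta> t)) ` {0..<1} = {0..<1}"
  proof (intro equalityI subsetI)
    fix u :: real assume u: "u \<in> {0..<1}"
    obtain x where x: "\<theta> x = u" using bij_is_surj[OF bij] by (metis surjD)
    obtain m where "\<theta> (x + of_int (- \<lfloor>x\<rfloor>)) = \<theta> x + of_int m"
      using tr[of x "- \<lfloor>x\<rfloor>"] by blast
    then have "\<theta> (frac x) = u + of_int m" using x by (simp add: frac_def)
    then have "frac (\<theta> (frac x)) = u" using u by simp
    then show "u \<in> (\<lambda>t. frac (\<theta> t)) ` {0..<1}"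
      by (intro image_eqI[of _ _ "frac x"]) (auto simp: frac_lt_1)
  qed (auto simp: frac_lt_1)
qed

text \<open>Common core of reversal and isotopy: a bijection of the circle that respects
  coincidences and frame signs transports all the data a word is made of. The times form a list in
  arbitrary order because reversal lists them backwards.\<close>

lemma transfer_double_points:
  assumes g: "curve g" and h: "curve h"
    and bij: "bij_betw \<tau> {0..<1} {0..<1}"
    and eq: "\<And>s t. s \<in> {0..<1} \<Longrightarrow> t \<in> {0..<1} \<Longrightarrow> h (\<tau> s) = h (\<tau> t) \<longleftrightarrow> g s = g t"
    and sign': "\<forall>s\<in>{0..<1}. \<forall>t\<in>{0..<1}. s \<noteq> t \<and> g s = g t \<longrightarrow>
       (0 < frame_orientation (h (\<tau> t)) (velocity h (\<tau> t)) (velocity h (\<tau> s))) =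
       (0 < frame_orientation (g t) (velocity g t) (velocity g s))"
  shows "double_points h = \<tau> ` double_points g"
    and "t \<in> double_points g \<Longrightarrow> over_branch h (\<tau> t) = over_branch g t"
    and "set ts \<subseteq> double_points g \<Longrightarrow> inj_on M (g ` double_points g) \<Longrightarrow>
      inj_on N (h ` double_points h) \<Longrightarrow>
      isomorphic_words (map (\<lambda>t. endpoint_of (over_branch h t) (N (h t))) (map \<tau> ts))
         (map (\<lambda>t. endpoint_of (over_branch g t) (M (g t))) ts)"
proof -
  interpret g: curve g by fact
  interpret h: curve h by fact
  have \<tau>: "\<tau> t \<in> {0..<1}" if "t \<in> {0..<1}" for t using bij that by (rule bij_betw_apply)
  have inj: "\<tau> s = \<tau> t \<longleftrightarrow> s = t" if "s \<in> {0..<1}" "t \<in> {0..<1}" for s t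
    using bij that by (auto simp: bij_betw_def inj_on_def)
  show D: "double_points h = \<tau> ` double_points g"
  proof (intro equalityI subsetI)
    fix u assume "u \<in> double_points h"
    then obtain v where uv: "u \<in> {0..<1}" "v \<in> {0..<1}" "v \<noteq> u" "h v = h u"
      by (rule double_pointE)
    have "u \<in> \<tau> ` {0..<1}" "v \<in> \<tau> ` {0..<1}" using uv bij by (simp_all add: bij_betw_def)
    then obtain s t where "s \<in> {0..<1}" "t \<in> {0..<1}" "v = \<tau> s" "u = \<tau> t" by blast
    moreover from this have "s \<noteq> t" "g s = g t" using uv eq by auto
    ultimately have "t \<in> double_points g" by (intro double_pointI[of t s]) auto
    then show "u \<in> \<tau> ` double_points g" using \<open>u = \<tau> t\<close> by blast
  next
    fix u assume "u \<in> \<tau> ` double_points g"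
    then obtain t where t: "t \<in> double_points g" "u = \<tau> t" by blast
    obtain s where st: "t \<in> {0..<1}" "s \<in> {0..<1}" "s \<noteq> t" "g s = g t"
      using t(1) by (rule double_pointE)
    then have "\<tau> s \<noteq> \<tau> t" "h (\<tau> s) = h (\<tau> t)" using inj eq by auto
    then show "u \<in> double_points h"
      using t(2) double_pointI[OF \<tau>[OF st(1)] \<tau>[OF st(2)]] by metis
  qed
  show o: "over_branch h (\<tau> t) = over_branch g t" if t: "t \<in> double_points g" for t
  proof -
    obtain s where "t \<in> {0..<1}" "s \<in> {0..<1}" "s \<noteq> t" "g s = g t"
      using t by (rule double_pointE)
    then have st: "s \<in> {0..<1}" "t \<in> {0..<1}" "s \<noteq> t" "g s = g t" by simp_all
    have "over_branch h (\<tau> t) \<longleftrightarrow>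
        0 < frame_orientation (h (\<tau> t)) (velocity h (\<tau> t)) (velocity h (\<tau> s))"
      by (rule h.over_branch_iff) (use st \<tau> inj eq in auto)
    also have "\<dots> \<longleftrightarrow> 0 < frame_orientation (g t) (velocity g t) (velocity g s)"
      using sign' st by blast
    also have "\<dots> \<longleftrightarrow> over_branch g t"
      by (rule g.over_branch_iff[OF st, symmetric])
    finally show ?thesis .
  qed
  show "isomorphic_words (map (\<lambda>t. endpoint_of (over_branch h t) (N (h t))) (map \<tau> ts))
         (map (\<lambda>t. endpoint_of (over_branch g t) (M (g t))) ts)"
    if ts: "set ts \<subseteq> double_points g" and M: "inj_on M (g ` double_points g)"
      and N: "inj_on N (h ` double_points h)"
  proof -
    have lab: "map (\<lambda>t. endpoint_of (over_branch h t) (N (h t))) (map \<tau> ts)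
        = map (\<lambda>t. endpoint_of (over_branch g t) (N (h (\<tau> t)))) ts"
      unfolding map_map using o ts by (intro map_cong) (simp_all add: subset_iff)
    have "N (h (\<tau> s)) = N (h (\<tau> t)) \<longleftrightarrow> M (g s) = M (g t)"
      if "s \<in> set ts" "t \<in> set ts" for s t
    proof -
      have st: "s \<in> double_points g" "t \<in> double_points g"
        using that ts by auto
      have "N (h (\<tau> s)) = N (h (\<tau> t)) \<longleftrightarrow> h (\<tau> s) = h (\<tau> t)"
        using st by (intro inj_on_eq_iff[OF N]) (simp_all add: D)
      also have "\<dots> \<longleftrightarrow> g s = g t" using st eq by (simp add: double_points_def)
      also have "\<dots> \<longleftrightarrow> M (g s) = M (g t)"
        using st by (intro inj_on_eq_iff[OF M, symmetric]) simp_all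
      finally show ?thesis .
    qed
    then show ?thesis unfolding lab by (rule isomorphic_words_endpoint_of)
  qed
qed

text \<open>On the line, negation reverses the order of the times; reduction modulo 1 then only
  moves the base point.\<close>

lemma curve_diagram_reversed:
  assumes g: "spherical_curve g" and h: "spherical_curve (reversed g)"
    and M: "inj_on M (g ` double_points g)"
  shows "curve_diagram (reversed g) = arrow_diagram (rev (curve.labelled_word g M))"
proof -
  interpret g: curve g using g by unfold_locales
  interpret h: curve "reversed g" using h by unfold_locales
  let ?\<tau> = "\<lambda>t::real. frac (- t)" and ?D = "double_points g"
  have bij: "bij_betw ?\<tau> {0..<1} {0..<1}"
  proof (rule bij_betw_frac_compose)
    fix t :: real and n :: int
    show "\<exists>m. - (t + of_int n) = - t + of_int m" by (rule exI[of _ "- n"]) simp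
    show "\<exists>m. - t + of_int n = - (t + of_int m)" by (rule exI[of _ "- n"]) simp
  qed (rule bij_uminus)
  have vel: "velocity (reversed g) (- t) = - velocity g t" for t
  proof -
    have "(uminus has_vector_derivative - 1) (at (- t))" by (auto intro!: derivative_eq_intros)
    then have "((g \<circ> uminus) has_vector_derivative (- 1) *\<^sub>R velocity g (- (- t))) (at (- t))"
      by (rule vector_diff_chain_at) (simp add: g.has_velocity)
    then show ?thesis by (simp add: reversed_def o_def vector_derivative_at)
  qed
  have pt: "reversed g (?\<tau> t) = g t" "velocity (reversed g) (?\<tau> t) = - velocity g t" for t
    unfolding h.frac_simps vel by (simp_all add: reversed_def)
  have eq: "reversed g (?\<tau> s) = reversed g (?\<tau> t) \<longleftrightarrow> g s = g t" for s t by (simp add: pt)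
  have sign: "\<forall>s\<in>{0..<1}. \<forall>t\<in>{0..<1}. s \<noteq> t \<and> g s = g t \<longrightarrow>
      (0 < frame_orientation (reversed g (?\<tau> t)) (velocity (reversed g) (?\<tau> t))
        (velocity (reversed g) (?\<tau> s))) = (0 < frame_orientation (g t) (velocity g t) (velocity g s))"
    by (simp add: pt frame_orientation_def)
  note transfer = transfer_double_points[OF g.curve_axioms h.curve_axioms bij eq sign]
  have fin: "finite ?D" by (rule g.finite_double_points)
  have "double_points (reversed g) = frac ` uminus ` ?D"
    using transfer(1) by (simp add: image_image)
  moreover have "\<exists>k. sorted_list_of_set (frac ` uminus ` ?D)
      = rotate k (map frac (sorted_list_of_set (uminus ` ?D)))"
    by (rule sorted_list_of_set_frac) (use fin in \<open>auto simp: double_points_def\<close>)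
  moreover have "sorted_list_of_set (uminus ` ?D) = map uminus (rev (sorted_list_of_set ?D))"
    using fin by (intro sorted_list_of_set_image_antimono) auto
  ultimately obtain k where "sorted_list_of_set (double_points (reversed g))
      = rotate k (map ?\<tau> (rev (sorted_list_of_set ?D)))"
    by (auto simp: o_def)
  then have lw: "h.labelled_word N = rotate k (map (\<lambda>t. endpoint_of (over_branch (reversed g) t)
      (N (reversed g t))) (map ?\<tau> (rev (sorted_list_of_set ?D))))" for N
    by (simp add: h.labelled_word_def rotate_map)
  obtain N :: "real^3 \<Rightarrow> nat" where N: "inj_on N (reversed g ` double_points (reversed g))"
    using h.exists_labelling[of 0] by blast
  have "curve_diagram (reversed g) = arrow_diagram (h.labelled_word N)"
    using N by (rule h.curve_diagram_labelled_word)
  also have "\<dots> = arrow_diagram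
      (map (\<lambda>t. endpoint_of (over_branch g t) (M (g t))) (rev (sorted_list_of_set ?D)))"
    unfolding lw arrow_diagram_rotate
    by (intro arrow_diagram_eqI transfer(3)) (use fin M N in auto)
  finally show ?thesis by (simp add: g.labelled_word_def rev_map)
qed

section \<open>Frames along an isotopy and under reparametrization\<close>

lemma nonzero_same_sign:
  fixes f :: "'a::topological_space \<Rightarrow> real"
  assumes "continuous_on S f" "connected S" "\<And>x. x \<in> S \<Longrightarrow> f x \<noteq> 0" "x \<in> S" "y \<in> S"
  shows "0 < f x \<longleftrightarrow> 0 < f y"
proof -
  have "connected (f ` S)" using assms by (intro connected_continuous_image)
  then have ivl: "\<And>a b c. a \<in> f ` S \<Longrightarrow> b \<in> f ` S \<Longrightarrow> a \<le> c \<Longrightarrow> c \<le> b \<Longrightarrow> c \<in> f ` S"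
    unfolding connected_iff_interval by blast
  have "0 \<notin> f ` S" using assms(3) by force
  then show ?thesis using ivl[of "f x" "f y" 0] ivl[of "f y" "f x" 0] assms(4,5) by force
qed

text \<open>The orientation of the transported frame is a continuous function of the isotopy
  parameter without zeros, so its sign at 1 equals its sign at 0.\<close>

lemma isotopy_orientation:
  assumes \<Phi>: "ambient_isotopy \<Phi>" and g: "curve g"
  obtains L where "\<And>t. ((\<lambda>s. \<Phi> 1 (g s)) has_vector_derivative L t) (at t)"
    and "\<And>s t. g s = g t \<Longrightarrow> \<not> collinear {0, velocity g t, velocity g s} \<Longrightarrow>
       0 < frame_orientation (\<Phi> 1 (g t)) (L t) (L s) \<longleftrightarrow>
       0 < frame_orientation (g t) (velocity g t) (velocity g s)"
proof -
  interpret g: curve g by fact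
  obtain D :: "real \<Rightarrow> real^3 \<Rightarrow> ((real^3) \<Rightarrow>\<^sub>L (real^3))" where
    contD: "continuous_on ({0..1} \<times> sphere 0 1) (\<lambda>(t, x). D t x)" and
    D: "\<forall>t\<in>{0..1}. \<forall>x\<in>sphere 0 1.
           (\<Phi> t has_derivative blinfun_apply (D t x)) (at x within sphere 0 1) \<and>
           (\<forall>v. v \<bullet> x = 0 \<and> v \<noteq> 0 \<longrightarrow> blinfun_apply (D t x) v \<noteq> 0)"
    using \<Phi> unfolding ambient_isotopy_def by blast
  have der: "(\<Phi> r has_derivative blinfun_apply (D r x)) (at x within sphere 0 1)"
    and inj: "v \<bullet> x = 0 \<Longrightarrow> v \<noteq> 0 \<Longrightarrow> blinfun_apply (D r x) v \<noteq> 0"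
    if "r \<in> {0..1}" "x \<in> sphere 0 1" for r x v
    using D that by blast+
  have cont: "continuous_on ({0..1} \<times> sphere 0 1) (\<lambda>(t, x). \<Phi> t x)"
    and \<Phi>0: "\<And>x. x \<in> sphere 0 1 \<Longrightarrow> \<Phi> 0 x = x"
    and bij: "\<And>r. r \<in> {0..1} \<Longrightarrow> bij_betw (\<Phi> r) (sphere 0 1) (sphere 0 1)"
    using \<Phi> unfolding ambient_isotopy_def by blast+
  define L where "L r t = blinfun_apply (D r (g t)) (velocity g t)" for r t
  have L: "((\<lambda>s. \<Phi> r (g s)) has_vector_derivative L r t) (at t)" if "r \<in> {0..1}" for r t
  proof -
    \<comment> \<open>The derivative of \<open>\<Phi> r\<close> is known only within the sphere,
      which is enough for a curve that stays on it.\<close>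
    have "range g \<subseteq> sphere 0 1" using g.on_sphere by blast
    then have "(\<Phi> r has_derivative blinfun_apply (D r (g t))) (at (g t) within range g)"
      by (rule has_derivative_subset[OF der[OF that g.on_sphere]])
    then have "((\<lambda>s. \<Phi> r (g s)) has_derivative
        (\<lambda>h. blinfun_apply (D r (g t)) (h *\<^sub>R velocity g t))) (at t)"
      by (rule has_derivative_in_compose[OF g.has_velocity[unfolded has_vector_derivative_def]])
    then show ?thesis
      by (simp add: has_vector_derivative_def L_def blinfun.scaleR_right)
  qed
  \<comment> \<open>Nothing is assumed about \<open>D 0\<close> directly; its effect on velocities
    follows from \<open>\<Phi> 0\<close> fixing the sphere pointwise.\<close>
  have L0: "L 0 t = velocity g t" for t
  proof -
    have "(g has_vector_derivative L 0 t) (at t)" using L[of 0 t] \<Phi>0 g.on_sphere by simp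
    then show ?thesis using g.has_velocity vector_derivative_unique_at by blast
  qed
  have sph: "\<Phi> r (g t) \<in> sphere 0 1" if "r \<in> {0..1}" for r t
    using bij[OF that] g.on_sphere by (rule bij_betw_apply)
  have orth: "\<Phi> r (g t) \<bullet> L r t = 0" if "r \<in> {0..1}" for r t
    by (rule tangent_orthogonal[OF L[OF that], of UNIV]) (use sph[OF that] inner_self_sphere in blast)+
  show ?thesis
  proof (rule that[of "L 1"])
    show "((\<lambda>s. \<Phi> 1 (g s)) has_vector_derivative L 1 t) (at t)" for t
      by (rule L) simp
    fix s t assume eq: "g s = g t" and nc: "\<not> collinear {0, velocity g t, velocity g s}"
    \<comment> \<open>\<open>D r x\<close> is known to be injective on the tangent plane only, so a
      dependence is pulled back through \<open>velocity g s - c *\<^sub>R velocity g t\<close>,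
      which is tangent.\<close>
    have ncL: "\<not> collinear {0, L r t, L r s}" if r: "r \<in> {0..1}" for r
    proof
      assume "collinear {0, L r t, L r s}"
      moreover have "velocity g t \<noteq> 0" "velocity g s \<noteq> 0" using nc by (auto simp: collinear_lemma)
      then have "L r t \<noteq> 0" "L r s \<noteq> 0"
        unfolding L_def using inj[OF r g.on_sphere] g.velocity_orthogonal inner_commute by metis+
      ultimately obtain c where "L r s = c *\<^sub>R L r t" by (metis collinear_lemma)
      then have "blinfun_apply (D r (g t)) (velocity g s - c *\<^sub>R velocity g t) = 0"
        by (simp add: L_def eq blinfun.diff_right blinfun.scaleR_right)
      moreover have "(velocity g s - c *\<^sub>R velocity g t) \<bullet> g t = 0"
        using g.velocity_orthogonal[of t] g.velocity_orthogonal[of s] eq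
        by (subst inner_commute) (simp add: inner_diff_right)
      ultimately have "velocity g s = c *\<^sub>R velocity g t"
        using inj[OF r g.on_sphere] by (metis eq_iff_diff_eq_0)
      then show False using nc by (auto simp: collinear_lemma)
    qed
    let ?F = "\<lambda>r. frame_orientation (\<Phi> r (g t)) (L r t) (L r s)"
    have "continuous_on {0..1} ?F"
      unfolding frame_orientation_def
    proof (intro continuous_on_inner continuous_on_cross)
      have sub: "continuous_on {0..1} (\<lambda>r::real. (r, g t))" "(\<lambda>r. (r, g t)) ` {0..1} \<subseteq> {0..1} \<times> sphere 0 1"
        using g.on_sphere by (auto intro!: continuous_intros)
      show "continuous_on {0..1} (\<lambda>r. \<Phi> r (g t))"
        using continuous_on_compose2[OF cont sub] by simp
      have "continuous_on {0..1} (\<lambda>r. D r (g t))"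
        using continuous_on_compose2[OF contD sub] by simp
      then show "continuous_on {0..1} (\<lambda>r. L r t)" "continuous_on {0..1} (\<lambda>r. L r s)"
        unfolding L_def eq by (intro continuous_intros; assumption)+
    qed
    moreover have "?F r \<noteq> 0" if "r \<in> {0..1}" for r
      using ncL[OF that] orth[OF that, of t] orth[OF that, of s] sph[OF that, of t] eq
      by (intro frame_orientation_nonzero) (auto intro: inner_self_sphere)
    ultimately have "0 < ?F 1 \<longleftrightarrow> 0 < ?F 0"
      by (intro nonzero_same_sign[of "{0..1}"]) auto
    then show "0 < frame_orientation (\<Phi> 1 (g t)) (L 1 t) (L 1 s) \<longleftrightarrow>
       0 < frame_orientation (g t) (velocity g t) (velocity g s)"
      using \<Phi>0 g.on_sphere by (simp add: L0)
  qed
qed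

lemma circle_reparametrization_bij:
  assumes "circle_reparametrization \<rho>"
  shows "strict_mono \<rho>" "bij \<rho>" "\<rho> (t + of_int n) = \<rho> t + of_int n"
    "(\<rho> has_vector_derivative deriv \<rho> t) (at t)"
proof -
  have step: "\<rho> (t + 1) = \<rho> t + 1" and pos: "0 < deriv \<rho> t" for t
    using assms by (auto simp: circle_reparametrization_def)
  obtain D where D: "\<And>t. (\<rho> has_vector_derivative D t) (at t)"
    using assms unfolding circle_reparametrization_def C1_differentiable_on_def by blast
  then have D': "(\<rho> has_real_derivative D t) (at t)" for t
    by (simp add: has_real_derivative_iff_has_vector_derivative)
  then have dD: "deriv \<rho> t = D t" for t by (rule DERIV_imp_deriv)
  then show "(\<rho> has_vector_derivative deriv \<rho> t) (at t)" for t using D by simp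
  show sm: "strict_mono \<rho>"
    by (rule strict_monoI) (metis DERIV_pos_imp_increasing D' dD pos)
  have nat: "\<rho> (t + of_nat n) = \<rho> t + of_nat n" for t n
  proof (induction n arbitrary: t)
    case (Suc n)
    then show ?case using step[of "t + of_nat n"] by (simp add: algebra_simps)
  qed simp
  show int: "\<rho> (t + of_int n) = \<rho> t + of_int n" for t n
  proof (cases "0 \<le> n")
    case True
    then show ?thesis using nat[of t "nat n"] by simp
  next
    case False
    then show ?thesis using nat[of "t + of_int n" "nat (- n)"] by simp
  qed
  have "\<exists>x. \<rho> x = y" for y
  proof -
    \<comment> \<open>The values of \<open>\<rho>\<close> at consecutive integers are one apart, so
      those at \<open>?n\<close> and \<open>?n + 1\<close> enclose \<open>y\<close>.\<close>
    let ?n = "\<lfloor>y - \<rho> 0\<rfloor>"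
    have "\<rho> (of_int ?n) \<le> y" "y \<le> \<rho> (of_int (?n + 1))"
      using int[of 0 ?n] int[of 0 "?n + 1"] by (simp_all, linarith+)
    moreover have "continuous_on {of_int ?n..of_int (?n + 1)} \<rho>"
      using D' by (meson DERIV_continuous continuous_at_imp_continuous_on)
    ultimately show ?thesis
      using IVT'[of \<rho> "of_int ?n" y "of_int (?n + 1)"] by auto
  qed
  then show "bij \<rho>" using sm by (metis bijI surjI strict_mono_imp_inj_on surj_def)
qed

lemma curve_diagram_same_curve:
  assumes g: "spherical_curve g" and h: "spherical_curve h" and "same_curve g h"
  shows "curve_diagram g = curve_diagram h"
proof -
  interpret g: curve g using g by unfold_locales
  interpret h: curve h using h by unfold_locales
  obtain \<Phi> \<rho> where \<Phi>: "ambient_isotopy \<Phi>" and \<rho>: "circle_reparametrization \<rho>"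
    and h\<rho>: "\<And>t. h (\<rho> t) = \<Phi> 1 (g t)"
    using assms(3) by (auto simp: same_curve_def)
  note r = circle_reparametrization_bij[OF \<rho>]
  let ?\<tau> = "\<lambda>t::real. frac (\<rho> t)" and ?D = "double_points g"
  have bij: "bij_betw ?\<tau> {0..<1} {0..<1}"
    by (rule bij_betw_frac_compose) (use r in auto)
  have inj: "inj_on (\<Phi> 1) (sphere 0 1)"
    using \<Phi> unfolding ambient_isotopy_def bij_betw_def by simp
  have eq: "h (?\<tau> s) = h (?\<tau> t) \<longleftrightarrow> g s = g t" for s t
    using inj g.on_sphere by (auto simp: h.frac_simps h\<rho> dest: inj_onD)
  obtain L where L: "\<And>t. ((\<lambda>s. \<Phi> 1 (g s)) has_vector_derivative L t) (at t)"
    and sgn: "\<And>s t. g s = g t \<Longrightarrow> \<not> collinear {0, velocity g t, velocity g s} \<Longrightarrow>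
       0 < frame_orientation (\<Phi> 1 (g t)) (L t) (L s) \<longleftrightarrow>
       0 < frame_orientation (g t) (velocity g t) (velocity g s)"
    using isotopy_orientation[OF \<Phi> g.curve_axioms] by blast
  \<comment> \<open>Reparametrization rescales velocities by positive factors, which do not affect
    the signs of frames.\<close>
  have vel: "L t = deriv \<rho> t *\<^sub>R velocity h (\<rho> t)" for t
  proof -
    have "((h \<circ> \<rho>) has_vector_derivative deriv \<rho> t *\<^sub>R velocity h (\<rho> t)) (at t)"
      using r(4) h.has_velocity by (rule vector_diff_chain_at)
    then show ?thesis
      using L[of t] vector_derivative_unique_at by (fastforce simp: o_def h\<rho>)
  qed
  have sign: "\<forall>s\<in>{0..<1}. \<forall>t\<in>{0..<1}. s \<noteq> t \<and> g s = g t \<longrightarrow>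
      (0 < frame_orientation (h (?\<tau> t)) (velocity h (?\<tau> t)) (velocity h (?\<tau> s))) =
      (0 < frame_orientation (g t) (velocity g t) (velocity g s))"
  proof (intro ballI impI, elim conjE)
    fix s t :: real
    assume st: "s \<in> {0..<1}" "t \<in> {0..<1}" "s \<noteq> t" "g s = g t"
    have "0 < deriv \<rho> s" "0 < deriv \<rho> t" using \<rho> by (auto simp: circle_reparametrization_def)
    moreover have "\<not> collinear {0, velocity g t, velocity g s}"
      using g st unfolding spherical_curve_def by metis
    ultimately show "(0 < frame_orientation (h (?\<tau> t)) (velocity h (?\<tau> t)) (velocity h (?\<tau> s))) =
      (0 < frame_orientation (g t) (velocity g t) (velocity g s))"
      using sgn[OF st(4)] by (simp add: h.frac_simps h\<rho> vel zero_less_mult_iff)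
  qed
  note transfer = transfer_double_points[OF g.curve_axioms h.curve_axioms bij eq sign]
  have fin: "finite ?D" by (rule g.finite_double_points)
  have "double_points h = frac ` \<rho> ` ?D"
    using transfer(1) by (simp add: image_image)
  moreover have "\<exists>k. sorted_list_of_set (frac ` \<rho> ` ?D)
      = rotate k (map frac (sorted_list_of_set (\<rho> ` ?D)))"
  proof (rule sorted_list_of_set_frac)
    fix x y assume "x \<in> \<rho> ` ?D" "y \<in> \<rho> ` ?D"
    then obtain s t where "x = \<rho> s" "y = \<rho> t" "s < t + 1" by (auto simp: double_points_def)
    then show "x < y + 1" using strict_monoD[OF r(1), of s "t + 1"] r(3)[of t 1] by simp
  qed (use fin in simp)
  moreover have "sorted_list_of_set (\<rho> ` ?D) = map \<rho> (sorted_list_of_set ?D)"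
    using fin r(1) by (intro sorted_list_of_set_image_mono) (auto simp: strict_mono_less)
  ultimately obtain k where "sorted_list_of_set (double_points h)
      = rotate k (map ?\<tau> (sorted_list_of_set ?D))"
    by (auto simp: o_def)
  then have lw: "h.labelled_word N = rotate k (map (\<lambda>t. endpoint_of (over_branch h t)
      (N (h t))) (map ?\<tau> (sorted_list_of_set ?D)))" for N
    by (simp add: h.labelled_word_def rotate_map)
  obtain N :: "real^3 \<Rightarrow> nat" where N: "inj_on N (h ` double_points h)" using h.exists_labelling[of 0] by blast
  obtain M :: "real^3 \<Rightarrow> nat" where M: "inj_on M (g ` double_points g)" using g.exists_labelling[of 0] by blast
  have "curve_diagram h = arrow_diagram (h.labelled_word N)"
    using N by (rule h.curve_diagram_labelled_word)
  also have "\<dots> = arrow_diagram (g.labelled_word M)"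
    unfolding lw arrow_diagram_rotate g.labelled_word_def
    by (intro arrow_diagram_eqI transfer(3)) (use fin M N in auto)
  also have "\<dots> = curve_diagram g" using g.curve_diagram_labelled_word[OF M] ..
  finally show ?thesis ..
qed

section \<open>Local changes\<close>

text \<open>The sign is 1 if the chart preserves orientation and -1 if it reverses it. The centre
  stands for the whole square, on which the sign is constant.\<close>

definition chart_sign :: "(real \<times> real \<Rightarrow> real^3) \<Rightarrow> real" where
  "chart_sign \<psi> = sgn (frame_orientation (\<psi> (0, 0))
     (frechet_derivative \<psi> (at (0, 0)) (1, 0)) (frechet_derivative \<psi> (at (0, 0)) (0, 1)))"

definition plane_cross :: "real \<times> real \<Rightarrow> real \<times> real \<Rightarrow> real" where
  "plane_cross u v = fst u * snd v - snd u * fst v"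

lemma frame_orientation_linear:
  assumes "linear L"
  shows "frame_orientation p (L u) (L v) = plane_cross u v * frame_orientation p (L (1, 0)) (L (0, 1))"
proof -
  have L: "L w = fst w *\<^sub>R L (1, 0) + snd w *\<^sub>R L (0, 1)" for w
    using assms by (simp flip: linear_add linear_scale)
  have "cross3 (L u) (L v) = plane_cross u v *\<^sub>R cross3 (L (1, 0)) (L (0, 1))"
    unfolding L[of u] L[of v] plane_cross_def
    by (simp add: cross_add_left cross_add_right cross_mult_left cross_mult_right
        cross_skew[of "L (0, 1)" "L (1, 0)"] algebra_simps)
  then show ?thesis by (simp add: frame_orientation_def)
qed

lemma square_chart_inj: "square_chart \<psi> \<Longrightarrow> inj_on \<psi> model_square"
  unfolding square_chart_def by (meson inj_on_subset)

text \<open>The derivative of the chart is injective with values in tangent planes, so it maps the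
  standard frame to a frame of nonzero orientation, whose sign is constant by connectedness of the
  square. Any other pair of vectors contributes its determinant as a factor.\<close>

lemma square_chart_frame:
  assumes "square_chart \<psi>"
  shows "chart_sign \<psi> \<in> {-1, 1}"
    and "z \<in> model_square \<Longrightarrow> \<exists>L. (\<psi> has_derivative L) (at z) \<and>
      (\<forall>u v. sgn (frame_orientation (\<psi> z) (L u) (L v)) = chart_sign \<psi> * sgn (plane_cross u v))"
proof -
  obtain U where U: "open U" "model_square \<subseteq> U" "\<psi> ` U \<subseteq> sphere 0 1"
    and ex: "\<exists>D :: real \<times> real \<Rightarrow> ((real \<times> real) \<Rightarrow>\<^sub>L (real^3)).
           continuous_on U D \<and>
           (\<forall>z\<in>U. (\<psi> has_derivative blinfun_apply (D z)) (at z) \<and> inj (blinfun_apply (D z)))"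
    using assms unfolding square_chart_def by blast
  obtain D :: "real \<times> real \<Rightarrow> ((real \<times> real) \<Rightarrow>\<^sub>L (real^3))" where
    contD: "continuous_on U D" and
    D: "\<And>z. z \<in> U \<Longrightarrow> (\<psi> has_derivative blinfun_apply (D z)) (at z)" "\<And>z. z \<in> U \<Longrightarrow> inj (blinfun_apply (D z))"
    using ex by blast
  let ?e1 = "(1, 0) :: real \<times> real" and ?e2 = "(0, 1) :: real \<times> real"
  let ?k = "\<lambda>z. frame_orientation (\<psi> z) (D z ?e1) (D z ?e2)"
  have sph: "\<psi> z \<bullet> \<psi> z = 1" if "z \<in> U" for z using that U(3) inner_self_sphere by blast
  have orth: "\<psi> z \<bullet> D z u = 0" if "z \<in> U" for z u
  proof -
    have lin: "((\<lambda>s. z + s *\<^sub>R u) has_derivative (\<lambda>s. s *\<^sub>R u)) (at 0)"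
      by (auto intro!: derivative_eq_intros)
    have "(\<psi> has_derivative blinfun_apply (D z)) (at (z + 0 *\<^sub>R u))" using D(1)[OF that] by simp
    then have "((\<lambda>s. \<psi> (z + s *\<^sub>R u)) has_derivative (\<lambda>s. D z (s *\<^sub>R u))) (at 0)"
      by (rule has_derivative_compose[OF lin])
    then have d: "((\<lambda>s. \<psi> (z + s *\<^sub>R u)) has_vector_derivative D z u) (at 0)"
      by (simp add: has_vector_derivative_def blinfun.scaleR_right)
    have "open ((\<lambda>s::real. z + s *\<^sub>R u) -` U)"
      using \<open>open U\<close> by (rule continuous_open_vimage) (intro continuous_intros)
    from tangent_orthogonal[OF d this] show ?thesis using that sph by simp
  qed
  have nz: "?k z \<noteq> 0" if z: "z \<in> U" for z
  proof (rule frame_orientation_nonzero)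
    have inj: "D z u = D z v \<longleftrightarrow> u = v" for u v using D(2)[OF z] by (simp add: inj_eq)
    show "\<not> collinear {0, D z ?e1, D z ?e2}"
    proof
      assume "collinear {0, D z ?e1, D z ?e2}"
      moreover have "D z ?e1 \<noteq> 0" "D z ?e2 \<noteq> 0" using inj[of ?e1 0] inj[of ?e2 0] by (simp_all add: prod_eq_iff)
      ultimately obtain c where "D z ?e2 = c *\<^sub>R D z ?e1" by (auto simp: collinear_lemma)
      then have "D z ?e2 = D z (c *\<^sub>R ?e1)" by (simp only: blinfun.scaleR_right)
      then have "?e2 = c *\<^sub>R ?e1" by (simp only: inj)
      then show False by simp
    qed
  qed (use z sph orth in auto)
  have cont: "continuous_on model_square ?k"
    unfolding frame_orientation_def
  proof (intro continuous_on_inner continuous_on_cross)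
    have "continuous_on U \<psi>"
      using D(1) has_derivative_continuous continuous_at_imp_continuous_on by blast
    then show "continuous_on model_square \<psi>" using U(2) continuous_on_subset by blast
    have "continuous_on model_square D" using contD U(2) continuous_on_subset by blast
    then show "continuous_on model_square (\<lambda>z. D z ?e1)" "continuous_on model_square (\<lambda>z. D z ?e2)"
      by (intro continuous_intros; assumption)+
  qed
  have conn: "connected model_square"
    by (intro convex_connected convex_Times convex_real_interval)
  have z0: "(0, 0) \<in> model_square" by auto
  have cs: "chart_sign \<psi> = sgn (?k (0, 0))"
    unfolding chart_sign_def frechet_derivative_at[OF D(1), OF subsetD[OF U(2) z0], symmetric] ..
  have same: "sgn (?k z) = chart_sign \<psi>" if z: "z \<in> model_square" for z
  proof -
    have "0 < ?k z \<longleftrightarrow> 0 < ?k (0, 0)"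
      using cont conn by (rule nonzero_same_sign) (use U(2) nz z z0 in auto)
    moreover have "?k z \<noteq> 0" "?k (0, 0) \<noteq> 0" using nz U(2) z z0 by blast+
    ultimately show ?thesis unfolding cs by (simp add: sgn_if)
  qed
  show "chart_sign \<psi> \<in> {-1, 1}"
    using nz[OF subsetD[OF U(2) z0]] unfolding cs by (simp add: sgn_if)
  show "\<exists>L. (\<psi> has_derivative L) (at z) \<and>
      (\<forall>u v. sgn (frame_orientation (\<psi> z) (L u) (L v)) = chart_sign \<psi> * sgn (plane_cross u v))"
    if z: "z \<in> model_square"
  proof (intro exI conjI allI)
    show "(\<psi> has_derivative blinfun_apply (D z)) (at z)" using D(1) U(2) z by blast
    fix u v
    have "linear (blinfun_apply (D z))" by (simp add: blinfun.bounded_linear_right bounded_linear.linear)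
    then show "sgn (frame_orientation (\<psi> z) (D z u) (D z v)) = chart_sign \<psi> * sgn (plane_cross u v)"
      using same[OF z] by (simp add: frame_orientation_linear[of "blinfun_apply (D z)" _ u v] sgn_mult)
  qed
qed

text \<open>One curve and one disk: the curve runs through the model arcs during the given intervals
  and avoids the disk otherwise. The curves before and after a deformation are two instances sharing
  \<open>\<psi>\<close>, \<open>\<sigma>\<close>, \<open>l\<close> and \<open>r\<close>.\<close>

locale arcs = curve h for h +
  fixes \<psi> :: "real \<times> real \<Rightarrow> real^3" and n :: nat and \<gamma> \<gamma>' :: "nat \<Rightarrow> real \<Rightarrow> real \<times> real"
    and \<sigma> l r :: "nat \<Rightarrow> real"
  assumes chart: "square_chart \<psi>"
    and sigma: "i < n \<Longrightarrow> \<sigma> i \<in> {-1, 1}"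
    and interval: "i < n \<Longrightarrow> 0 < l i \<and> l i < r i \<and> r i < 1"
    and disjoint: "i < n \<Longrightarrow> j < n \<Longrightarrow> i \<noteq> j \<Longrightarrow> {l i..r i} \<inter> {l j..r j} = {}"
    and in_square: "i < n \<Longrightarrow> s \<in> {-1..1} \<Longrightarrow> \<gamma> i s \<in> model_square"
    and model_derivative: "i < n \<Longrightarrow> s \<in> {-1<..<1} \<Longrightarrow> (\<gamma> i has_vector_derivative \<gamma>' i s) (at s)"
    and arc: "i < n \<Longrightarrow> t \<in> {l i..r i} \<Longrightarrow>
      h t = \<psi> (\<gamma> i (\<sigma> i * ((2 * t - l i - r i) / (r i - l i))))"
    and outside: "t \<in> {0..1} \<Longrightarrow> t \<notin> (\<Union>i<n. {l i..r i}) \<Longrightarrow> h t \<notin> \<psi> ` model_square"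
begin

text \<open>\<open>time i\<close> and \<open>position i\<close> are mutually inverse affine maps
  between the parameter of the model arc and the parameter of the curve.\<close>

definition time :: "nat \<Rightarrow> real \<Rightarrow> real" where
  "time i s = (l i + r i + \<sigma> i * s * (r i - l i)) / 2"

definition position :: "nat \<Rightarrow> real \<Rightarrow> real" where
  "position i t = \<sigma> i * ((2 * t - l i - r i) / (r i - l i))"

lemma position_time: "i < n \<Longrightarrow> position i (time i s) = s"
  using sigma[of i] interval[of i] by (auto simp: time_def position_def field_simps)

lemma time_position: "i < n \<Longrightarrow> time i (position i t) = t"
  using sigma[of i] interval[of i] by (auto simp: time_def position_def field_simps)

lemma abs_position: "i < n \<Longrightarrow> \<bar>position i t\<bar> = \<bar>2 * t - l i - r i\<bar> / (r i - l i)"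
  using sigma[of i] interval[of i] by (auto simp: position_def abs_mult abs_divide)

lemma position_in: "i < n \<Longrightarrow> t \<in> {l i..r i} \<longleftrightarrow> position i t \<in> {-1..1}"
proof -
  assume i: "i < n"
  have "\<bar>position i t\<bar> \<le> 1 \<longleftrightarrow> \<bar>2 * t - l i - r i\<bar> \<le> r i - l i"
    using interval[OF i] by (simp add: abs_position[OF i] divide_le_eq)
  then show ?thesis using interval[OF i] by (auto simp: abs_le_iff)
qed

lemma position_in_open: "i < n \<Longrightarrow> t \<in> {l i<..<r i} \<longleftrightarrow> position i t \<in> {-1<..<1}"
proof -
  assume i: "i < n"
  have "\<bar>position i t\<bar> < 1 \<longleftrightarrow> \<bar>2 * t - l i - r i\<bar> < r i - l i"
    using interval[OF i] by (simp add: abs_position[OF i] divide_less_eq)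
  then show ?thesis using interval[OF i] by (auto simp: abs_less_iff)
qed

lemma time_in: "i < n \<Longrightarrow> s \<in> {-1..1} \<Longrightarrow> time i s \<in> {l i..r i}"
  using position_in[of i "time i s"] by (simp add: position_time)

lemma time_in_unit: "i < n \<Longrightarrow> s \<in> {-1..1} \<Longrightarrow> time i s \<in> {0..<1}"
  using time_in[of i s] interval[of i] by auto

lemma arc_time: "i < n \<Longrightarrow> s \<in> {-1..1} \<Longrightarrow> h (time i s) = \<psi> (\<gamma> i s)"
  using arc[of i "time i s"] time_in[of i s] position_time[of i s] by (simp add: position_def)

lemma time_less:
  "i < n \<Longrightarrow> time i s < time i s' \<longleftrightarrow> (if \<sigma> i = 1 then s < s' else s' < s)"
  using sigma[of i] interval[of i] by (auto simp: time_def)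

lemma time_eq_iff:
  assumes "i < n" "j < n" "s \<in> {-1..1}" "s' \<in> {-1..1}"
  shows "time i s = time j s' \<longleftrightarrow> i = j \<and> s = s'"
  using assms disjoint[of i j] time_in[of i s] time_in[of j s'] position_time[of i]
  by (metis IntI empty_iff)

lemma arc_eq_iff:
  assumes "i < n" "j < n" "s \<in> {-1..1}" "s' \<in> {-1..1}"
  shows "h (time i s) = h (time j s') \<longleftrightarrow> \<gamma> i s = \<gamma> j s'"
  using assms square_chart_inj[OF chart] in_square[of i s] in_square[of j s']
  by (simp add: arc_time inj_on_eq_iff)

text \<open>The partner may lie on the same arc, as for the loop of RI; only the very same parameter
  is excluded.\<close>

definition crossings :: "nat \<Rightarrow> real set" where
  "crossings i = {s \<in> {-1..1}. \<exists>j<n. \<exists>s'\<in>{-1..1}. (j, s') \<noteq> (i, s) \<and> \<gamma> j s' = \<gamma> i s}"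

lemma inside_iff:
  assumes "t \<in> {0..1}"
  shows "h t \<in> \<psi> ` model_square \<longleftrightarrow> t \<in> (\<Union>i<n. {l i..r i})"
proof
  assume "t \<in> (\<Union>i<n. {l i..r i})"
  then obtain i where "i < n" "t \<in> {l i..r i}" by blast
  then show "h t \<in> \<psi> ` model_square"
    using arc[of i t] in_square[of i "position i t"] position_in[of i t] by (simp add: position_def)
qed (use outside assms in blast)

text \<open>By \<open>inside_iff\<close> both passages through a point of the disk take place during
  the intervals, and the chart is injective, so double points there are those of the model.\<close>

lemma double_points_arc:
  assumes "i < n"
  shows "double_points h \<inter> {l i..r i} = time i ` crossings i"
proof (intro equalityI subsetI)
  fix t assume t: "t \<in> double_points h \<inter> {l i..r i}"
  then obtain s where s: "t \<in> {0..<1}" "s \<in> {0..<1}" "s \<noteq> t" "h s = h t"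
    by (blast elim: double_pointE)
  have "h t \<in> \<psi> ` model_square" using inside_iff[of t] s(1) t assms by auto
  then obtain j where j: "j < n" "s \<in> {l j..r j}" using inside_iff[of s] s by auto
  have p: "position i t \<in> {-1..1}" "position j s \<in> {-1..1}"
    using position_in assms j t by blast+
  have "\<gamma> j (position j s) = \<gamma> i (position i t)"
    using arc_eq_iff[OF j(1) assms p(2,1)] s(4) time_position assms j by simp
  moreover have "(j, position j s) \<noteq> (i, position i t)"
    using time_position assms j(1) s(3) by (metis prod.inject)
  ultimately have "position i t \<in> crossings i" unfolding crossings_def using p j(1) by blast
  then show "t \<in> time i ` crossings i" using time_position[OF assms] by (metis imageI)
next
  fix t assume "t \<in> time i ` crossings i"
  then obtain s j s' where *: "t = time i s" "s \<in> {-1..1}" "j < n" "s' \<in> {-1..1}"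
    "(j, s') \<noteq> (i, s)" "\<gamma> j s' = \<gamma> i s" by (auto simp: crossings_def)
  have "time i s \<noteq> time j s'" "h (time i s) = h (time j s')"
    using time_eq_iff[of i j s s'] arc_eq_iff[of i j s s'] assms * by auto
  then have "t \<in> double_points h"
    using double_pointI[OF time_in_unit time_in_unit] assms * by metis
  then show "t \<in> double_points h \<inter> {l i..r i}" using time_in assms * by blast
qed

lemma velocity_time:
  assumes "i < n" "s \<in> {-1<..<1}" "(\<psi> has_derivative L) (at (\<gamma> i s))"
  shows "velocity h (time i s) = (2 * \<sigma> i / (r i - l i)) *\<^sub>R L (\<gamma>' i s)"
proof -
  let ?c = "2 * \<sigma> i / (r i - l i)"
  interpret L: bounded_linear L using assms(3) by (rule has_derivative_bounded_linear)
  have "(position i has_vector_derivative ?c) (at (time i s))"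
  proof -
    have "position i = (\<lambda>t. ?c * t - \<sigma> i * ((l i + r i) / (r i - l i)))"
      by (simp add: position_def fun_eq_iff diff_divide_distrib add_divide_distrib algebra_simps)
    then show ?thesis using interval[OF assms(1)]
      by (auto intro!: derivative_eq_intros
          simp flip: has_real_derivative_iff_has_vector_derivative)
  qed
  moreover have "(\<gamma> i has_vector_derivative \<gamma>' i s) (at (position i (time i s)))"
    using model_derivative assms(1,2) by (simp add: position_time)
  ultimately have "((\<gamma> i \<circ> position i) has_vector_derivative ?c *\<^sub>R \<gamma>' i s) (at (time i s))"
    by (rule vector_diff_chain_at)
  then have "((\<lambda>t. \<psi> ((\<gamma> i \<circ> position i) t)) has_derivative (\<lambda>x. L (x *\<^sub>R (?c *\<^sub>R \<gamma>' i s))))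
      (at (time i s))"
    unfolding has_vector_derivative_def
    by (rule has_derivative_compose) (simp add: position_time assms)
  then have "((\<lambda>t. \<psi> (\<gamma> i (position i t))) has_vector_derivative ?c *\<^sub>R L (\<gamma>' i s)) (at (time i s))"
    by (simp add: has_vector_derivative_def L.scaleR)
  then have "(h has_vector_derivative ?c *\<^sub>R L (\<gamma>' i s)) (at (time i s))"
  proof (rule has_vector_derivative_transform_within_open)
    show "time i s \<in> {l i<..<r i}"
      using position_in_open[OF assms(1)] position_time assms(1,2) by simp
    show "\<psi> (\<gamma> i (position i t)) = h t" if "t \<in> {l i<..<r i}" for t
      using arc[OF assms(1), of t] that by (simp add: position_def)
  qed simp
  then show ?thesis by (rule vector_derivative_at)
qed

text \<open>The durations of the intervals enter as positive factors and drop out. What remains is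
  the sign of the chart, of the two directions and of the determinant of the model tangents.\<close>

lemma over_branch_time:
  assumes "i < n" "j < n" "s \<in> {-1<..<1}" "s' \<in> {-1<..<1}" "(j, s') \<noteq> (i, s)" "\<gamma> j s' = \<gamma> i s"
  shows "over_branch h (time i s) \<longleftrightarrow>
    0 < chart_sign \<psi> * \<sigma> i * \<sigma> j * plane_cross (\<gamma>' i s) (\<gamma>' j s')"
proof -
  have s: "s \<in> {-1..1}" "s' \<in> {-1..1}" using assms by auto
  obtain L where L: "(\<psi> has_derivative L) (at (\<gamma> i s))"
    and sgn: "\<And>u v. sgn (frame_orientation (\<psi> (\<gamma> i s)) (L u) (L v)) = chart_sign \<psi> * sgn (plane_cross u v)"
    using square_chart_frame(2)[OF chart in_square[OF assms(1) s(1)]] by blast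
  let ?F = "frame_orientation (\<psi> (\<gamma> i s)) (L (\<gamma>' i s)) (L (\<gamma>' j s'))"
  have c: "0 < 2 / (r i - l i)" "0 < 2 / (r j - l j)" using interval assms by auto
  have "time i s \<noteq> time j s'" "h (time i s) = h (time j s')"
    using time_eq_iff[of i j s s'] arc_eq_iff[of i j s s'] assms s by auto
  then have "over_branch h (time i s) \<longleftrightarrow>
      0 < frame_orientation (h (time i s)) (velocity h (time i s)) (velocity h (time j s'))"
    using assms s by (intro over_branch_iff time_in_unit) auto
  also have "frame_orientation (h (time i s)) (velocity h (time i s)) (velocity h (time j s'))
      = (2 / (r i - l i)) * (2 / (r j - l j)) * (\<sigma> i * \<sigma> j * ?F)"
    using velocity_time[of i s L] velocity_time[of j s' L] L assms s
    by (simp add: arc_time mult.commute[of "r j - l j"] mult.left_commute)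
  also have "0 < \<dots> \<longleftrightarrow> 0 < \<sigma> i * \<sigma> j * ?F"
    using c by (simp only: zero_less_mult_iff) (auto simp: mult_less_0_iff zero_less_mult_iff)
  also have "\<dots> \<longleftrightarrow> 0 < sgn (\<sigma> i * \<sigma> j * ?F)" by simp
  also have "sgn (\<sigma> i * \<sigma> j * ?F) = sgn (chart_sign \<psi> * \<sigma> i * \<sigma> j * plane_cross (\<gamma>' i s) (\<gamma>' j s'))"
    using sigma[of i] sigma[of j] assms(1,2) square_chart_frame(1)[OF chart]
    by (auto simp: sgn_mult sgn)
  finally show ?thesis by simp
qed

end

text \<open>A point outside the disk is passed both times outside the intervals, and near these
  times the two curves agree.\<close>

lemma outside_double_points:
  assumes g: "arcs g \<psi> n \<gamma> \<gamma>' \<sigma> l r" and h: "arcs h \<psi> n \<delta> \<delta>' \<sigma> l r"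
    and eq: "\<And>t. t \<in> {0..1} - (\<Union>i<n. {l i..r i}) \<Longrightarrow> h t = g t"
    and t: "t \<in> double_points g - (\<Union>i<n. {l i..r i})"
  shows "t \<in> double_points h" and "over_branch h t = over_branch g t"
proof -
  interpret g: arcs g \<psi> n \<gamma> \<gamma>' \<sigma> l r by fact
  interpret h: arcs h \<psi> n \<delta> \<delta>' \<sigma> l r by fact
  let ?J = "\<Union>i<n. {l i..r i}"
  obtain s where s: "t \<in> {0..<1}" "s \<in> {0..<1}" "s \<noteq> t" "g s = g t"
    using t by (blast elim: double_pointE)
  have out: "s \<notin> ?J" "t \<notin> ?J" using g.inside_iff[of s] g.inside_iff[of t] s t by auto
  then have h_eq: "h s = g s" "h t = g t" using eq s by auto
  then show "t \<in> double_points h" using double_pointI[of t s h] s by auto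
  have vel: "velocity h u = velocity g u" if u: "u \<in> {0..<1}" "u \<notin> ?J" for u
  proof -
    have "closed ?J" by (intro closed_UN) auto
    then have "open (- ?J)" by (rule open_Compl)
    obtain e where e: "0 < e" "ball u e \<subseteq> - ?J"
      using \<open>open (- ?J)\<close> u(2) by (metis ComplI openE)
    \<comment> \<open>The curves are compared on \<open>{0..1}\<close> only, a one-sided
      neighbourhood of the base point 0; the derivative within this interval still determines the
      velocity.\<close>
    have "(h has_vector_derivative velocity g u) (at u within {0..1})"
    proof (rule has_vector_derivative_transform_within)
      show "(g has_vector_derivative velocity g u) (at u within {0..1})"
        using g.has_velocity by (rule has_vector_derivative_at_within)
      show "0 < e" by fact
      show "g v = h v" if "v \<in> {0..1}" "dist v u < e" for v
        using that e(2) eq[of v] by (auto simp: dist_commute subset_iff)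
    qed (use u in auto)
    moreover have "(h has_vector_derivative velocity h u) (at u within {0..1})"
      using h.has_velocity by (rule has_vector_derivative_at_within)
    ultimately show ?thesis
      using vector_derivative_unique_within_closed_interval[of 0 1 u h] u by simp
  qed
  show "over_branch h t = over_branch g t"
    using g.over_branch_iff[of s t] h.over_branch_iff[of s t] vel s out h_eq by simp
qed

section \<open>Comparing the words before and after a change\<close>

lemma sorted_list_of_set_three_parts:
  fixes E P1 P2 P3 :: "real set"
  assumes fin: "finite E" "finite P1" "finite P2" "finite P3"
    and P: "P1 \<subseteq> {a1..b1}" "P2 \<subseteq> {a2..b2}" "P3 \<subseteq> {a3..b3}"
    and E: "E \<inter> {a1..b1} = {}" "E \<inter> {a2..b2} = {}" "E \<inter> {a3..b3} = {}"
    and ab: "a1 \<le> b1" "b1 < a2" "a2 \<le> b2" "b2 < a3" "a3 \<le> b3"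
  shows "sorted_list_of_set (E \<union> P1 \<union> P2 \<union> P3) =
    sorted_list_of_set (E \<inter> {..<a1}) @ sorted_list_of_set P1 @
    sorted_list_of_set (E \<inter> {b1<..<a2}) @ sorted_list_of_set P2 @
    sorted_list_of_set (E \<inter> {b2<..<a3}) @ sorted_list_of_set P3 @
    sorted_list_of_set (E \<inter> {b3<..})"
proof -
  have "E \<subseteq> {..<a1} \<union> {b1<..<a2} \<union> {b2<..<a3} \<union> {b3<..}"
    using E ab by fastforce
  then have "E \<union> P1 \<union> P2 \<union> P3 = E \<inter> {..<a1} \<union> (P1 \<union> (E \<inter> {b1<..<a2} \<union> (P2 \<union>
      (E \<inter> {b2<..<a3} \<union> (P3 \<union> E \<inter> {b3<..})))))"
    by blast
  moreover have "sorted_list_of_set (P3 \<union> E \<inter> {b3<..})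
      = sorted_list_of_set P3 @ sorted_list_of_set (E \<inter> {b3<..})"
    using fin P ab by (intro sorted_list_of_set_Un) auto
  moreover have "sorted_list_of_set (E \<inter> {b2<..<a3} \<union> (P3 \<union> E \<inter> {b3<..}))
      = sorted_list_of_set (E \<inter> {b2<..<a3}) @ sorted_list_of_set (P3 \<union> E \<inter> {b3<..})"
    using fin P ab by (intro sorted_list_of_set_Un) force+
  moreover have "sorted_list_of_set (P2 \<union> (E \<inter> {b2<..<a3} \<union> (P3 \<union> E \<inter> {b3<..})))
      = sorted_list_of_set P2 @ sorted_list_of_set (E \<inter> {b2<..<a3} \<union> (P3 \<union> E \<inter> {b3<..}))"
    using fin P ab by (intro sorted_list_of_set_Un) force+
  moreover have "sorted_list_of_set (E \<inter> {b1<..<a2} \<union> (P2 \<union> (E \<inter> {b2<..<a3} \<union> (P3 \<union> E \<inter> {b3<..}))))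
      = sorted_list_of_set (E \<inter> {b1<..<a2}) @
        sorted_list_of_set (P2 \<union> (E \<inter> {b2<..<a3} \<union> (P3 \<union> E \<inter> {b3<..})))"
    using fin P ab by (intro sorted_list_of_set_Un) force+
  moreover have "sorted_list_of_set (P1 \<union> (E \<inter> {b1<..<a2} \<union> (P2 \<union> (E \<inter> {b2<..<a3} \<union> (P3 \<union> E \<inter> {b3<..})))))
      = sorted_list_of_set P1 @
        sorted_list_of_set (E \<inter> {b1<..<a2} \<union> (P2 \<union> (E \<inter> {b2<..<a3} \<union> (P3 \<union> E \<inter> {b3<..}))))"
    using fin P ab by (intro sorted_list_of_set_Un) force+
  moreover have "sorted_list_of_set (E \<inter> {..<a1} \<union> (P1 \<union> (E \<inter> {b1<..<a2} \<union> (P2 \<union> (E \<inter> {b2<..<a3} \<union> (P3 \<union> E \<inter> {b3<..}))))))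
      = sorted_list_of_set (E \<inter> {..<a1}) @
        sorted_list_of_set (P1 \<union> (E \<inter> {b1<..<a2} \<union> (P2 \<union> (E \<inter> {b2<..<a3} \<union> (P3 \<union> E \<inter> {b3<..})))))"
    using fin P ab by (intro sorted_list_of_set_Un) force+
  ultimately show ?thesis by simp
qed

definition curve_part :: "(real \<Rightarrow> real^3) \<Rightarrow> (real^3 \<Rightarrow> nat) \<Rightarrow> real set \<Rightarrow> gword" where
  "curve_part g N X = map (\<lambda>t. endpoint_of (over_branch g t) (N (g t))) (sorted_list_of_set X)"

lemma letters_curve_part: "finite X \<Longrightarrow> letters (curve_part g N X) = (\<lambda>t. N (g t)) ` X"
  by (simp add: curve_part_def letters_def image_image)

text \<open>The times in \<open>E\<close> carry the same letters and the same over-branches for both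
  curves, so the two words share the gaps and differ only in three blocks.\<close>

lemma curve_combination_exchange:
  assumes g: "spherical_curve g" and h: "spherical_curve h"
    and Dg: "double_points g = E \<union> P1 \<union> P2 \<union> P3" and Dh: "double_points h = E \<union> Q1 \<union> Q2 \<union> Q3"
    and P: "P1 \<subseteq> {a1..b1}" "P2 \<subseteq> {a2..b2}" "P3 \<subseteq> {a3..b3}"
    and Q: "Q1 \<subseteq> {a1..b1}" "Q2 \<subseteq> {a2..b2}" "Q3 \<subseteq> {a3..b3}"
    and E: "E \<inter> {a1..b1} = {}" "E \<inter> {a2..b2} = {}" "E \<inter> {a3..b3} = {}"
    and ab: "a1 \<le> b1" "b1 < a2" "a2 \<le> b2" "b2 < a3" "a3 \<le> b3"
    and over: "\<And>t. t \<in> E \<Longrightarrow> over_branch h t = over_branch g t"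
    and N: "inj_on N (g ` double_points g)" "\<And>p. 0 < N p"
    and M: "inj_on M (h ` double_points h)" "\<And>p. 0 < M p"
    and NM: "\<And>t. t \<in> E \<Longrightarrow> M (h t) = N (g t)" "\<And>t. t \<in> E \<Longrightarrow> 3 < N (g t)"
    and NP: "\<And>t. t \<in> P1 \<union> P2 \<union> P3 \<Longrightarrow> N (g t) \<le> 3"
    and MQ: "\<And>t. t \<in> Q1 \<union> Q2 \<union> Q3 \<Longrightarrow> M (h t) \<le> 3"
    and ex: "exchangeable (\<lambda>X. weight x \<alpha> I (frag_of X))
      (curve_part g N P1) (curve_part g N P2) (curve_part g N P3)
      (curve_part h M Q1) (curve_part h M Q2) (curve_part h M Q3)"
  shows "curve_combination x \<alpha> I g = curve_combination x \<alpha> I h"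
proof -
  interpret g: curve g using g by unfold_locales
  interpret h: curve h using h by unfold_locales
  have fin: "finite E" "finite P1" "finite P2" "finite P3" "finite Q1" "finite Q2" "finite Q3"
    using g.finite_double_points h.finite_double_points Dg Dh by auto
  define V T U W where VTUW: "V = curve_part g N (E \<inter> {..<a1})" "T = curve_part g N (E \<inter> {b1<..<a2})"
    "U = curve_part g N (E \<inter> {b2<..<a3})" "W = curve_part g N (E \<inter> {b3<..})"
  have E_part: "curve_part h M (E \<inter> X) = curve_part g N (E \<inter> X)" for X
    unfolding curve_part_def using fin(1) over NM(1) by (intro map_cong) auto
  have wg: "g.labelled_word N = V @ curve_part g N P1 @ T @ curve_part g N P2 @ U @ curve_part g N P3 @ W"
    unfolding g.labelled_word_def Dg VTUW
    using fin P E ab by (simp add: sorted_list_of_set_three_parts curve_part_def)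
  have "h.labelled_word M = curve_part h M (E \<inter> {..<a1}) @ curve_part h M Q1 @
      curve_part h M (E \<inter> {b1<..<a2}) @ curve_part h M Q2 @ curve_part h M (E \<inter> {b2<..<a3}) @
      curve_part h M Q3 @ curve_part h M (E \<inter> {b3<..})"
    unfolding h.labelled_word_def Dh
    using fin Q E ab by (simp add: sorted_list_of_set_three_parts curve_part_def)
  then have wh: "h.labelled_word M = V @ curve_part h M Q1 @ T @ curve_part h M Q2 @ U @ curve_part h M Q3 @ W"
    unfolding VTUW E_part .
  have gauss_g: "oriented_gauss_word (g.labelled_word N)"
    using N by (intro g.oriented_gauss_word_labelled_word) auto
  have gauss_h: "oriented_gauss_word (h.labelled_word M)"
    using M by (intro h.oriented_gauss_word_labelled_word) auto
  have out: "letters (V @ T @ U @ W) \<subseteq> {3<..}"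
    unfolding VTUW using fin(1) NM(2) by (auto simp: letters_curve_part)
  have in_g: "letters (curve_part g N P1 @ curve_part g N P2 @ curve_part g N P3) \<subseteq> {..3}"
    using fin NP by (auto simp: letters_curve_part)
  have in_h: "letters (curve_part h M Q1 @ curve_part h M Q2 @ curve_part h M Q3) \<subseteq> {..3}"
    using fin MQ by (auto simp: letters_curve_part)
  have keep: "sub_word w {3<..} = w" if "letters w \<subseteq> {3<..}" for w
    using that by (auto simp: sub_word_def letters_def filter_id_conv)
  have drop: "sub_word w {3<..} = []" if "letters w \<subseteq> {..3}" for w
    using that by (force simp: sub_word_def letters_def filter_empty_conv)
  \<comment> \<open>Letters above 3 lie in the gaps and the others in the blocks, so the gaps alone
    are a sub-word of a Gauss word.\<close>
  have "sub_word (g.labelled_word N) {3<..} = V @ T @ U @ W"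
    unfolding wg using out in_g by (simp add: keep drop)
  then have "oriented_gauss_word (V @ T @ U @ W)"
    using oriented_gauss_word_sub_word[OF gauss_g] by metis
  then have "word_sum (\<lambda>X. weight x \<alpha> I (frag_of X)) (g.labelled_word N)
      = word_sum (\<lambda>X. weight x \<alpha> I (frag_of X)) (h.labelled_word M)"
    unfolding wg wh using out in_g in_h
    by (intro word_sum_exchange[OF ex]) fastforce+
  then show ?thesis
    using curve_combination_word_sum[OF g.curve_diagram_labelled_word[OF N(1)] gauss_g]
      curve_combination_word_sum[OF h.curve_diagram_labelled_word[OF M(1)] gauss_h] by simp
qed

text \<open>With fewer than three crossings the points are repeated and the first match counts: RI
  uses only the letter 1, RII the letters 1 and 2.\<close>

definition relabel :: "('a \<Rightarrow> nat) \<Rightarrow> 'a \<Rightarrow> 'a \<Rightarrow> 'a \<Rightarrow> 'a \<Rightarrow> nat" where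
  "relabel N p1 p2 p3 p = (if p = p1 then 1 else if p = p2 then 2 else if p = p3 then 3 else N p)"

lemma inj_on_relabel:
  assumes "inj_on N X" "\<And>p. 3 < N p"
  shows "inj_on (relabel N p1 p2 p3) (X \<union> {p1, p2, p3})"
proof (rule inj_onI)
  fix p q assume p: "p \<in> X \<union> {p1, p2, p3}" and q: "q \<in> X \<union> {p1, p2, p3}"
    and eq: "relabel N p1 p2 p3 p = relabel N p1 p2 p3 q"
  have small: "relabel N p1 p2 p3 u \<le> 3" if "u \<in> {p1, p2, p3}" for u
    using that by (auto simp: relabel_def)
  have big: "relabel N p1 p2 p3 u = N u" if "u \<notin> {p1, p2, p3}" for u
    using that by (simp add: relabel_def)
  consider "p \<in> {p1, p2, p3}" "q \<in> {p1, p2, p3}" | "p \<in> X" "p \<notin> {p1, p2, p3}" "q \<in> X" "q \<notin> {p1, p2, p3}"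
    | "p \<in> {p1, p2, p3}" "q \<notin> {p1, p2, p3}" | "p \<notin> {p1, p2, p3}" "q \<in> {p1, p2, p3}"
    using p q by blast
  then show "p = q"
  proof cases
    case 1
    then show ?thesis using eq by (auto simp: relabel_def split: if_splits)
  next
    case 2
    then show ?thesis using eq assms(1) by (simp add: big inj_on_eq_iff)
  next
    case 3
    then show ?thesis using eq small[of p] big[of q] assms(2)[of q] by simp
  next
    case 4
    then show ?thesis using eq small[of q] big[of p] assms(2)[of p] by simp
  qed
qed

locale arcs_change = g: arcs g \<psi> n \<gamma> \<gamma>' \<sigma> l r + h: arcs h \<psi> n \<delta> \<delta>' \<sigma> l r
  for g h \<psi> n \<gamma> \<gamma>' \<delta> \<delta>' \<sigma> l r +
  assumes outside_eq: "t \<in> {0..1} - (\<Union>i<n. {l i..r i}) \<Longrightarrow> h t = g t"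
begin

definition outer :: "real set" where
  "outer = double_points g - (\<Union>i<n. {l i..r i})"

lemma outer_eq: "outer = double_points h - (\<Union>i<n. {l i..r i})"
proof -
  have "g t = h t" if "t \<in> {0..1} - (\<Union>i<n. {l i..r i})" for t using outside_eq[OF that] by simp
  then show ?thesis
    unfolding outer_def
    using outside_double_points(1)[OF g.arcs_axioms h.arcs_axioms outside_eq]
      outside_double_points(1)[OF h.arcs_axioms g.arcs_axioms] by blast
qed

text \<open>The indices \<open>i1 i2 i3\<close> list the arcs in the order of their passage. With fewer than three arcs,
  indices from \<open>n\<close> on stand for empty intervals beyond the unit interval.\<close>

lemma curve_combination_arcs:
  assumes i: "{..<n} \<subseteq> {i1, i2, i3}"
    and ivl: "\<And>i. i \<in> {i1, i2, i3} \<Longrightarrow> lo i \<le> up i \<and> (if i < n then lo i = l i \<and> up i = r i else 1 < lo i)"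
    and ord: "up i1 < lo i2" "up i2 < lo i3"
    and P: "\<And>i. i < n \<Longrightarrow> double_points g \<inter> {l i..r i} = P i" "\<And>i. n \<le> i \<Longrightarrow> P i = {}"
    and Q: "\<And>i. i < n \<Longrightarrow> double_points h \<inter> {l i..r i} = Q i" "\<And>i. n \<le> i \<Longrightarrow> Q i = {}"
    and N: "inj_on N (g ` double_points g)" "\<And>p. 3 < N p"
    and p: "p1 \<in> \<psi> ` model_square" "p2 \<in> \<psi> ` model_square" "p3 \<in> \<psi> ` model_square"
    and gp: "\<And>i t. i < n \<Longrightarrow> t \<in> P i \<Longrightarrow> g t \<in> {p1, p2, p3}"
    and q: "q1 \<in> \<psi> ` model_square" "q2 \<in> \<psi> ` model_square" "q3 \<in> \<psi> ` model_square"
    and hq: "\<And>i t. i < n \<Longrightarrow> t \<in> Q i \<Longrightarrow> h t \<in> {q1, q2, q3}"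
    and ex: "exchangeable (\<lambda>X. weight x \<alpha> I (frag_of X))
      (curve_part g (relabel N p1 p2 p3) (P i1)) (curve_part g (relabel N p1 p2 p3) (P i2))
      (curve_part g (relabel N p1 p2 p3) (P i3))
      (curve_part h (relabel N q1 q2 q3) (Q i1)) (curve_part h (relabel N q1 q2 q3) (Q i2))
      (curve_part h (relabel N q1 q2 q3) (Q i3))"
  shows "curve_combination x \<alpha> I g = curve_combination x \<alpha> I h"
proof -
  have UN: "(\<Union>i<n. A i) = A i1 \<union> A i2 \<union> A i3" if "\<And>i. n \<le> i \<Longrightarrow> A i = {}" for A :: "nat \<Rightarrow> real set"
  proof -
    have 1: "A j \<subseteq> (\<Union>i<n. A i)" for j
    proof (cases "j < n")
      case True
      then show ?thesis by (intro UN_upper) simp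
    next
      case False
      then show ?thesis using that[of j] by simp
    qed
    have 2: "A j \<subseteq> A i1 \<union> A i2 \<union> A i3" if "j < n" for j
    proof -
      have "j = i1 \<or> j = i2 \<or> j = i3" using subsetD[OF i, of j] \<open>j < n\<close> by simp
      then show ?thesis by blast
    qed
    show ?thesis
    proof
      show "(\<Union>i<n. A i) \<subseteq> A i1 \<union> A i2 \<union> A i3" using 2 by (intro UN_least) simp
      show "A i1 \<union> A i2 \<union> A i3 \<subseteq> (\<Union>i<n. A i)" using 1 by (intro Un_least)
    qed
  qed
  have unit: "outer \<subseteq> {0..<1}" by (auto simp: outer_def double_points_def)
  have outer_ivl: "outer \<inter> {lo i..up i} = {}" if "i \<in> {i1, i2, i3}" for i
    using ivl[OF that] unit by (cases "i < n") (auto simp: outer_def)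
  have sub: "P i \<subseteq> {lo i..up i}" "Q i \<subseteq> {lo i..up i}" if "i \<in> {i1, i2, i3}" for i
  proof -
    have "P i \<subseteq> {lo i..up i} \<and> Q i \<subseteq> {lo i..up i}"
    proof (cases "i < n")
      case True
      then show ?thesis using ivl[OF that] by (simp flip: P(1) Q(1))
    next
      case False
      then show ?thesis using P(2)[of i] Q(2)[of i] by simp
    qed
    then show "P i \<subseteq> {lo i..up i}" "Q i \<subseteq> {lo i..up i}" by simp_all
  qed
  have outside_g: "g t \<notin> \<psi> ` model_square" "h t = g t" if "t \<in> outer" for t
  proof -
    have "t \<in> {0..1}" using subsetD[OF unit that] by simp
    moreover have "t \<notin> (\<Union>i<n. {l i..r i})" using that unfolding outer_def by blast
    ultimately show "g t \<notin> \<psi> ` model_square" "h t = g t" using g.outside outside_eq by blast+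
  qed
  have Dg: "double_points g = outer \<union> P i1 \<union> P i2 \<union> P i3"
  proof -
    have "double_points g = outer \<union> (\<Union>i<n. double_points g \<inter> {l i..r i})"
      by (auto simp: outer_def)
    also have "(\<Union>i<n. double_points g \<inter> {l i..r i}) = (\<Union>i<n. P i)" using P(1) by simp
    also have "\<dots> = P i1 \<union> P i2 \<union> P i3" using P(2) by (rule UN)
    finally show ?thesis by blast
  qed
  have Dh: "double_points h = outer \<union> Q i1 \<union> Q i2 \<union> Q i3"
  proof -
    have "double_points h = outer \<union> (\<Union>i<n. double_points h \<inter> {l i..r i})"
      unfolding outer_eq by auto
    also have "(\<Union>i<n. double_points h \<inter> {l i..r i}) = (\<Union>i<n. Q i)" using Q(1) by simp
    also have "\<dots> = Q i1 \<union> Q i2 \<union> Q i3" using Q(2) by (rule UN)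
    finally show ?thesis by blast
  qed
  have gP: "g t \<in> {p1, p2, p3}" if t: "t \<in> P i1 \<union> P i2 \<union> P i3" for t
  proof -
    obtain i where "t \<in> P i" using t by blast
    then show ?thesis using gp[of i t] P(2)[of i] by (cases "i < n") auto
  qed
  have hQ: "h t \<in> {q1, q2, q3}" if t: "t \<in> Q i1 \<union> Q i2 \<union> Q i3" for t
  proof -
    obtain i where "t \<in> Q i" using t by blast
    then show ?thesis using hq[of i t] Q(2)[of i] by (cases "i < n") auto
  qed
  have small: "relabel N u1 u2 u3 u \<le> 3" if "u \<in> {u1, u2, u3}" for u1 u2 u3 u
    using that by (auto simp: relabel_def)
  have pos: "0 < relabel N u1 u2 u3 u" for u1 u2 u3 u
    using N(2)[of u] by (auto simp: relabel_def)
  have same: "relabel N p1 p2 p3 (g t) = N (g t)" "relabel N q1 q2 q3 (h t) = N (g t)"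
    if "t \<in> outer" for t
    using outside_g[OF that] p q by (auto simp: relabel_def)
  show ?thesis
  proof (rule curve_combination_exchange[OF g.spherical h.spherical Dg Dh
        sub(1)[of i1] sub(1)[of i2] sub(1)[of i3] sub(2)[of i1] sub(2)[of i2] sub(2)[of i3]
        outer_ivl[of i1] outer_ivl[of i2] outer_ivl[of i3] _ ord(1) _ ord(2) _ _ _ _ _ _ _ _ _ _ ex])
    show "over_branch h t = over_branch g t" if "t \<in> outer" for t
    proof (rule outside_double_points(2)[OF g.arcs_axioms h.arcs_axioms])
      show "h u = g u" if "u \<in> {0..1} - (\<Union>i<n. {l i..r i})" for u using that by (rule outside_eq)
      show "t \<in> double_points g - (\<Union>i<n. {l i..r i})" using that unfolding outer_def .
    qed
    have "g ` double_points g \<subseteq> g ` double_points g \<union> {p1, p2, p3}" by blast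
    then show "inj_on (relabel N p1 p2 p3) (g ` double_points g)"
      using inj_on_relabel[OF N] inj_on_subset by blast
    \<comment> \<open>Outside the disk the double points of \<open>h\<close> are those of
      \<open>g\<close>, so at most \<open>q1\<close>, \<open>q2\<close>, \<open>q3\<close> are
      new.\<close>
    have "h ` double_points h \<subseteq> g ` double_points g \<union> {q1, q2, q3}"
      using hQ outside_g Dg unfolding Dh by auto
    then show "inj_on (relabel N q1 q2 q3) (h ` double_points h)"
      using inj_on_relabel[OF N] inj_on_subset by blast
    show "relabel N p1 p2 p3 (g t) \<le> 3" if "t \<in> P i1 \<union> P i2 \<union> P i3" for t
      using gP[OF that] by (rule small)
    show "relabel N q1 q2 q3 (h t) \<le> 3" if "t \<in> Q i1 \<union> Q i2 \<union> Q i3" for t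
      using hQ[OF that] by (rule small)
  qed (use ivl same N(2) pos in \<open>auto simp: same\<close>)
qed

end

lemma has_vector_derivative_graph:
  assumes "(f has_real_derivative d) (at s)" "(k has_real_derivative e) (at s)"
  shows "((\<lambda>s. (f s, k s)) has_vector_derivative (d, e)) (at s)"
  using has_derivative_Pair[OF assms[unfolded has_field_derivative_def]]
  by (simp add: has_vector_derivative_def mult.commute)

lemma local_change_arcs:
  assumes lc: "local_change as bs \<sigma> g h" and g: "spherical_curve g" and h: "spherical_curve h"
    and n: "length as = n"
    and as: "\<And>i. i < n \<Longrightarrow> as ! i = \<gamma> i" and bs: "\<And>i. i < n \<Longrightarrow> bs ! i = \<delta> i"
    and \<gamma>: "\<And>i s. s \<in> {-1..1} \<Longrightarrow> \<gamma> i s \<in> model_square"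
      "\<And>i s. (\<gamma> i has_vector_derivative \<gamma>' i s) (at s)"
    and \<delta>: "\<And>i s. s \<in> {-1..1} \<Longrightarrow> \<delta> i s \<in> model_square"
      "\<And>i s. (\<delta> i has_vector_derivative \<delta>' i s) (at s)"
  shows "\<exists>\<psi> l r. arcs_change g h \<psi> n \<gamma> \<gamma>' \<delta> \<delta>' \<sigma> l r"
proof -
  obtain \<psi> l r where chart: "square_chart \<psi>"
    and \<sigma>': "\<forall>i<n. \<sigma> i \<in> {-1, 1} \<and> 0 < l i \<and> l i < r i \<and> r i < 1"
    and disj': "\<forall>i<n. \<forall>j<n. i \<noteq> j \<longrightarrow> {l i..r i} \<inter> {l j..r j} = {}"
    and arc': "\<forall>i<n. \<forall>t\<in>{l i..r i}.
           g t = \<psi> ((as ! i) (\<sigma> i * ((2 * t - l i - r i) / (r i - l i)))) \<and>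
           h t = \<psi> ((bs ! i) (\<sigma> i * ((2 * t - l i - r i) / (r i - l i))))"
    and out': "\<forall>t\<in>{0..1} - (\<Union>i<n. {l i..r i}). h t = g t \<and> g t \<notin> \<psi> ` model_square"
    using lc unfolding local_change_def n by (elim exE conjE) (rule that)
  have \<sigma>: "\<sigma> i \<in> {-1, 1}" "0 < l i \<and> l i < r i \<and> r i < 1" if "i < n" for i
    using \<sigma>' that by blast+
  have disj: "{l i..r i} \<inter> {l j..r j} = {}" if "i < n" "j < n" "i \<noteq> j" for i j
    using disj' that by blast
  have arc: "g t = \<psi> (\<gamma> i (\<sigma> i * ((2 * t - l i - r i) / (r i - l i))))"
    "h t = \<psi> (\<delta> i (\<sigma> i * ((2 * t - l i - r i) / (r i - l i))))" if "i < n" "t \<in> {l i..r i}" for i t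
    using arc' that as[OF that(1)] bs[OF that(1)] by metis+
  have out: "h t = g t" "g t \<notin> \<psi> ` model_square" "h t \<notin> \<psi> ` model_square"
    if "t \<in> {0..1} - (\<Union>i<n. {l i..r i})" for t
    using bspec[OF out' that] by simp_all
  have out2: "g t \<notin> \<psi> ` model_square" "h t \<notin> \<psi> ` model_square"
    if "t \<in> {0..1}" "t \<notin> (\<Union>i<n. {l i..r i})" for t
    using out(2,3)[of t] that by blast+
  have "arcs g \<psi> n \<gamma> \<gamma>' \<sigma> l r"
    by unfold_locales (rule g chart \<sigma> disj arc(1) out2(1) \<gamma>; assumption)+
  moreover have "arcs h \<psi> n \<delta> \<delta>' \<sigma> l r"
    by unfold_locales (rule h chart \<sigma> disj arc(2) out2(2) \<delta>; assumption)+
  ultimately have "arcs_change g h \<psi> n \<gamma> \<gamma>' \<delta> \<delta>' \<sigma> l r"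
    using out(1) unfolding arcs_change_def arcs_change_axioms_def by blast
  then show ?thesis by blast
qed

context arcs
begin

lemma sorted_list_of_set_times:
  assumes "i < n" "s < s'"
  shows "sorted_list_of_set (time i ` {s, s'}) = (if \<sigma> i = 1 then [time i s, time i s'] else [time i s', time i s])"
  using assms time_less[of i s s'] time_less[of i s' s]
  by (intro sorted_list_of_set_eqI) (auto simp: insert_commute)

lemma curve_part_times:
  assumes "i < n" "s < s'" "s \<in> {-1..1}" "s' \<in> {-1..1}"
  shows "curve_part h M (time i ` {s, s'}) =
    (if \<sigma> i = 1 then (\<lambda>w. w) else rev)
      [endpoint_of (over_branch h (time i s)) (M (\<psi> (\<gamma> i s))),
       endpoint_of (over_branch h (time i s')) (M (\<psi> (\<gamma> i s')))]"
  unfolding curve_part_def sorted_list_of_set_times[OF assms(1,2)]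
  using assms by (simp add: arc_time)

lemma sigma_cases: "i < n \<Longrightarrow> \<sigma> i = 1 \<or> \<sigma> i = - 1"
  using sigma[of i] by auto

end

lemma curve_part_empty [simp]: "curve_part g N {} = []"
  by (simp add: curve_part_def)

text \<open>An empty block merely separates two gaps. The gap behind \<open>B\<close> is moved in
  front of \<open>S\<close>, and the gap between the empty block and \<open>B\<close> is taken
  empty. Combined with a rotation this lets two blocks change places.\<close>

lemma exchangeable_shift:
  assumes "exchangeable \<phi> A [] B [] [] []"
  shows "exchangeable \<phi> A B [] [] [] []"
  unfolding exchangeable_def
proof (intro allI impI, elim conjE)
  fix S T U :: gword
  assume g: "oriented_gauss_word (S @ T @ U)"
    and d: "letters (S @ T @ U) \<inter> (letters (A @ B @ []) \<union> letters ([] @ [] @ [])) = {}"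
  have "oriented_gauss_word ((U @ S) @ T @ [])"
    using g oriented_gauss_word_append_commute[of "S @ T" U] by simp
  moreover have "letters ((U @ S) @ T @ []) \<inter> (letters (A @ [] @ B) \<union> letters ([] @ [] @ [])) = {}"
    using d by auto
  ultimately have "(\<Sum>K\<in>Pow (letters (A @ [] @ B)).
           \<phi> (arrow_diagram ((U @ S) @ sub_word A K @ T @ sub_word [] K @ [] @ sub_word B K))) =
        (\<Sum>K\<in>Pow (letters ([] @ [] @ [])).
           \<phi> (arrow_diagram ((U @ S) @ sub_word [] K @ T @ sub_word [] K @ [] @ sub_word [] K)))"
    by (rule assms[unfolded exchangeable_def, rule_format, OF conjI])
  moreover have rot: "arrow_diagram ((U @ S) @ X @ T @ Y) = arrow_diagram (S @ X @ T @ Y @ U)" for X Y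
    using arrow_diagram_append_commute[of U "S @ X @ T @ Y"] by simp
  ultimately show "(\<Sum>K\<in>Pow (letters (A @ B @ [])).
           \<phi> (arrow_diagram (S @ sub_word A K @ T @ sub_word B K @ U @ sub_word [] K))) =
        (\<Sum>K\<in>Pow (letters ([] @ [] @ [])).
           \<phi> (arrow_diagram (S @ sub_word [] K @ T @ sub_word [] K @ U @ sub_word [] K)))"
    using rot[of "[]" "[]"] by simp
qed

lemma exchangeable_swap:
  "exchangeable \<phi> A B [] [] [] [] \<Longrightarrow> exchangeable \<phi> B A [] [] [] []"
  by (rule exchangeable_shift[OF exchangeable_rotate])

subsection \<open>The first deformation\<close>

text \<open>The profile common to all models. It vanishes together with its derivative at -1 and 1,
  which makes the arcs agree to first order at their ends.\<close>

definition bump :: "real \<Rightarrow> real" where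
  "bump s = (1 - s\<^sup>2)\<^sup>2"

lemma bump_derivative: "(bump has_real_derivative - 4 * s * (1 - s\<^sup>2)) (at s)"
  unfolding bump_def[abs_def] by (auto intro!: derivative_eq_intros simp: algebra_simps)

lemma bump_bounds: "s \<in> {-1..1} \<Longrightarrow> bump s \<in> {0..1}"
  unfolding bump_def by (auto simp: abs_square_le_1 power_le_one)

lemma bump_minus [simp]: "bump (- s) = bump s"
  by (simp add: bump_def)

lemma bump_eq_iff:
  assumes "s \<in> {-1..1}" "t \<in> {-1..1}"
  shows "bump s = bump t \<longleftrightarrow> s = t \<or> s = - t"
proof -
  have "s\<^sup>2 \<le> 1" "t\<^sup>2 \<le> 1" using assms by (auto simp: abs_square_le_1)
  then have "bump s = bump t \<longleftrightarrow> 1 - s\<^sup>2 = 1 - t\<^sup>2"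
    unfolding bump_def by (intro power2_eq_iff_nonneg) auto
  then show ?thesis by (simp add: power2_eq_iff)
qed

lemma bump_half: "\<exists>a. 0 < a \<and> a < 1 \<and> bump a = 1 / 2"
proof -
  \<comment> \<open>For \<open>bump a = 1 / 2\<close> the quantity \<open>1 - a^2\<close> has to be
    \<open>sqrt (1 / 2)\<close>.\<close>
  let ?a = "sqrt (1 - sqrt (1 / 2))"
  have "sqrt (1 / 2) < sqrt 1" by (intro real_sqrt_less_mono) simp
  then have "0 < 1 - sqrt (1 / 2)" "1 - sqrt (1 / 2) < 1" by simp_all
  then have "0 < ?a" "?a < 1" "?a\<^sup>2 = 1 - sqrt (1 / 2)"
    by (simp_all add: real_sqrt_less_iff[of _ 1, simplified])
  then show ?thesis by (intro exI[of _ ?a]) (simp add: bump_def)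
qed

text \<open>\<open>c = 1\<close> is the model after the deformation, \<open>c = 0\<close> the one before it.\<close>

definition RI_arc :: "real \<Rightarrow> nat \<Rightarrow> real \<Rightarrow> real \<times> real" where
  "RI_arc c i s = (s * (1 - 2 * c * bump s), c * bump s / 2)"

definition RI_tangent :: "real \<Rightarrow> nat \<Rightarrow> real \<Rightarrow> real \<times> real" where
  "RI_tangent c i s = (1 - 2 * c * bump s + s * (8 * c * s * (1 - s\<^sup>2)), - 2 * c * s * (1 - s\<^sup>2))"

lemma RI_arc_derivative: "(RI_arc c i has_vector_derivative RI_tangent c i s) (at s)"
  unfolding RI_arc_def[abs_def] RI_tangent_def
  by (intro has_vector_derivative_graph)
     (auto intro!: derivative_eq_intros bump_derivative simp: field_simps)

lemma RI_arc_square: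
  assumes "s \<in> {-1..1}" "c \<in> {0, 1}"
  shows "RI_arc c i s \<in> model_square"
proof -
  have "\<bar>1 - 2 * c * bump s\<bar> \<le> 1" using bump_bounds[OF assms(1)] assms(2) by auto
  then have "\<bar>s * (1 - 2 * c * bump s)\<bar> \<le> 1 * 1"
    unfolding abs_mult using assms(1) by (intro mult_mono) auto
  then show ?thesis using bump_bounds[OF assms(1)] assms(2)
    by (auto simp: RI_arc_def abs_le_iff)
qed

text \<open>For the loop, equal heights leave only \<open>t = - s\<close>. The horizontal coordinate
  is odd, so it must vanish there, and \<open>s = 0\<close> is excluded.\<close>

lemma RI_arc_eq_iff:
  assumes "s \<in> {-1..1}" "t \<in> {-1..1}" "c \<in> {0, 1}" "s \<noteq> t"
  shows "RI_arc c i s = RI_arc c i t \<longleftrightarrow> c = 1 \<and> t = - s \<and> bump s = 1 / 2"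
proof (cases "c = 0")
  case False
  then have "c = 1" using assms by simp
  show ?thesis
  proof (cases "t = - s")
    case True
    then have "s \<noteq> 0" using assms by auto
    have "s * (1 - 2 * bump s) = (- s) * (1 - 2 * bump s) \<longleftrightarrow> 2 * s * (1 - 2 * bump s) = 0"
      by (simp add: algebra_simps)
    also have "\<dots> \<longleftrightarrow> bump s = 1 / 2" using \<open>s \<noteq> 0\<close> by auto
    finally show ?thesis using True \<open>c = 1\<close> by (simp add: RI_arc_def)
  next
    case False
    then show ?thesis using bump_eq_iff[OF assms(1,2)] assms(4) \<open>c = 1\<close> by (auto simp: RI_arc_def)
  qed
qed (use assms in \<open>auto simp: RI_arc_def\<close>)

lemma curve_combination_RI:
  assumes lc: "local_change RI_before RI_after \<sigma> g h" and g: "spherical_curve g" and h: "spherical_curve h"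
    and rel: "\<And>r. r \<in> relators RI \<Longrightarrow> weight x \<alpha> I r = 0"
  shows "curve_combination x \<alpha> I g = curve_combination x \<alpha> I h"
proof -
  have "\<exists>\<psi> l r. arcs_change g h \<psi> 1 (RI_arc 0) (RI_tangent 0) (RI_arc 1) (RI_tangent 1) \<sigma> l r"
  proof (rule local_change_arcs[OF lc g h])
    show "RI_before ! i = RI_arc 0 i" "RI_after ! i = RI_arc 1 i" if "i < 1" for i
      using that by (simp_all add: RI_before_def RI_after_def RI_arc_def bump_def fun_eq_iff)
  qed ((rule RI_arc_square RI_arc_derivative; simp) | simp add: RI_before_def)+
  then obtain \<psi> l r where "arcs_change g h \<psi> 1 (RI_arc 0) (RI_tangent 0) (RI_arc 1) (RI_tangent 1) \<sigma> l r"
    by blast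
  then interpret arcs_change g h \<psi> 1 "RI_arc 0" "RI_tangent 0" "RI_arc 1" "RI_tangent 1" \<sigma> l r .
  interpret diagram_functional "weight x \<alpha> I" by (rule diagram_functional_weight)
  obtain a where a: "0 < a" "a < 1" "bump a = 1 / 2" using bump_half by blast
  have cg: "g.crossings 0 = {}"
    unfolding g.crossings_def using RI_arc_eq_iff[of _ _ 0] by auto
  have ch: "h.crossings 0 = {- a, a}"
  proof -
    have "s \<in> h.crossings 0 \<longleftrightarrow> s \<in> {-1..1} \<and> bump s = bump a" for s
    proof
      assume "s \<in> h.crossings 0"
      then obtain s' where "s \<in> {-1..1}" "s' \<in> {-1..1}" "s' \<noteq> s" "RI_arc 1 0 s' = RI_arc 1 0 s"
        unfolding h.crossings_def by auto
      then show "s \<in> {-1..1} \<and> bump s = bump a" using RI_arc_eq_iff[of s' s 1 0] a by auto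
    next
      assume s: "s \<in> {-1..1} \<and> bump s = bump a"
      then have "s \<noteq> 0" using a by (auto simp: bump_def)
      then have "- s \<in> {-1..1}" "- s \<noteq> s" "RI_arc 1 0 (- s) = RI_arc 1 0 s"
        using RI_arc_eq_iff[of "- s" s 1 0] s a by auto
      then show "s \<in> h.crossings 0" unfolding h.crossings_def using s by blast
    qed
    then show ?thesis using bump_eq_iff[of _ a] a by auto
  qed
  obtain N :: "real^3 \<Rightarrow> nat" where N: "inj_on N (g ` double_points g)" "\<And>p. 3 < N p"
    using g.exists_labelling[of 3] by blast
  have pt: "RI_arc 1 0 (- a) = RI_arc 1 0 a" using RI_arc_eq_iff[of "- a" a 1] a by simp
  \<comment> \<open>The loop has one crossing, so all three points coincide and its letter is
    1.\<close>
  let ?q = "\<psi> (RI_arc 1 0 a)" and ?M = "relabel N (\<psi> (RI_arc 1 0 a)) (\<psi> (RI_arc 1 0 a)) (\<psi> (RI_arc 1 0 a))"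
  let ?Q = "\<lambda>i::nat. if i < 1 then h.time 0 ` {- a, a} else {}"
  have M: "?M ?q = 1" by (simp add: relabel_def)
  \<comment> \<open>Which of the two passages is above is left open, as both orders of starting and
    end point are relators.\<close>
  have "over_branch h (h.time 0 (- a)) \<longleftrightarrow> \<not> over_branch h (h.time 0 a)"
    using a pt h.time_in_unit[of 0 a] h.time_in_unit[of 0 "- a"]
    by (intro h.over_branch_swap) (auto simp: h.arc_time h.time_eq_iff)
  then have "curve_part h ?M (?Q 0) = [Start 1, End 1] \<or> curve_part h ?M (?Q 0) = [End 1, Start 1]"
    using h.curve_part_times[of 0 "- a" a ?M] a pt M by (auto simp: endpoint_of_def)
  then have "exchangeable \<phi> (curve_part h ?M (?Q 0)) [] [] [] [] []"
    using rel by (intro exchangeable_RI[of 1]) auto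
  then have ex: "exchangeable \<phi> [] [] [] (curve_part h ?M (?Q 0)) [] []" by (rule exchangeable_sym)
  have q: "?q \<in> \<psi> ` model_square" using a by (intro imageI RI_arc_square) auto
  show ?thesis
  \<comment> \<open>The indices 1 and 2 are fictitious arcs with the one-point intervals at 2 and 3,
    beyond the period.\<close>
  proof (rule curve_combination_arcs[of 0 1 2 "\<lambda>i. if i < 1 then l i else real i + 1"
        "\<lambda>i. if i < 1 then r i else real i + 1" "\<lambda>i. {}" ?Q N ?q ?q ?q ?q ?q ?q])
    show "double_points g \<inter> {l i..r i} = {}" if "i < 1" for i
      using g.double_points_arc[of i] that cg by simp
    show "double_points h \<inter> {l i..r i} = ?Q i" if "i < 1" for i
      using h.double_points_arc[of 0] ch that by simp
    show "h t \<in> {?q, ?q, ?q}" if "i < 1" "t \<in> ?Q i" for i t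
      using that a pt by (auto simp: h.arc_time)
    show "exchangeable \<phi> (curve_part g ?M {}) (curve_part g ?M {}) (curve_part g ?M {})
      (curve_part h ?M (?Q 0)) (curve_part h ?M (?Q 1)) (curve_part h ?M (?Q 2))"
      using ex by simp
  qed (use g.interval[of 0] N q in auto)
qed

subsection \<open>The second deformation\<close>

lemma sign_product:
  fixes k :: real
  assumes "k \<in> {-1, 1}"
  shows "0 < u \<Longrightarrow> 0 < k * u \<longleftrightarrow> k = 1" and "u < 0 \<Longrightarrow> 0 < k * u \<longleftrightarrow> k = - 1"
  using assms by auto

lemma (in arcs) interval_order:
  assumes "i < n" "j < n" "i \<noteq> j"
  shows "r i < l j \<or> r j < l i"
proof (rule ccontr)
  assume "\<not> (r i < l j \<or> r j < l i)"
  then have "max (l i) (l j) \<in> {l i..r i} \<inter> {l j..r j}"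
    using interval[of i] interval[of j] assms by auto
  then show False using disjoint[OF assms] by blast
qed

text \<open>As for RI, \<open>c\<close> is 0 before the deformation and 1 after it.\<close>

definition RII_arc :: "real \<Rightarrow> nat \<Rightarrow> real \<Rightarrow> real \<times> real" where
  "RII_arc c i s = (s, if i = 0 then 0 else 1 / 2 - c * bump s)"

definition RII_tangent :: "real \<Rightarrow> nat \<Rightarrow> real \<Rightarrow> real \<times> real" where
  "RII_tangent c i s = (1, if i = 0 then 0 else 4 * c * s * (1 - s\<^sup>2))"

lemma RII_arc_derivative: "(RII_arc c i has_vector_derivative RII_tangent c i s) (at s)"
  unfolding RII_arc_def[abs_def] RII_tangent_def
  by (cases "i = 0"; intro has_vector_derivative_graph)
     (auto intro!: derivative_eq_intros bump_derivative simp: field_simps)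

lemma RII_arc_square:
  assumes "s \<in> {-1..1}" "c \<in> {0, 1}"
  shows "RII_arc c i s \<in> model_square"
  using bump_bounds[OF assms(1)] assms by (auto simp: RII_arc_def)

text \<open>The letters 1 and 2 are the left and the right crossing, and \<open>\<tau>\<close> is
  the product of the signs of the chart and of both directions. The determinants at the two
  crossings are opposite, so the upper branch changes from one arc to the other. Each coherent
  pattern is one of the two strong relators; of the incoherent ones, half match the weak relator
  only after their blocks are swapped.\<close>

lemma (in diagram_functional) exchangeable_RII_chunks:
  fixes \<sigma> :: "nat \<Rightarrow> real" and \<tau> :: real
  assumes \<sigma>: "\<sigma> 0 \<in> {-1, 1}" "\<sigma> 1 \<in> {-1, 1}" and \<tau>: "\<tau> \<in> {-1, 1}"
    and strong: "\<And>r. coherent_bigon \<sigma> \<Longrightarrow> r \<in> relators strong_RII \<Longrightarrow> \<Phi> r = 0"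
    and weak: "\<And>r. \<not> coherent_bigon \<sigma> \<Longrightarrow> r \<in> relators weak_RII \<Longrightarrow> \<Phi> r = 0"
  shows "exchangeable \<phi>
     ((if \<sigma> 0 = 1 then (\<lambda>w. w) else rev) [endpoint_of (\<tau> = -1) 1, endpoint_of (\<tau> = 1) 2])
     ((if \<sigma> 1 = 1 then (\<lambda>w. w) else rev) [endpoint_of (\<tau> = 1) 1, endpoint_of (\<tau> = -1) 2])
     [] [] [] []"
proof (cases "coherent_bigon \<sigma>")
  case True
  note rules = exchangeable_strong_RII[OF strong[OF True]]
  show ?thesis using \<sigma> \<tau> True
    by (elim insertE emptyE, simp_all add: endpoint_of_def coherent_bigon_def)
       (rule rules; simp; fail)+
next
  case False
  note rule1 = exchangeable_weak_RII[OF weak[OF False]]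
  note rules = rule1 exchangeable_swap[OF rule1]
  show ?thesis using \<sigma> \<tau> False
    by (elim insertE emptyE, simp_all add: endpoint_of_def coherent_bigon_def)
       (rule rules; simp; fail)+
qed

lemma curve_combination_RII:
  assumes lc: "local_change RII_before RII_after \<sigma> g h" and g: "spherical_curve g" and h: "spherical_curve h"
    and strong: "\<And>r. coherent_bigon \<sigma> \<Longrightarrow> r \<in> relators strong_RII \<Longrightarrow> weight x \<alpha> I r = 0"
    and weak: "\<And>r. \<not> coherent_bigon \<sigma> \<Longrightarrow> r \<in> relators weak_RII \<Longrightarrow> weight x \<alpha> I r = 0"
  shows "curve_combination x \<alpha> I g = curve_combination x \<alpha> I h"
proof -
  have "\<exists>\<psi> l r. arcs_change g h \<psi> 2 (RII_arc 0) (RII_tangent 0) (RII_arc 1) (RII_tangent 1) \<sigma> l r"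
  proof (rule local_change_arcs[OF lc g h])
    show "RII_before ! i = RII_arc 0 i" "RII_after ! i = RII_arc 1 i" if "i < 2" for i
      using that by (auto simp: RII_before_def RII_after_def RII_arc_def bump_def fun_eq_iff less_2_cases_iff)
  qed ((rule RII_arc_square RII_arc_derivative; simp) | simp add: RII_before_def)+
  then obtain \<psi> l r where "arcs_change g h \<psi> 2 (RII_arc 0) (RII_tangent 0) (RII_arc 1) (RII_tangent 1) \<sigma> l r"
    by blast
  then interpret arcs_change g h \<psi> 2 "RII_arc 0" "RII_tangent 0" "RII_arc 1" "RII_tangent 1" \<sigma> l r .
  interpret diagram_functional "weight x \<alpha> I" by (rule diagram_functional_weight)
  obtain a where a: "0 < a" "a < 1" "bump a = 1 / 2" using bump_half by blast
  have a_in: "a \<in> {-1..1}" "- a \<in> {-1..1}" "a \<in> {-1<..<1}" "- a \<in> {-1<..<1}" using a by auto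
  have eq: "RII_arc c j s' = RII_arc c i s \<longleftrightarrow> s' = s \<and> (i = j \<or> c * bump s = 1 / 2)"
    if "i < 2" "j < 2" for i j c s s'
    using that by (auto simp: RII_arc_def less_2_cases_iff)
  have cg: "g.crossings i = {}" if "i < 2" for i
    unfolding g.crossings_def using eq[of i _ 0] that by auto
  have ch: "h.crossings i = {- a, a}" if "i < 2" for i
  proof -
    have "s \<in> h.crossings i \<longleftrightarrow> s \<in> {-1..1} \<and> bump s = bump a" for s
    proof
      assume "s \<in> h.crossings i"
      then show "s \<in> {-1..1} \<and> bump s = bump a"
        unfolding h.crossings_def using eq[of i _ 1 _ s] that a(3) by auto
    next
      assume s: "s \<in> {-1..1} \<and> bump s = bump a"
      have "1 - i < 2" "1 - i \<noteq> i" using that by presburger+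
      then have "1 - i < 2" "(1 - i, s) \<noteq> (i, s)" "RII_arc 1 (1 - i) s = RII_arc 1 i s"
        using eq[of i "1 - i" 1 s s] that a(3) s by auto
      then show "s \<in> h.crossings i" unfolding h.crossings_def using s by blast
    qed
    then show ?thesis using bump_eq_iff[of _ a] a by auto
  qed
  obtain N :: "real^3 \<Rightarrow> nat" where N: "inj_on N (g ` double_points g)" "\<And>p. 3 < N p"
    using g.exists_labelling[of 3] by blast
  define q1 q2 where "q1 = \<psi> (RII_arc 1 0 (- a))" and "q2 = \<psi> (RII_arc 1 0 a)"
  have pt: "\<psi> (RII_arc 1 i (- a)) = q1" "\<psi> (RII_arc 1 i a) = q2" if "i < 2" for i
    using that eq[of 0 i 1 a a] eq[of 0 i 1 "- a" "- a"] a by (simp_all add: q1_def q2_def)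
  have q: "q1 \<in> \<psi> ` model_square" "q2 \<in> \<psi> ` model_square"
    unfolding q1_def q2_def using a by (intro imageI RII_arc_square; simp)+
  have "q1 \<noteq> q2"
  proof
    assume "q1 = q2"
    then have "RII_arc 1 0 (- a) = RII_arc 1 0 a"
      unfolding q1_def q2_def
      by (rule inj_onD[OF square_chart_inj[OF h.chart]]) (use a in \<open>intro RII_arc_square; simp\<close>)+
    then show False using a by (simp add: RII_arc_def)
  qed
  let ?M = "relabel N q1 q2 q2"
  have M: "?M q1 = 1" "?M q2 = 2" using \<open>q1 \<noteq> q2\<close> by (simp_all add: relabel_def)
  let ?Q = "\<lambda>i::nat. if i < 2 then h.time i ` {- a, a} else {}"
  define \<tau> where "\<tau> = chart_sign \<psi> * \<sigma> 0 * \<sigma> 1"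
  have sg: "\<sigma> 0 \<in> {-1, 1}" "\<sigma> 1 \<in> {-1, 1}" using h.sigma[of 0] h.sigma[of 1] by simp_all
  have \<tau>: "\<tau> \<in> {-1, 1}" using sg square_chart_frame(1)[OF h.chart] by (auto simp: \<tau>_def)
  \<comment> \<open>This is the slope of the bent arc at \<open>a\<close>; at \<open>- a\<close> it
    is the opposite.\<close>
  have pos: "0 < 4 * a * (1 - a\<^sup>2)" using a by (simp add: power_less_one_iff abs_square_less_1)
  have over: "over_branch h (h.time 0 a) \<longleftrightarrow> \<tau> = 1" "over_branch h (h.time 0 (- a)) \<longleftrightarrow> \<tau> = -1"
    "over_branch h (h.time 1 a) \<longleftrightarrow> \<tau> = -1" "over_branch h (h.time 1 (- a)) \<longleftrightarrow> \<tau> = 1"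
    using h.over_branch_time[of 0 1 a a] h.over_branch_time[of 0 1 "- a" "- a"]
      h.over_branch_time[of 1 0 a a] h.over_branch_time[of 1 0 "- a" "- a"] a_in
      eq[of 0 1 1 a a] eq[of 0 1 1 "- a" "- a"] a(3) sign_product[OF \<tau>, of "4 * a * (1 - a\<^sup>2)"]
      sign_product[OF \<tau>, of "- (4 * a * (1 - a\<^sup>2))"] pos
    by (simp_all add: \<tau>_def RII_tangent_def plane_cross_def mult_ac)
  have part: "curve_part h ?M (?Q 0) = (if \<sigma> 0 = 1 then (\<lambda>w. w) else rev) [endpoint_of (\<tau> = -1) 1, endpoint_of (\<tau> = 1) 2]"
    "curve_part h ?M (?Q 1) = (if \<sigma> 1 = 1 then (\<lambda>w. w) else rev) [endpoint_of (\<tau> = 1) 1, endpoint_of (\<tau> = -1) 2]"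
    using h.curve_part_times[of 0 "- a" a ?M] h.curve_part_times[of 1 "- a" a ?M] a over M
    by (simp_all add: pt)
  have ex: "exchangeable \<phi> (curve_part h ?M (?Q 0)) (curve_part h ?M (?Q 1)) [] [] [] []"
    unfolding part using sg \<tau> strong weak by (rule exchangeable_RII_chunks)
  \<comment> \<open>Either arc may be passed first; the rule for one order yields the other by
    swapping the blocks.\<close>
  have *: ?thesis if i: "(i1, i2) \<in> {(0, 1), (1, 0)}" and "r i1 < l i2" for i1 i2
  proof (rule curve_combination_arcs[of i1 i2 2 "\<lambda>i. if i < 2 then l i else real i + 1"
        "\<lambda>i. if i < 2 then r i else real i + 1" "\<lambda>i. {}" ?Q N q1 q2 q2 q1 q2 q2])
    show "double_points g \<inter> {l i..r i} = {}" if "i < 2" for i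
      using g.double_points_arc[of i] cg that by simp
    show "double_points h \<inter> {l i..r i} = ?Q i" if "i < 2" for i
      using h.double_points_arc[of i] ch that by simp
    show "h t \<in> {q1, q2, q2}" if "i < 2" "t \<in> ?Q i" for i t
      using that a by (auto simp: h.arc_time pt)
    have "exchangeable \<phi> (curve_part h ?M (?Q i1)) (curve_part h ?M (?Q i2)) [] [] [] []"
      using i ex exchangeable_swap[OF ex] by auto
    from exchangeable_sym[OF this] show "exchangeable \<phi> (curve_part g ?M {}) (curve_part g ?M {}) (curve_part g ?M {})
      (curve_part h ?M (?Q i1)) (curve_part h ?M (?Q i2)) (curve_part h ?M (?Q 2))"
      by simp
  qed (use g.interval[of 0] g.interval[of 1] N q that in auto)
  show ?thesis using h.interval_order[of 0 1] *[of 0 1] *[of 1 0] by auto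
qed

subsection \<open>The third deformation\<close>

lemma bump_antimono:
  assumes "0 \<le> s" "s \<le> t" "t \<le> 1"
  shows "bump t \<le> bump s"
proof -
  have "s\<^sup>2 \<le> t\<^sup>2" "t\<^sup>2 \<le> 1" using assms by (auto intro: power_mono simp: power_le_one)
  then show ?thesis unfolding bump_def by (intro power_mono) auto
qed

text \<open>The fixed point is where the arcs 0 and 2 of RIII meet. A solution is nonnegative
  because \<open>bump\<close> is, and on nonnegative parameters \<open>bump\<close> does not
  increase, so there is only one.\<close>

lemma bump_fixpoint: "\<exists>a. 0 < a \<and> a < 1 \<and> bump a = a \<and> (\<forall>s\<in>{-1..1}. bump s = s \<longrightarrow> s = a)"
proof -
  have "continuous_on {0..1} (\<lambda>s. s - bump s)"
    unfolding bump_def by (intro continuous_intros)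
  then obtain a where a: "0 \<le> a" "a \<le> 1" "a - bump a = 0"
    using IVT'[of "\<lambda>s. s - bump s" 0 0 1] by (auto simp: bump_def)
  moreover have "a \<noteq> 0" "a \<noteq> 1" using a(3) by (auto simp: bump_def)
  moreover have "s = a" if s: "s \<in> {-1..1}" "bump s = s" for s
  proof -
    have "0 \<le> s" using bump_bounds[OF s(1)] s(2) by simp
    then show ?thesis
      using bump_antimono[of s a] bump_antimono[of a s] a s by (cases "s \<le> a") auto
  qed
  ultimately show ?thesis by (intro exI[of _ a]) auto
qed

text \<open>\<open>e = 1\<close> is the model before the deformation, \<open>e = -1\<close> the one after it.\<close>

definition RIII_arc :: "real \<Rightarrow> nat \<Rightarrow> real \<Rightarrow> real \<times> real" where
  "RIII_arc e i s = (s, if i = 0 then s / 2 else if i = 1 then - s / 2 else e * bump s / 2)"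

definition RIII_tangent :: "real \<Rightarrow> nat \<Rightarrow> real \<Rightarrow> real \<times> real" where
  "RIII_tangent e i s = (1, if i = 0 then 1 / 2 else if i = 1 then - 1 / 2 else - 2 * e * s * (1 - s\<^sup>2))"

lemma RIII_arc_derivative: "(RIII_arc e i has_vector_derivative RIII_tangent e i s) (at s)"
proof -
  have "((\<lambda>s. if i = 0 then s / 2 else if i = 1 then - s / 2 else e * bump s / 2)
      has_real_derivative (if i = 0 then 1 / 2 else if i = 1 then - 1 / 2 else - 2 * e * s * (1 - s\<^sup>2))) (at s)"
    by (cases "i = 0"; cases "i = 1")
       (auto intro!: derivative_eq_intros bump_derivative simp: field_simps)
  then show ?thesis
    unfolding RIII_arc_def[abs_def] RIII_tangent_def
    by (intro has_vector_derivative_graph DERIV_ident)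
qed

lemma RIII_arc_square:
  assumes "s \<in> {-1..1}" "e \<in> {-1, 1}"
  shows "RIII_arc e i s \<in> model_square"
  using bump_bounds[OF assms(1)] assms by (auto simp: RIII_arc_def)

text \<open>The parameters of the crossings on each arc, \<open>c\<close> being the one of arcs 0 and 2, and the
  letters met along it. The letters 1, 2, 3 stand for the crossings of the arcs 0 and 1, 0 and 2,
  1 and 2.\<close>

definition RIII_crossings :: "real \<Rightarrow> nat \<Rightarrow> real set" where
  "RIII_crossings c i = (if i = 0 then {0, c} else if i = 1 then {- c, 0} else {- c, c})"

definition RIII_chunk :: "real \<Rightarrow> (nat \<Rightarrow> real) \<Rightarrow> nat \<Rightarrow> gword" where
  "RIII_chunk \<kappa> \<sigma> i =
     (if i = 0 then [endpoint_of (\<kappa> * \<sigma> 0 * \<sigma> 1 = - 1) 1, endpoint_of (\<kappa> * \<sigma> 0 * \<sigma> 2 = - 1) 2]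
      else if i = 1 then [endpoint_of (\<kappa> * \<sigma> 1 * \<sigma> 2 = 1) 3, endpoint_of (\<kappa> * \<sigma> 0 * \<sigma> 1 = 1) 1]
      else [endpoint_of (\<kappa> * \<sigma> 1 * \<sigma> 2 = - 1) 3, endpoint_of (\<kappa> * \<sigma> 0 * \<sigma> 2 = 1) 2])"

lemma less_3_cases: "i < 3 \<longleftrightarrow> i = 0 \<or> i = 1 \<or> i = (2::nat)"
  by auto

text \<open>Passing from \<open>e = 1\<close> to \<open>e = -1\<close> moves each crossing with the
  third arc to the opposite parameter, but keeps the tangent determinants. So letters keep their
  over and under types, and each arc meets its two crossings in the opposite order: the deformation
  reverses every block.\<close>

lemma RIII_curve_part:
  fixes a e :: real
  assumes arcs: "arcs h \<psi> 3 (RIII_arc e) (RIII_tangent e) \<sigma> l r" and e: "e \<in> {-1, 1}"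
    and a: "0 < a" "a < 1" "bump a = a" "\<forall>s\<in>{-1..1}. bump s = s \<longrightarrow> s = a"
    and q: "q1 = \<psi> (0, 0)" "q2 = \<psi> (e * a, e * a / 2)" "q3 = \<psi> (- e * a, e * a / 2)"
    and i: "i < 3"
  shows "double_points h \<inter> {l i..r i} = arcs.time \<sigma> l r i ` RIII_crossings (e * a) i"
    and "curve_part h (relabel N q1 q2 q3) (arcs.time \<sigma> l r i ` RIII_crossings (e * a) i) =
      (if \<sigma> i = e then RIII_chunk (chart_sign \<psi>) \<sigma> i else rev (RIII_chunk (chart_sign \<psi>) \<sigma> i))"
    and "t \<in> arcs.time \<sigma> l r i ` RIII_crossings (e * a) i \<Longrightarrow> h t \<in> {q1, q2, q3}"
    and "q1 \<in> \<psi> ` model_square" "q2 \<in> \<psi> ` model_square" "q3 \<in> \<psi> ` model_square"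
proof -
  interpret h: arcs h \<psi> 3 "RIII_arc e" "RIII_tangent e" \<sigma> l r by fact
  define c where "c = e * a"
  have c: "c \<noteq> 0" "c \<in> {-1..1}" "- c \<in> {-1..1}" "c \<in> {-1<..<1}" "- c \<in> {-1<..<1}"
    "e * bump c = c" "e * bump (- c) = c" "e * c = a"
    using a(1-3) e by (auto simp: c_def)
  \<comment> \<open>As \<open>bump\<close> is even, \<open>e * bump s = s\<close> says that
    \<open>e * s\<close> is the fixed point \<open>a\<close> of \<open>bump\<close>.\<close>
  have fixp: "e * bump s = s \<longleftrightarrow> s = c" if "s \<in> {-1..1}" for s
  proof
    assume "e * bump s = s"
    then have "bump (e * s) = e * s" "e * s \<in> {-1..1}" using e that by auto
    then have "e * s = a" using a(4) by simp
    then show "s = c" using e by (auto simp: c_def)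
  qed (use c in simp)
  have eq01: "RIII_arc e 0 s = RIII_arc e 1 s \<longleftrightarrow> s = 0" for s by (auto simp: RIII_arc_def)
  have eq02: "RIII_arc e 0 s = RIII_arc e 2 s \<longleftrightarrow> s = c" if "s \<in> {-1..1}" for s
    using fixp[OF that] by (auto simp: RIII_arc_def)
  have eq12: "RIII_arc e 1 s = RIII_arc e 2 s \<longleftrightarrow> s = - c" if "s \<in> {-1..1}" for s
  proof -
    have "RIII_arc e 1 s = RIII_arc e 2 s \<longleftrightarrow> e * bump (- s) = - s" by (auto simp: RIII_arc_def)
    also have "\<dots> \<longleftrightarrow> - s = c" using that by (intro fixp) auto
    finally show ?thesis by auto
  qed
  have fst_eq: "RIII_arc e j s' = RIII_arc e k s \<Longrightarrow> s' = s" for j k s s' by (simp add: RIII_arc_def)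
  have crossings_iff: "s \<in> h.crossings k \<longleftrightarrow> s \<in> {-1..1} \<and> (\<exists>j<3. j \<noteq> k \<and> RIII_arc e j s = RIII_arc e k s)"
    for k s
    unfolding h.crossings_def using fst_eq by blast
  have crossings: "h.crossings k = RIII_crossings c k" if "k < 3" for k
  proof -
    have ex: "(\<exists>j<3. P j) \<longleftrightarrow> P 0 \<or> P 1 \<or> P (2::nat)" for P
      unfolding less_3_cases by blast
    have "s \<in> h.crossings k \<longleftrightarrow> s \<in> RIII_crossings c k" for s
    proof (cases "s \<in> {-1..1}")
      case True
      note eqs = eq01[of s] eq02[OF True] eq12[OF True]
      have "RIII_arc e 1 s = RIII_arc e 0 s \<longleftrightarrow> s = 0" "RIII_arc e 2 s = RIII_arc e 0 s \<longleftrightarrow> s = c"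
        "RIII_arc e 2 s = RIII_arc e 1 s \<longleftrightarrow> s = - c"
        using eqs by metis+
      then show ?thesis
        using that[unfolded less_3_cases] True eqs unfolding crossings_iff ex RIII_crossings_def
        by (elim disjE) auto
    next
      case False
      then show ?thesis using c unfolding crossings_iff RIII_crossings_def by auto
    qed
    then show ?thesis by blast
  qed
  show "double_points h \<inter> {l i..r i} = h.time i ` RIII_crossings (e * a) i"
    using h.double_points_arc[OF i] crossings[OF i] by (simp add: c_def)
  define \<kappa> where "\<kappa> = chart_sign \<psi>"
  have sg: "\<sigma> 0 \<in> {-1, 1}" "\<sigma> 1 \<in> {-1, 1}" "\<sigma> 2 \<in> {-1, 1}" "\<kappa> \<in> {-1, 1}"
    using h.sigma[of 0] h.sigma[of 1] h.sigma[of 2] square_chart_frame(1)[OF h.chart]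
    by (simp_all add: \<kappa>_def)
  have k: "\<kappa> * \<sigma> 0 * \<sigma> 1 \<in> {-1, 1}" "\<kappa> * \<sigma> 0 * \<sigma> 2 \<in> {-1, 1}" "\<kappa> * \<sigma> 1 * \<sigma> 2 \<in> {-1, 1}"
    using sg by auto
  have pos: "0 < 2 * a * (1 - a\<^sup>2)" using a(1,2) by (simp add: abs_square_less_1)
  \<comment> \<open>Since \<open>e * c = a\<close> and \<open>c^2 = a^2\<close>, the slope of the
    third arc at the crossing does not depend on \<open>e\<close>.\<close>
  have slope: "- 2 * e * c * (1 - c\<^sup>2) = - (2 * a * (1 - a\<^sup>2))"
    using e by (auto simp: c_def)
  have slope': "- 2 * e * (- c) * (1 - (- c)\<^sup>2) = 2 * a * (1 - a\<^sup>2)"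
    using e by (auto simp: c_def)
  have cross: "plane_cross (RIII_tangent e 0 0) (RIII_tangent e 1 0) = - 1"
    "plane_cross (RIII_tangent e 1 0) (RIII_tangent e 0 0) = 1"
    "plane_cross (RIII_tangent e 0 c) (RIII_tangent e 2 c) = - (2 * a * (1 - a\<^sup>2) + 1 / 2)"
    "plane_cross (RIII_tangent e 2 c) (RIII_tangent e 0 c) = 2 * a * (1 - a\<^sup>2) + 1 / 2"
    "plane_cross (RIII_tangent e 1 (- c)) (RIII_tangent e 2 (- c)) = 2 * a * (1 - a\<^sup>2) + 1 / 2"
    "plane_cross (RIII_tangent e 2 (- c)) (RIII_tangent e 1 (- c)) = - (2 * a * (1 - a\<^sup>2) + 1 / 2)"
    using slope slope' by (simp_all add: RIII_tangent_def plane_cross_def)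
  have over: "over_branch h (h.time 0 0) \<longleftrightarrow> \<kappa> * \<sigma> 0 * \<sigma> 1 = - 1"
    "over_branch h (h.time 1 0) \<longleftrightarrow> \<kappa> * \<sigma> 0 * \<sigma> 1 = 1"
    "over_branch h (h.time 0 c) \<longleftrightarrow> \<kappa> * \<sigma> 0 * \<sigma> 2 = - 1"
    "over_branch h (h.time 2 c) \<longleftrightarrow> \<kappa> * \<sigma> 0 * \<sigma> 2 = 1"
    "over_branch h (h.time 1 (- c)) \<longleftrightarrow> \<kappa> * \<sigma> 1 * \<sigma> 2 = 1"
    "over_branch h (h.time 2 (- c)) \<longleftrightarrow> \<kappa> * \<sigma> 1 * \<sigma> 2 = - 1"
  proof -
    have big: "0 < 2 * a * (1 - a\<^sup>2) + 1 / 2" "- (2 * a * (1 - a\<^sup>2) + 1 / 2) < 0" using pos by simp_all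
    show "over_branch h (h.time 0 0) \<longleftrightarrow> \<kappa> * \<sigma> 0 * \<sigma> 1 = - 1"
      using h.over_branch_time[of 0 1 0 0] eq01[of 0] sign_product(2)[OF k(1), of "-1"]
      unfolding cross \<kappa>_def by simp
    show "over_branch h (h.time 1 0) \<longleftrightarrow> \<kappa> * \<sigma> 0 * \<sigma> 1 = 1"
      using h.over_branch_time[of 1 0 0 0] eq01[of 0] sign_product(1)[OF k(1), of 1]
      unfolding cross \<kappa>_def by (simp add: mult_ac)
    show "over_branch h (h.time 0 c) \<longleftrightarrow> \<kappa> * \<sigma> 0 * \<sigma> 2 = - 1"
      using h.over_branch_time[of 0 2 c c] eq02[of c] c sign_product(2)[OF k(2) big(2)]
      unfolding cross \<kappa>_def by simp
    show "over_branch h (h.time 2 c) \<longleftrightarrow> \<kappa> * \<sigma> 0 * \<sigma> 2 = 1"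
      using h.over_branch_time[of 2 0 c c] eq02[of c] c sign_product(1)[OF k(2) big(1)]
      unfolding cross \<kappa>_def by (simp add: mult_ac)
    show "over_branch h (h.time 1 (- c)) \<longleftrightarrow> \<kappa> * \<sigma> 1 * \<sigma> 2 = 1"
      using h.over_branch_time[of 1 2 "- c" "- c"] eq12[of "- c"] c sign_product(1)[OF k(3) big(1)]
      unfolding cross \<kappa>_def by simp
    show "over_branch h (h.time 2 (- c)) \<longleftrightarrow> \<kappa> * \<sigma> 1 * \<sigma> 2 = - 1"
      using h.over_branch_time[of 2 1 "- c" "- c"] eq12[of "- c"] c sign_product(2)[OF k(3) big(2)]
      unfolding cross \<kappa>_def by (simp add: mult_ac)
  qed
  have points: "RIII_arc e 0 0 = (0, 0)" "RIII_arc e 1 0 = (0, 0)" "RIII_arc e 0 c = (e * a, e * a / 2)"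
    "RIII_arc e 2 c = (e * a, e * a / 2)" "RIII_arc e 1 (- c) = (- e * a, e * a / 2)"
    "RIII_arc e 2 (- c) = (- e * a, e * a / 2)"
    using c by (simp_all add: RIII_arc_def c_def)
  have pts: "\<psi> (RIII_arc e 0 0) = q1" "\<psi> (RIII_arc e 1 0) = q1" "\<psi> (RIII_arc e 0 c) = q2"
    "\<psi> (RIII_arc e 2 c) = q2" "\<psi> (RIII_arc e 1 (- c)) = q3" "\<psi> (RIII_arc e 2 (- c)) = q3"
    unfolding points q by (rule refl)+
  have sq: "(0, 0) \<in> model_square" "(e * a, e * a / 2) \<in> model_square" "(- e * a, e * a / 2) \<in> model_square"
    using a(1,2) e by auto
  show "q1 \<in> \<psi> ` model_square" "q2 \<in> \<psi> ` model_square" "q3 \<in> \<psi> ` model_square"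
    unfolding q by (rule imageI, rule sq)+
  have "q1 \<noteq> q2" "q1 \<noteq> q3" "q2 \<noteq> q3"
    unfolding q using a(1) e sq inj_on_eq_iff[OF square_chart_inj[OF h.chart]] by auto
  then have M: "relabel N q1 q2 q3 q1 = 1" "relabel N q1 q2 q3 q2 = 2" "relabel N q1 q2 q3 q3 = 3"
    by (auto simp: relabel_def)
  show "t \<in> h.time i ` RIII_crossings (e * a) i \<Longrightarrow> h t \<in> {q1, q2, q3}"
    using i c(2,3) unfolding less_3_cases c_def[symmetric]
    by (auto simp: RIII_crossings_def h.arc_time pts simp del: One_nat_def)
  \<comment> \<open>For \<open>e = - 1\<close> the pair is listed by decreasing parameter, so it is
    read forwards when \<open>\<sigma> i = - 1\<close>.\<close>
  have part: "curve_part h (relabel N q1 q2 q3) (h.time i ` {s, s'}) =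
      (if \<sigma> i = e then (\<lambda>w. w) else rev)
      [endpoint_of (over_branch h (h.time i s)) (relabel N q1 q2 q3 (\<psi> (RIII_arc e i s))),
       endpoint_of (over_branch h (h.time i s')) (relabel N q1 q2 q3 (\<psi> (RIII_arc e i s')))]"
    if "e * s < e * s'" "s \<in> {-1..1}" "s' \<in> {-1..1}" for s s'
  proof (cases "e = 1")
    case True
    then show ?thesis
      using h.curve_part_times[OF i, of s s' "relabel N q1 q2 q3"] that by simp
  next
    case False
    then have "e = - 1" using e by simp
    moreover have "{s, s'} = {s', s}" by blast
    moreover have "\<sigma> i = - 1 \<longleftrightarrow> \<sigma> i \<noteq> 1" using h.sigma_cases[OF i] by auto
    ultimately show ?thesis
      using h.curve_part_times[OF i, of s' s "relabel N q1 q2 q3"] that by simp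
  qed
  have ec: "e * 0 < e * c" "e * (- c) < e * 0" "e * (- c) < e * c" using c(8) a(1) by simp_all
  show "curve_part h (relabel N q1 q2 q3) (h.time i ` RIII_crossings (e * a) i) =
      (if \<sigma> i = e then RIII_chunk (chart_sign \<psi>) \<sigma> i else rev (RIII_chunk (chart_sign \<psi>) \<sigma> i))"
    using i part[OF ec(1)] part[OF ec(2)] part[OF ec(3)] c(2,3)
    unfolding less_3_cases c_def[symmetric] \<kappa>_def[symmetric]
    by (elim disjE) (simp_all add: RIII_crossings_def RIII_chunk_def over pts M del: One_nat_def)
qed

text \<open>There are sixteen sign patterns, four of them coherent. The six orders of passage form
  two cyclic orders, so one of each is checked and the others are rotations. In every case a relator
  fits after a rotation, possibly with its sides interchanged; matching the blocks tells which
  crossings play the parts of \<open>i\<close>, \<open>j\<close>, \<open>k\<close>.\<close>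

lemma (in diagram_functional) exchangeable_RIII_chunks:
  fixes \<sigma> :: "nat \<Rightarrow> real" and \<kappa> :: real
  assumes \<sigma>: "\<sigma> 0 \<in> {-1, 1}" "\<sigma> 1 \<in> {-1, 1}" "\<sigma> 2 \<in> {-1, 1}" and \<kappa>: "\<kappa> \<in> {-1, 1}"
    and strong: "\<And>r. coherent_triangle \<sigma> \<Longrightarrow> r \<in> relators strong_RIII \<Longrightarrow> \<Phi> r = 0"
    and weak: "\<And>r. \<not> coherent_triangle \<sigma> \<Longrightarrow> r \<in> relators weak_RIII \<Longrightarrow> \<Phi> r = 0"
    and X: "\<And>i. X i = (if \<sigma> i = 1 then RIII_chunk \<kappa> \<sigma> i else rev (RIII_chunk \<kappa> \<sigma> i))"
    and i: "(i1, i2, i3) \<in> {(0, 1, 2), (1, 2, 0), (2, 0, 1), (0, 2, 1), (2, 1, 0), (1, 0, 2)}"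
  shows "exchangeable \<phi> (X i1) (X i2) (X i3) (rev (X i1)) (rev (X i2)) (rev (X i3))"
proof -
  have "exchangeable \<phi> (X 0) (X 1) (X 2) (rev (X 0)) (rev (X 1)) (rev (X 2)) \<and>
      exchangeable \<phi> (X 0) (X 2) (X 1) (rev (X 0)) (rev (X 2)) (rev (X 1))"
  proof (cases "coherent_triangle \<sigma>")
    case True
    note rules = exchangeable_strong_RIII[OF strong[OF True]]
    note rules1 = rules rules[THEN exchangeable_rotate] rules[THEN exchangeable_rotate, THEN exchangeable_rotate]
    note rules2 = rules1 rules1[THEN exchangeable_sym]
    show ?thesis unfolding X using \<sigma> \<kappa> True
      by (elim insertE emptyE, simp_all add: endpoint_of_def coherent_triangle_def RIII_chunk_def)
         (rule conjI; rule rules2; simp; fail)+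
  next
    case False
    note rules = exchangeable_weak_RIII[OF weak[OF False]]
    note rules1 = rules rules[THEN exchangeable_rotate] rules[THEN exchangeable_rotate, THEN exchangeable_rotate]
    note rules2 = rules1 rules1[THEN exchangeable_sym]
    show ?thesis unfolding X using \<sigma> \<kappa> False
      by (elim insertE emptyE, simp_all add: endpoint_of_def coherent_triangle_def RIII_chunk_def)
         (rule conjI; rule rules2; simp; fail)+
  qed
  then show ?thesis
    using i by (auto intro: exchangeable_rotate exchangeable_rotate[OF exchangeable_rotate])
qed

lemma curve_combination_RIII:
  assumes lc: "local_change RIII_before RIII_after \<sigma> g h" and g: "spherical_curve g" and h: "spherical_curve h"
    and strong: "\<And>r. coherent_triangle \<sigma> \<Longrightarrow> r \<in> relators strong_RIII \<Longrightarrow> weight x \<alpha> I r = 0"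
    and weak: "\<And>r. \<not> coherent_triangle \<sigma> \<Longrightarrow> r \<in> relators weak_RIII \<Longrightarrow> weight x \<alpha> I r = 0"
  shows "curve_combination x \<alpha> I g = curve_combination x \<alpha> I h"
proof -
  have "\<exists>\<psi> l r. arcs_change g h \<psi> 3 (RIII_arc 1) (RIII_tangent 1) (RIII_arc (-1)) (RIII_tangent (-1)) \<sigma> l r"
  proof (rule local_change_arcs[OF lc g h])
    show "RIII_before ! i = RIII_arc 1 i" "RIII_after ! i = RIII_arc (-1) i" if "i < 3" for i
      using that by (auto simp: RIII_before_def RIII_after_def RIII_arc_def bump_def fun_eq_iff less_3_cases)
  qed ((rule RIII_arc_square RIII_arc_derivative; simp) | simp add: RIII_before_def)+
  then obtain \<psi> l r where
    "arcs_change g h \<psi> 3 (RIII_arc 1) (RIII_tangent 1) (RIII_arc (-1)) (RIII_tangent (-1)) \<sigma> l r"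
    by blast
  then interpret arcs_change g h \<psi> 3 "RIII_arc 1" "RIII_tangent 1" "RIII_arc (-1)" "RIII_tangent (-1)" \<sigma> l r .
  interpret diagram_functional "weight x \<alpha> I" by (rule diagram_functional_weight)
  obtain a where a: "0 < a" "a < 1" "bump a = a" "\<forall>s\<in>{-1..1}. bump s = s \<longrightarrow> s = a"
    using bump_fixpoint by blast
  obtain N :: "real^3 \<Rightarrow> nat" where N: "inj_on N (g ` double_points g)" "\<And>p. 3 < N p"
    using g.exists_labelling[of 3] by blast
  \<comment> \<open>The crossing of the two straight arcs stays in place, so \<open>p1\<close>
    serves for both curves.\<close>
  define p1 p2 p3 q2 q3 where pq: "p1 = \<psi> (0, 0)" "p2 = \<psi> (1 * a, 1 * a / 2)" "p3 = \<psi> (- 1 * a, 1 * a / 2)"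
    "q2 = \<psi> (-1 * a, -1 * a / 2)" "q3 = \<psi> (- (-1) * a, -1 * a / 2)"
  note G = RIII_curve_part[OF g.arcs_axioms _ a pq(1,2,3)]
  note H = RIII_curve_part[OF h.arcs_axioms _ a pq(1,4,5)]
  let ?P = "\<lambda>i::nat. if i < 3 then g.time i ` RIII_crossings (1 * a) i else {}"
  let ?Q = "\<lambda>i::nat. if i < 3 then h.time i ` RIII_crossings (-1 * a) i else {}"
  define X where "X i = (if \<sigma> i = 1 then RIII_chunk (chart_sign \<psi>) \<sigma> i else rev (RIII_chunk (chart_sign \<psi>) \<sigma> i))" for i
  have sg: "\<sigma> 0 \<in> {-1, 1}" "\<sigma> 1 \<in> {-1, 1}" "\<sigma> 2 \<in> {-1, 1}"
    using h.sigma[of 0] h.sigma[of 1] h.sigma[of 2] by simp_all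
  have partg: "curve_part g (relabel N p1 p2 p3) (?P i) = X i" if "i < 3" for i
    using G(2)[of i N] that by (simp add: X_def)
  have parth: "curve_part h (relabel N p1 q2 q3) (?Q i) = rev (X i)" if "i < 3" for i
    using H(2)[of i N] that h.sigma_cases[OF that] by (auto simp: X_def)
  have *: ?thesis
    if i: "(i1, i2, i3) \<in> {(0, 1, 2), (1, 2, 0), (2, 0, 1), (0, 2, 1), (2, 1, 0), (1, 0, 2)}"
      and ord: "r i1 < l i2" "r i2 < l i3" for i1 i2 i3
  proof (rule curve_combination_arcs[of i1 i2 i3 l r ?P ?Q N p1 p2 p3 p1 q2 q3])
    have i3: "i1 < 3" "i2 < 3" "i3 < 3" using i by auto
    show "{..<3} \<subseteq> {i1, i2, i3}" using i by (auto simp: less_3_cases)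
    show "l i \<le> r i \<and> (if i < 3 then l i = l i \<and> r i = r i else 1 < l i)" if "i \<in> {i1, i2, i3}" for i
      using that i3 g.interval[of i] by auto
    show "double_points g \<inter> {l i..r i} = ?P i" if "i < 3" for i
      using G(1)[of i] that by simp
    show "double_points h \<inter> {l i..r i} = ?Q i" if "i < 3" for i
      using H(1)[of i] that by simp
    show "g t \<in> {p1, p2, p3}" if "i < 3" "t \<in> ?P i" for i t
      using G(3)[of i t] that by simp
    show "h t \<in> {p1, q2, q3}" if "i < 3" "t \<in> ?Q i" for i t
      using H(3)[of i t] that by simp
    show "p1 \<in> \<psi> ` model_square" "p2 \<in> \<psi> ` model_square" "p3 \<in> \<psi> ` model_square"
      "p1 \<in> \<psi> ` model_square" "q2 \<in> \<psi> ` model_square" "q3 \<in> \<psi> ` model_square"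
      using G(4-6)[of 0] H(5,6)[of 0] by simp_all
    have "exchangeable \<phi> (X i1) (X i2) (X i3) (rev (X i1)) (rev (X i2)) (rev (X i3))"
      by (rule exchangeable_RIII_chunks[OF sg square_chart_frame(1)[OF h.chart] strong weak X_def i])
    then show "exchangeable \<phi> (curve_part g (relabel N p1 p2 p3) (?P i1))
        (curve_part g (relabel N p1 p2 p3) (?P i2)) (curve_part g (relabel N p1 p2 p3) (?P i3))
        (curve_part h (relabel N p1 q2 q3) (?Q i1)) (curve_part h (relabel N p1 q2 q3) (?Q i2))
        (curve_part h (relabel N p1 q2 q3) (?Q i3))"
      unfolding partg[OF i3(1)] partg[OF i3(2)] partg[OF i3(3)]
        parth[OF i3(1)] parth[OF i3(2)] parth[OF i3(3)] .
  qed (use N ord in auto)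
  have ivl: "l 0 < r 0" "l 1 < r 1" "l 2 < r 2"
    using h.interval[of 0] h.interval[of 1] h.interval[of 2] by auto
  have o: "r 0 < l 1 \<or> r 1 < l 0" "r 0 < l 2 \<or> r 2 < l 0" "r 1 < l 2 \<or> r 2 < l 1"
    using h.interval_order[of 0 1] h.interval_order[of 0 2] h.interval_order[of 1 2] by auto
  \<comment> \<open>Of the eight outcomes of the pairwise comparisons, the two cyclic ones
    contradict \<open>l i < r i\<close>; the other six are the orders of the arcs.\<close>
  have "(r 0 < l 1 \<and> r 1 < l 2) \<or> (r 1 < l 2 \<and> r 2 < l 0) \<or> (r 2 < l 0 \<and> r 0 < l 1) \<or>
      (r 0 < l 2 \<and> r 2 < l 1) \<or> (r 2 < l 1 \<and> r 1 < l 0) \<or> (r 1 < l 0 \<and> r 0 < l 2)"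
    using o ivl by argo
  then show ?thesis
    using *[of 0 1 2] *[of 1 2 0] *[of 2 0 1] *[of 0 2 1] *[of 2 1 0] *[of 1 0 2] by blast
qed

section \<open>Invariance\<close>

lemma curve_combination_elementary_move:
  assumes g: "spherical_curve g" and h: "spherical_curve h" and m: "elementary_move j g h"
    and rel: "\<And>r. r \<in> relators j \<Longrightarrow> weight x \<alpha> I r = 0"
  shows "curve_combination x \<alpha> I g = curve_combination x \<alpha> I h"
proof (cases j)
  case RI
  then obtain \<sigma> where "local_change RI_before RI_after \<sigma> g h" using m by auto
  then show ?thesis using g h by (rule curve_combination_RI) (use rel RI in simp)
next
  case strong_RII
  then obtain \<sigma> where "coherent_bigon \<sigma>" "local_change RII_before RII_after \<sigma> g h" using m by auto
  then show ?thesis using g h rel strong_RII by (intro curve_combination_RII[of \<sigma>]) auto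
next
  case weak_RII
  then obtain \<sigma> where "\<not> coherent_bigon \<sigma>" "local_change RII_before RII_after \<sigma> g h" using m by auto
  then show ?thesis using g h rel weak_RII by (intro curve_combination_RII[of \<sigma>]) auto
next
  case strong_RIII
  then obtain \<sigma> where "coherent_triangle \<sigma>" "local_change RIII_before RIII_after \<sigma> g h" using m by auto
  then show ?thesis using g h rel strong_RIII by (intro curve_combination_RIII[of \<sigma>]) auto
next
  case weak_RIII
  then obtain \<sigma> where "\<not> coherent_triangle \<sigma>" "local_change RIII_before RIII_after \<sigma> g h" using m by auto
  then show ?thesis using g h rel weak_RIII by (intro curve_combination_RIII[of \<sigma>]) auto
qed

text \<open>The conditions on double points refer to the half-open period, which
  \<open>t \<mapsto> - t\<close> does not preserve; following it by \<open>frac\<close> maps the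
  period injectively into itself without changing points or velocities of \<open>g\<close>.\<close>

lemma spherical_curve_reversed:
  assumes "spherical_curve g"
  shows "spherical_curve (reversed g)"
proof -
  interpret curve g using assms by unfold_locales
  let ?\<tau> = "\<lambda>t::real. frac (- t)"
  have vel: "(reversed g has_vector_derivative - velocity g (- t)) (at t)" for t
  proof -
    have "(uminus has_vector_derivative - 1) (at t)" by (auto intro!: derivative_eq_intros)
    then have "((g \<circ> uminus) has_vector_derivative (- 1) *\<^sub>R velocity g (- t)) (at t)"
      by (rule vector_diff_chain_at) (rule has_velocity)
    then show ?thesis by (simp add: reversed_def o_def)
  qed
  then have velocity: "velocity (reversed g) t = - velocity g (- t)" for t
    by (rule vector_derivative_at)
  have \<tau>: "?\<tau> t \<in> {0..<1}" for t by (simp add: frac_lt_1)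
  have rev\<tau>: "reversed g t = g (?\<tau> t)" "velocity (reversed g) t = - velocity g (?\<tau> t)" for t
    by (simp_all add: frac_simps velocity) (simp add: reversed_def)
  have inj: "?\<tau> s = ?\<tau> t \<longleftrightarrow> s = t" if "s \<in> {0..<1}" "t \<in> {0..<1}" for s t
    using that by (simp add: frac_neg_eq_iff)
  have cont: "continuous_on UNIV (velocity g)"
    using assms by (simp add: spherical_curve_def C1_differentiable_on_eq)
  have C1: "reversed g C1_differentiable_on UNIV"
    unfolding C1_differentiable_on_def
  proof (intro exI conjI ballI)
    show "(reversed g has_vector_derivative - velocity g (- t)) (at t)" for t by (rule vel)
    show "continuous_on UNIV (\<lambda>t. - velocity g (- t))"
      by (intro continuous_intros continuous_on_compose2[OF cont]) auto
  qed
  have fin: "finite (double_points (reversed g))"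
  proof (rule inj_on_finite[of ?\<tau>])
    show "inj_on ?\<tau> (double_points (reversed g))"
      by (rule inj_onI) (simp add: inj double_points_def)
    show "?\<tau> ` double_points (reversed g) \<subseteq> double_points g"
    proof
      fix u assume "u \<in> ?\<tau> ` double_points (reversed g)"
      then obtain t where u: "u = ?\<tau> t" and "t \<in> double_points (reversed g)" by blast
      then obtain s where "t \<in> {0..<1}" "s \<in> {0..<1}" "s \<noteq> t" "reversed g s = reversed g t"
        by (blast elim: double_pointE)
      then show "u \<in> double_points g"
        unfolding u using \<tau> inj by (intro double_pointI[of "?\<tau> t" "?\<tau> s"]) (simp_all add: rev\<tau>)
    qed
  qed (rule finite_double_points)
  have col: "collinear {0, - u, - v} \<longleftrightarrow> collinear {0, u, v}" for u v :: "real^3"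
    by (simp flip: cross_eq_0)
  show ?thesis
    unfolding spherical_curve_def
  proof (intro conjI allI ballI impI)
    show "reversed g (t + 1) = reversed g t" for t
      using periodic[of "- t" "- 1"] by (simp add: reversed_def)
    show "range (reversed g) \<subseteq> sphere 0 1" using on_sphere by (auto simp: reversed_def)
    show "velocity (reversed g) t \<noteq> 0" for t
      using assms by (simp add: velocity spherical_curve_def)
    show "r = s \<or> s = t \<or> r = t"
      if "r \<in> {0..<1}" "s \<in> {0..<1}" "t \<in> {0..<1}" "reversed g r = reversed g s \<and> reversed g s = reversed g t"
      for r s t
      using no_triple[OF \<tau> \<tau> \<tau>, of r t s] that by (auto simp: rev\<tau> inj)
    show "\<not> collinear {0, velocity (reversed g) s, velocity (reversed g) t}"
      if "s \<in> {0..<1}" "t \<in> {0..<1}" "s \<noteq> t \<and> reversed g s = reversed g t" for s t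
    proof -
      have "?\<tau> s \<noteq> ?\<tau> t" "g (?\<tau> s) = g (?\<tau> t)" using that by (simp_all add: inj rev\<tau>)
      then have "\<not> collinear {0, velocity g (?\<tau> s), velocity g (?\<tau> t)}"
        using assms \<tau>[of s] \<tau>[of t] unfolding spherical_curve_def by blast
      then show ?thesis unfolding rev\<tau>(2) col .
    qed
  qed (fact C1 fin)+
qed

theorem theorem1:
  fixes b d :: nat and \<epsilon> :: "deformation \<Rightarrow> nat" and \<alpha> :: "nat \<Rightarrow> int"
    and x :: "nat \<Rightarrow> diagram"
  assumes "2 \<le> b" and "b \<le> d"
    and "diagram_enumeration x"
    and "\<forall>j. \<epsilon> j \<in> {0, 1}"
    and "\<forall>j. \<epsilon> j = 1 \<longrightarrow>
           (\<forall>r\<in>relators_between j b d.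
              (\<Sum>i = n_check (b - 1) + 1..n_check d. \<alpha> i * tilde (x i) r) = 0)"
  shows "oriented_invariant {j. \<epsilon> j = 1}
           (curve_combination x \<alpha> {n_check (b - 1) + 1..n_check d}) \<and>
         ((\<forall>i\<in>{n_check (b - 1) + 1..n_check d}. \<forall>j\<in>{n_check (b - 1) + 1..n_check d}.
             mirroring_pair (x i) (x j) \<longrightarrow> \<alpha> i = \<alpha> j \<or> reflective_pair (x i) (x j)) \<longrightarrow>
          unoriented_invariant {j. \<epsilon> j = 1}
            (curve_combination x \<alpha> {n_check (b - 1) + 1..n_check d}))"
proof -
  let ?I = "{n_check (b - 1) + 1..n_check d}"
  let ?F = "curve_combination x \<alpha> ?I"
  have b: "0 < b" using assms(1) by simp
  have rel: "weight x \<alpha> ?I r = 0" if "\<epsilon> j = 1" "r \<in> relators j" for j r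
    using weight_eq_0[OF assms(3) b assms(2) _ that(2)] assms(5) that(1) by blast
  have same: "?F g = ?F h" if "spherical_curve g" "spherical_curve h" "same_curve g h" for g h
    using curve_diagram_same_curve[OF that] by (simp add: curve_combination_def curve_count_def)
  have oriented: "oriented_invariant {j. \<epsilon> j = 1} ?F"
    unfolding oriented_invariant_def
  proof (intro allI impI conjI ballI)
    fix g g' assume "spherical_curve g \<and> spherical_curve g'"
    then have g: "spherical_curve g" "spherical_curve g'" by simp_all
    show "?F g = ?F g'" if "same_curve g g'" using same[OF g that] .
    fix j assume j: "j \<in> {j. \<epsilon> j = 1}" and "related_by_deformation j g g'"
    then obtain h h' where h: "spherical_curve h" "spherical_curve h'" "same_curve g h" "same_curve h' g'"
      and move: "elementary_move j h h' \<or> elementary_move j h' h"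
      unfolding related_by_deformation_def by blast
    have "?F h = ?F h'"
      using move
    proof
      assume "elementary_move j h h'"
      then show ?thesis using h rel j by (intro curve_combination_elementary_move[of _ _ j]) auto
    next
      assume "elementary_move j h' h"
      then show ?thesis
        using h rel j by (intro curve_combination_elementary_move[of _ _ j, symmetric]) auto
    qed
    then show "?F g = ?F g'" using same[OF g(1) h(1,3)] same[OF h(2) g(2) h(4)] by simp
  qed
  have reversal: "?F (reversed g) = ?F g"
    if mir: "\<forall>i\<in>?I. \<forall>j\<in>?I. mirroring_pair (x i) (x j) \<longrightarrow> \<alpha> i = \<alpha> j \<or> reflective_pair (x i) (x j)"
      and g: "spherical_curve g" for g
  proof -
    interpret curve g using g by unfold_locales
    obtain N :: "real^3 \<Rightarrow> nat" where N: "inj_on N (g ` double_points g)" "\<And>p. 0 < N p"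
      using exists_labelling[of 0] by blast
    show ?thesis
    proof (rule curve_combination_reversed[OF assms(3) b assms(2) refl])
      show "curve_diagram g = arrow_diagram (labelled_word N)"
        using N(1) by (rule curve_diagram_labelled_word)
      show "curve_diagram (reversed g) = arrow_diagram (rev (labelled_word N))"
        using g spherical_curve_reversed[OF g] N(1) by (rule curve_diagram_reversed)
      show "oriented_gauss_word (labelled_word N)"
        using N by (intro oriented_gauss_word_labelled_word) auto
    qed (use g mir in blast)+
  qed
  show ?thesis
    using oriented reversal unfolding unoriented_invariant_def by blast
qed

end
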